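(* Let $s$ be a composition and $\mathrm h$ an admissible height function for the DKK triangulation of $\mathcal F_{\mathcal O(s)}(\mathbf i)$. The face poset of the polyhedral complex $\mathrm{Perm}_s(\mathrm h)\subset\mathbb R^n$ is isomorphic to the face poset of the combinatorial $s$-permutahedron.
   Context: $s=(s_1,\dots,s_n)$ positive integers, $s_{n+1}:=2$. Graph $\mathcal O(s)$: vertices $v_{-1},\dots,v_n$; source edges $e^i_1,\dots,e^i_{s_i-1}$ from $v_{-1}$ to $v_{n+1-i}$ ($i\in[n+1]$); bump $e^i_0$ and dip $e^i_{s_i}$ from $v_{n-i}$ to $v_{n+1-i}$ ($i\in[n]$); framing: incoming at $v_{n+1-i}$: $e^i_0\prec e^i_1\prec\cdots\prec e^i_{s_i}$; outgoing at $v_{n+1-i}$: $e^{i-1}_0\prec e^{i-1}_{s_{i-1}}$. Routes: paths $v_{-1}\to v_n$; $R(k,t,\delta)$ ($k\in[n+1]$, $t\in[s_k-1]$, $\delta\in\{0,1\}^{k-1}$) has edges $e^k_t,e^{k-1}_{\delta_{k-1}s_{k-1}},\dots,e^1_{\delta_1s_1}$. Routes $P,Q$ are coherent if on each maximal common subpath $v_a\cdots v_b$ ($v_a\ne v_{-1}$, $v_b\neq v_n$), $P$'s entering edge at $v_a$ precedes $Q$'s iff $P$'s leaving edge at $v_b$ precedes $Q$'s. $\mathcal F_{\mathcal O(s)}(\mathbf i)=\mathrm{conv}\{\mathbf 1_R\}$ (unit flows $v_{-1}\to v_n$); its DKK triangulation consists of simplices $\mathrm{conv}\{\mathbf 1_R:R\in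 C\}$ for pairwise coherent $C$. $\mathrm h$ (routes $\to\mathbb R$) is admissible if lifting $\mathbf 1_R$ to height $\mathrm h(R)$ and projecting lower faces gives the DKK triangulation. For $k\in[2,n+1]$, $t\in[s_k-1]$ let $F^k_t(\mathbf x)=\min_{\delta\in\{0,1\}^{k-1}}\big(\mathrm h(R(k,t,\delta))+\sum_{i\in[k-1]}\delta_ix_i\big)$ for $\mathbf x\in\mathbb R^n$; its tropical hypersurface $\mathcal T(F^k_t)$ is the set of $\mathbf x$ where the minimum is attained at least twice. The arrangement of these hypersurfaces induces a polyhedral complex on $\mathbb R^n$ (the common refinement of the subdivisions of $\mathbb R^n$ according to which terms attain each minimum); $\mathrm{Perm}_s(\mathrm h)$ is its subcomplex of bounded cells. Combinatorial $s$-permutahedron: Stirling $s$-permutations are rearrangements of $1^{s_1}\cdots n^{s_n}$ avoiding $121$; $B_a$ is the shortest factor containing all $a$'s; for $a<c$, $|(c,a)_w|$ = number of $c$'s before $B_a$; $s$-weak order: $w\le w'$ iff $|(c,a)_w|\le|(c,a)_{w'}|$ for all $a<c$. An ascent of $w$ is a pair $(a,c)$, $a<c$, with $ac$ a factor of $w$, and then the transposition of $w=u_1B_acu_2$ along it is $u_1cB_au_2$; $w+A$ is the join of $w$ and its transpositions along the ascents in $A$. Faces are pairs $(w,A)$ with $A$ a set of ascents of $w$, and $(w,A)\le(w',A')$ iff $[w,w+A]\subseteq[w',w'+A']$. *)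

theory Defs
  imports
    "HOL-Analysis.Analysis"
    "HOL-Analysis.Finite_Function_Topology"
    "HOL-Library.Multiset"
    "HOL-Library.FuncSet"
begin

section \<open>The oruga graph and its framing\<close>

text \<open>
  A composition \<open>s = (s\<^sub>1, ..., s\<^sub>n)\<close> is a list of positive naturals with \<open>n = length s\<close>.
  The pair \<open>(i, j)\<close> stands for the edge with superscript \<open>i\<close> and subscript \<open>j\<close>, and the integer
  \<open>a\<close> for the vertex \<open>v\<^sub>a\<close>.
\<close>

type_synonym edge = "nat \<times> nat"

definition part :: "nat list \<Rightarrow> nat \<Rightarrow> nat" where
  "part s i = (s @ [2]) ! (i - 1)"

definition edges :: "nat list \<Rightarrow> edge set" where
  "edges s =
     {(i, j). i \<in> {1..length s + 1} \<and> j \<in> {1..part s i - 1}} \<union>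
     {(i, j). i \<in> {1..length s} \<and> j \<in> {0, part s i}}"

definition edge_source :: "nat list \<Rightarrow> edge \<Rightarrow> int" where
  "edge_source s e =
     (if snd e = 0 \<or> snd e = part s (fst e) then int (length s) - int (fst e) else -1)"

definition edge_target :: "nat list \<Rightarrow> edge \<Rightarrow> int" where
  "edge_target s e = int (length s) + 1 - int (fst e)"

text \<open>
  The incoming edges at an inner vertex all have the same superscript and are ordered by subscript,
  and so are the outgoing ones; hence one relation describes both parts of the framing.
\<close>

definition edge_prec :: "edge \<Rightarrow> edge \<Rightarrow> bool" where
  "edge_prec e f \<longleftrightarrow> fst e = fst f \<and> snd e < snd f"

definition routes :: "nat list \<Rightarrow> edge list set" where
  "routes s =
     {P. P \<noteq> [] \<and> set P \<subseteq> edges s \<and>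
         edge_source s (hd P) = -1 \<and> edge_target s (last P) = int (length s) \<and>
         successively (\<lambda>e f. edge_target s e = edge_source s f) P}"

definition bits :: "nat \<Rightarrow> (nat \<Rightarrow> nat) set" where
  "bits k = {1..<k} \<rightarrow>\<^sub>E {0, 1}"

definition route :: "nat list \<Rightarrow> nat \<Rightarrow> nat \<Rightarrow> (nat \<Rightarrow> nat) \<Rightarrow> edge list" where
  "route s k t \<delta> = (k, t) # map (\<lambda>i. (i, \<delta> i * part s i)) (rev [1..<k])"

text \<open>
  Here \<open>M\<close> is the edge list of a maximal common subpath, entered by \<open>e\<close> and \<open>e'\<close> and left by
  \<open>f\<close> and \<open>f'\<close>; the existence of these edges says that it does not start at the first or end at the
  last vertex of the graph. The subpath may be a single vertex (\<open>M = []\<close>), in which case the equality of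
  targets says that both routes pass through it.
\<close>

definition coherent :: "nat list \<Rightarrow> edge list \<Rightarrow> edge list \<Rightarrow> bool" where
  "coherent s P Q \<longleftrightarrow>
     (\<forall>P1 e M f P2 Q1 e' f' Q2.
        P = P1 @ [e] @ M @ [f] @ P2 \<and> Q = Q1 @ [e'] @ M @ [f'] @ Q2 \<and>
        edge_target s e = edge_target s e' \<and> e \<noteq> e' \<and> f \<noteq> f' \<longrightarrow>
        (edge_prec e e' \<longleftrightarrow> edge_prec f f'))"


section \<open>Flow polytope, DKK triangulation and admissible heights\<close>

text \<open>
  Vectors indexed by edges are finitely supported functions; the flow polytope is the convex hull of
  the vectors \<open>route_vec R\<close> for \<open>R \<in> routes s\<close>.
\<close>

definition route_vec :: "edge list \<Rightarrow> edge \<Rightarrow>\<^sub>0 real" where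
  "route_vec R = (\<Sum>e\<in>set R. Poly_Mapping.single e 1)"

definition dkk_triangulation :: "nat list \<Rightarrow> (edge \<Rightarrow>\<^sub>0 real) set set" where
  "dkk_triangulation s =
     {convex hull (route_vec ` C) | C.
        C \<noteq> {} \<and> C \<subseteq> routes s \<and> (\<forall>P\<in>C. \<forall>Q\<in>C. coherent s P Q)}"

text \<open>
  Lower faces are the faces minimizing a linear functional that is positive on the height direction.
\<close>

definition lower_face :: "('v::real_vector \<times> real) set \<Rightarrow> ('v \<times> real) set \<Rightarrow> bool" where
  "lower_face F P \<longleftrightarrow>
     F \<noteq> {} \<and>
     (\<exists>\<phi> :: 'v \<times> real \<Rightarrow> real. linear \<phi> \<and> 0 < \<phi> (0, 1) \<and> F = {p \<in> P. \<forall>q\<in>P. \<phi> p \<le> \<phi> q})"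

definition regular_subdivision ::
    "nat list \<Rightarrow> (edge list \<Rightarrow> real) \<Rightarrow> (edge \<Rightarrow>\<^sub>0 real) set set" where
  "regular_subdivision s h =
     {fst ` F | F. lower_face F (convex hull ((\<lambda>R. (route_vec R, h R)) ` routes s))}"

definition admissible :: "nat list \<Rightarrow> (edge list \<Rightarrow> real) \<Rightarrow> bool" where
  "admissible s h \<longleftrightarrow> regular_subdivision s h = dkk_triangulation s"


section \<open>The complex of bounded cells of the tropical arrangement\<close>

text \<open>\<open>Rn n\<close> is \<open>\<real>\<^sup>n\<close>, with coordinates indexed by \<open>1, ..., n\<close>.\<close>

definition Rn :: "nat \<Rightarrow> (nat \<Rightarrow>\<^sub>0 real) set" where
  "Rn n = {x. Poly_Mapping.keys x \<subseteq> {1..n}}"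

definition trop_term ::
    "nat list \<Rightarrow> (edge list \<Rightarrow> real) \<Rightarrow> nat \<Rightarrow> nat \<Rightarrow> (nat \<Rightarrow>\<^sub>0 real) \<Rightarrow> (nat \<Rightarrow> nat) \<Rightarrow> real" where
  "trop_term s h k t x \<delta> =
     h (route s k t \<delta>) + (\<Sum>i\<in>{1..<k}. real (\<delta> i) * Poly_Mapping.lookup x i)"

definition trop_poly ::
    "nat list \<Rightarrow> (edge list \<Rightarrow> real) \<Rightarrow> nat \<Rightarrow> nat \<Rightarrow> (nat \<Rightarrow>\<^sub>0 real) \<Rightarrow> real" where
  "trop_poly s h k t x = Min (trop_term s h k t x ` bits k)"

text \<open>
  The terms attaining the minimum at \<open>x\<close>; the tropical hypersurface consists of the points with at
  least two of them.
\<close>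

definition min_terms ::
    "nat list \<Rightarrow> (edge list \<Rightarrow> real) \<Rightarrow> nat \<Rightarrow> nat \<Rightarrow> (nat \<Rightarrow>\<^sub>0 real) \<Rightarrow> (nat \<Rightarrow> nat) set" where
  "min_terms s h k t x = {\<delta> \<in> bits k. trop_term s h k t x \<delta> = trop_poly s h k t x}"

text \<open>
  The closed cells of the subdivision of \<open>\<real>\<^sup>n\<close> by a single tropical hypersurface: the points at which
  (at least) the terms minimal at \<open>x\<close> are minimal.
\<close>

definition trop_subdivision ::
    "nat list \<Rightarrow> (edge list \<Rightarrow> real) \<Rightarrow> nat \<Rightarrow> nat \<Rightarrow> (nat \<Rightarrow>\<^sub>0 real) set set" where
  "trop_subdivision s h k t =
     {{y \<in> Rn (length s). min_terms s h k t x \<subseteq> min_terms s h k t y} | x. x \<in> Rn (length s)}"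

definition trop_indices :: "nat list \<Rightarrow> (nat \<times> nat) set" where
  "trop_indices s = {(k, t). k \<in> {2..length s + 1} \<and> t \<in> {1..part s k - 1}}"

text \<open>
  Common refinement: the nonempty intersections of one cell from each subdivision. Intersecting with
  \<open>\<real>\<^sup>n\<close> only matters when there are no hypersurfaces (\<open>n = 0\<close>).
\<close>

definition arrangement_complex ::
    "nat list \<Rightarrow> (edge list \<Rightarrow> real) \<Rightarrow> (nat \<Rightarrow>\<^sub>0 real) set set" where
  "arrangement_complex s h =
     {C. C \<noteq> {} \<and>
         (\<exists>c. (\<forall>(k, t) \<in> trop_indices s. c (k, t) \<in> trop_subdivision s h k t) \<and>
              C = Rn (length s) \<inter> (\<Inter>p \<in> trop_indices s. c p))}"

definition Perm :: "nat list \<Rightarrow> (edge list \<Rightarrow> real) \<Rightarrow> (nat \<Rightarrow>\<^sub>0 real) set set" where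
  "Perm s h = {C \<in> arrangement_complex s h. bounded C}"


section \<open>The combinatorial s-permutahedron\<close>

definition stirling_perms :: "nat list \<Rightarrow> nat list set" where
  "stirling_perms s =
     {w. mset w = (\<Sum>i\<in>{1..length s}. replicate_mset (part s i) i) \<and>
         \<not> (\<exists>p q r. p < q \<and> q < r \<and> r < length w \<and> w ! p = w ! r \<and> w ! p < w ! q)}"

text \<open>
  The decomposition of a word into the parts before, inside and after the \<open>a\<close>-block, i.e. the shortest
  factor containing all letters \<open>a\<close>, which extends from the first to the last \<open>a\<close>.
\<close>

definition before_block :: "nat list \<Rightarrow> nat \<Rightarrow> nat list" where
  "before_block w a = takeWhile (\<lambda>x. x \<noteq> a) w"

definition block :: "nat list \<Rightarrow> nat \<Rightarrow> nat list" where
  "block w a = rev (dropWhile (\<lambda>x. x \<noteq> a) (rev (dropWhile (\<lambda>x. x \<noteq> a) w)))"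

definition after_block :: "nat list \<Rightarrow> nat \<Rightarrow> nat list" where
  "after_block w a = rev (takeWhile (\<lambda>x. x \<noteq> a) (rev w))"

definition inversions :: "nat list \<Rightarrow> nat \<Rightarrow> nat \<Rightarrow> nat" where
  "inversions w c a = count_list (before_block w a) c"

definition weak_le :: "nat list \<Rightarrow> nat list \<Rightarrow> nat list \<Rightarrow> bool" where
  "weak_le s w w' \<longleftrightarrow>
     (\<forall>a c. 1 \<le> a \<and> a < c \<and> c \<le> length s \<longrightarrow> inversions w c a \<le> inversions w' c a)"

definition weak_interval :: "nat list \<Rightarrow> nat list \<Rightarrow> nat list \<Rightarrow> nat list set" where
  "weak_interval s u v = {z \<in> stirling_perms s. weak_le s u z \<and> weak_le s z v}"

definition weak_join :: "nat list \<Rightarrow> nat list set \<Rightarrow> nat list" where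
  "weak_join s U =
     (THE z. z \<in> stirling_perms s \<and> (\<forall>u\<in>U. weak_le s u z) \<and>
             (\<forall>y\<in>stirling_perms s. (\<forall>u\<in>U. weak_le s u y) \<longrightarrow> weak_le s z y))"

definition ascents :: "nat list \<Rightarrow> (nat \<times> nat) set" where
  "ascents w = {(a, c). a < c \<and> (\<exists>u v. w = u @ [a, c] @ v)}"

text \<open>
  For an ascent \<open>(a, c)\<close> the letter \<open>a\<close> of the factor \<open>ac\<close> is the last one, since a further \<open>a\<close> would give
  a pattern 121; so \<open>c\<close> is the first letter after the \<open>a\<close>-block.
\<close>

definition transpose_ascent :: "nat list \<Rightarrow> nat \<times> nat \<Rightarrow> nat list" where
  "transpose_ascent w = (\<lambda>(a, c). before_block w a @ [c] @ block w a @ tl (after_block w a))"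

definition join_ascents :: "nat list \<Rightarrow> nat list \<Rightarrow> (nat \<times> nat) set \<Rightarrow> nat list" where
  "join_ascents s w A = weak_join s (insert w (transpose_ascent w ` A))"

definition perm_faces :: "nat list \<Rightarrow> (nat list \<times> (nat \<times> nat) set) set" where
  "perm_faces s = {(w, A). w \<in> stirling_perms s \<and> A \<subseteq> ascents w}"

definition perm_face_le ::
    "nat list \<Rightarrow> nat list \<times> (nat \<times> nat) set \<Rightarrow> nat list \<times> (nat \<times> nat) set \<Rightarrow> bool" where
  "perm_face_le s = (\<lambda>(w, A) (w', A').
     weak_interval s w (join_ascents s w A) \<subseteq> weak_interval s w' (join_ascents s w' A'))"

end

theory Submission
  imports Defs
begin

text \<open>
  Write a route as the list of its subscripts. Coherence of two routes then says that the subscripts at their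
  common levels are comparable, so a clique is a chain. A cell of the arrangement is determined by the routes
  whose terms are minimal on it, and admissibility turns these sets into the cliques using every source edge;
  the cell is bounded iff every bump and dip is used as well. Reading subscripts as letter counts, a clique that
  uses all edges is a chain of prefixes of a Stirling permutation \<open>w\<close> in which only prefixes ending inside an
  ascent of \<open>w\<close> are missing: a pair \<open>(w, A)\<close>. A route comes from a prefix of \<open>z\<close> iff its subscripts bound
  the inversion numbers of \<open>z\<close> suitably from both sides, so the permutations \<open>z\<close> whose prefixes give all routes
  of the clique form an interval of the weak order. It starts at \<open>w\<close>, and it ends at the join \<open>w + A\<close>, which is
  obtained by reversing the clique.
\<close>

section \<open>Routes as chains of subscripts\<close>

text \<open>Two obstacles shape the proof. Routes have different lengths and are compared only on
  the levels they share, so \<open>route_le\<close> is not transitive on all routes; inside a clique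
  it is, because a cycle of three comparisons forces equality (\<open>route_le_cycle\<close>).
  Secondly, \<open>w + A\<close> is a definite description, and no lattice property of the weak
  order is assumed: the join has to be exhibited. Reversal does this, since exchanging bumps with
  dips corresponds to reading words backwards and turns lower bounds on inversion numbers into upper
  ones. On the polyhedral side a linear functional is a potential on the edges plus a multiple of
  the height. On routes with source edge (k, t) it equals the tropical term, up to scaling and a
  constant depending only on (k, t), if x_i is the potential of the dip minus that of the bump.
  Starting from a point, the potentials of the source edges are chosen so that every minimum becomes
  0. Starting from a face, the minima for the various source edges all equal the global minimum
  because the clique uses every source edge.\<close>

definition edge_path :: "nat \<Rightarrow> (nat \<Rightarrow> nat) \<Rightarrow> edge list" where
  "edge_path k c = map (\<lambda>i. (i, c i)) (rev [1..<Suc k])"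

text \<open>Routes are listed from the highest superscript down to 1, so the edge with superscript
  \<open>i\<close> has index \<open>length P - i\<close>.\<close>

definition entry :: "edge list \<Rightarrow> nat \<Rightarrow> nat" where
  "entry P i = snd (P ! (length P - i))"

definition route_le :: "edge list \<Rightarrow> edge list \<Rightarrow> bool" where
  "route_le P Q \<longleftrightarrow> (\<forall>i. 1 \<le> i \<and> i \<le> length P \<and> i \<le> length Q \<longrightarrow> entry P i \<le> entry Q i)"

lemma length_edge_path [simp]: "length (edge_path k c) = k"
  by (simp add: edge_path_def)

lemma entry_edge_path [simp]: "1 \<le> i \<Longrightarrow> i \<le> k \<Longrightarrow> entry (edge_path k c) i = c i"
  by (simp add: edge_path_def entry_def rev_nth del: upt_Suc)

lemma set_edge_path: "set (edge_path k c) = {(i, c i) |i. 1 \<le> i \<and> i \<le> k}"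
  by (auto simp: edge_path_def simp del: upt_Suc)

lemma edge_path_cong: "k = k' \<Longrightarrow> (\<And>i. 1 \<le> i \<Longrightarrow> i \<le> k \<Longrightarrow> c i = c' i) \<Longrightarrow> edge_path k c = edge_path k' c'"
  by (auto simp: edge_path_def simp del: upt_Suc)

lemma edge_path_Suc: "edge_path (Suc k) c = (Suc k, c (Suc k)) # edge_path k c"
  by (simp add: edge_path_def)

lemma edge_path_split:
  assumes "1 \<le> i" "i \<le> k"
  shows "edge_path k c = map (\<lambda>i. (i, c i)) (rev [Suc i..<Suc k]) @ [(i, c i)] @ edge_path (i - 1) c"
proof -
  have "[1..<Suc k] = [1..<i] @ [i] @ [Suc i..<Suc k]"
    using assms by (metis Suc_le_mono append_Cons append_Nil le_SucI le_add_diff_inverse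
        upt_add_eq_append upt_conv_Cons le_imp_less_Suc)
  then show ?thesis using assms by (simp add: edge_path_def del: upt_Suc)
qed

locale composition =
  fixes s :: "nat list"
  assumes pos: "\<And>i. i \<in> set s \<Longrightarrow> 0 < i"
begin

abbreviation "n \<equiv> length s"

lemma part_last [simp]: "part s (Suc n) = 2"
  by (simp add: part_def)

lemma part_pos: "1 \<le> i \<Longrightarrow> i \<le> Suc n \<Longrightarrow> 0 < part s i"
  using pos by (cases "i = Suc n") (auto simp: part_def nth_append)

text \<open>The strict bounds at level \<open>k\<close> exclude bump and dip: a route starts at
  v_{-1}, so its first edge is a source edge, and no later edge is.\<close>

definition flow_val :: "nat \<Rightarrow> (nat \<Rightarrow> nat) \<Rightarrow> bool" where
  "flow_val k c \<longleftrightarrow> 1 \<le> k \<and> k \<le> Suc n \<and> 0 < c k \<and> c k < part s k \<and>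
     (\<forall>i. 1 \<le> i \<and> i < k \<longrightarrow> c i = 0 \<or> c i = part s i)"

lemma edge_path_in_routes:
  assumes "flow_val k c"
  shows "edge_path k c \<in> routes s"
proof -
  have k: "1 \<le> k" "k \<le> Suc n" "0 < c k" "c k < part s k"
    and c: "\<And>i. 1 \<le> i \<Longrightarrow> i < k \<Longrightarrow> c i = 0 \<or> c i = part s i"
    using assms by (auto simp: flow_val_def)
  have suc: "successively (\<lambda>e f. edge_target s e = edge_source s f) (edge_path m c)" if "m \<le> k" for m
    using that
  proof (induction m)
    case (Suc m)
    show ?case
    proof (cases m)
      case 0 then show ?thesis by (simp add: edge_path_def)
    next
      case (Suc l)
      have "c m = 0 \<or> c m = part s m" using c[of m] Suc Suc.prems by simp
      then show ?thesis using Suc Suc.IH Suc.prems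
        by (auto simp: edge_path_Suc edge_target_def edge_source_def)
    qed
  qed (simp add: edge_path_def)
  have edg: "set (edge_path k c) \<subseteq> edges s"
  proof
    fix e assume "e \<in> set (edge_path k c)"
    then obtain i where i: "e = (i, c i)" "1 \<le> i" "i \<le> k" by (auto simp: set_edge_path)
    show "e \<in> edges s"
      using i k c[of i] by (cases "i = k") (auto simp: edges_def)
  qed
  have hd: "hd (edge_path k c) = (k, c k)" using k by (cases k) (auto simp: edge_path_Suc)
  have last: "last (edge_path k c) = (1, c 1)"
    using k by (simp add: edge_path_def last_map last_rev del: upt_Suc)
  have "edge_path k c \<noteq> []" using k by (metis length_edge_path list.size(3) not_one_le_zero)
  then show ?thesis
    using suc[of k] edg hd last k by (auto simp: routes_def edge_source_def edge_target_def)
qed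

text \<open>The induction peels off first edges, and a proper tail of a route starts at an inner
  vertex. Hence the condition on the source of the first edge is dropped here and nothing is claimed
  about the top entry.\<close>

lemma routes_edge_path_aux:
  assumes "P \<noteq> []" "set P \<subseteq> edges s" "edge_target s (last P) = int n"
    "successively (\<lambda>e f. edge_target s e = edge_source s f) P"
  shows "\<exists>c. P = edge_path (fst (hd P)) c \<and> 1 \<le> fst (hd P) \<and>
    (\<forall>i. 1 \<le> i \<and> i < fst (hd P) \<longrightarrow> c i = 0 \<or> c i = part s i)"
  using assms
proof (induction P)
  case (Cons e P)
  show ?case
  proof (cases P)
    case Nil
    then have "fst e = 1" using Cons.prems by (simp add: edge_target_def)
    then have e: "e # P = edge_path (fst e) (\<lambda>_. snd e)"
      using Nil by (cases e) (simp add: edge_path_def)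
    show ?thesis unfolding list.sel(1)
      by (intro exI[of _ "\<lambda>_. snd e"] conjI e) (use \<open>fst e = 1\<close> in auto)
  next
    case (Cons e' P')
    have "\<exists>c. P = edge_path (fst (hd P)) c \<and> 1 \<le> fst (hd P) \<and>
      (\<forall>i. 1 \<le> i \<and> i < fst (hd P) \<longrightarrow> c i = 0 \<or> c i = part s i)"
      using Cons Cons.IH Cons.prems by auto
    then obtain c where c: "P = edge_path (fst e') c" "1 \<le> fst e'"
      "\<And>i. 1 \<le> i \<Longrightarrow> i < fst e' \<Longrightarrow> c i = 0 \<or> c i = part s i"
      using Cons by auto
    \<comment> \<open>A nonnegative target is not v_{-1}, so \<open>e'\<close> is a bump or a
      dip.\<close>
    have "edge_target s e \<ge> 0" using Cons.prems by (auto simp: edges_def edge_target_def)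
    moreover have st: "edge_target s e = edge_source s e'" using Cons.prems Cons by simp
    ultimately have e': "snd e' = 0 \<or> snd e' = part s (fst e')"
      by (auto simp: edge_source_def split: if_splits)
    then have fe: "fst e = Suc (fst e')" using st by (auto simp: edge_source_def edge_target_def)
    have hd: "e' = (fst e', c (fst e'))"
      using c(1,2) Cons by (cases "fst e'") (auto simp: edge_path_Suc)
    have e1: "e # P = edge_path (fst e) (c(fst e := snd e))"
      using c(1) by (auto simp: edge_path_Suc fe prod_eq_iff intro!: edge_path_cong)
    have e2: "(c(fst e := snd e)) i = 0 \<or> (c(fst e := snd e)) i = part s i"
      if "1 \<le> i" "i < fst e" for i
      using that fe c(3)[of i] e' arg_cong[OF hd, of snd] by (cases "i = fst e'") auto
    show ?thesis unfolding list.sel(1)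
      by (intro exI[of _ "c(fst e := snd e)"] conjI e1) (use fe e2 in auto)
  qed
qed simp

lemma routes_iff: "P \<in> routes s \<longleftrightarrow> (\<exists>k c. flow_val k c \<and> P = edge_path k c)"
proof
  assume P: "P \<in> routes s"
  then obtain c where c: "P = edge_path (fst (hd P)) c" "1 \<le> fst (hd P)"
    "\<And>i. 1 \<le> i \<Longrightarrow> i < fst (hd P) \<Longrightarrow> c i = 0 \<or> c i = part s i"
    using routes_edge_path_aux[of P] by (auto simp: routes_def)
  define k where "k = fst (hd P)"
  have hd: "hd P = (k, c k)"
    using c(1,2) unfolding k_def[symmetric] by (cases k) (auto simp: edge_path_Suc)
  have "hd P \<in> edges s" "edge_source s (hd P) = -1" using P by (auto simp: routes_def)
  then have "k \<le> Suc n \<and> 0 < c k \<and> c k < part s k"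
    unfolding hd by (auto simp: edges_def edge_source_def split: if_splits)
  then have "flow_val k c" using c(2,3) by (auto simp: flow_val_def k_def)
  then show "\<exists>k c. flow_val k c \<and> P = edge_path k c" using c(1) k_def by auto
qed (auto intro: edge_path_in_routes)

lemma flow_val_cong:
  "flow_val k c \<Longrightarrow> (\<And>i. 1 \<le> i \<Longrightarrow> i \<le> k \<Longrightarrow> c i = c' i) \<Longrightarrow> flow_val k c'"
  by (auto simp: flow_val_def)

lemma route_flow_val: "P \<in> routes s \<Longrightarrow> flow_val (length P) (entry P)"
  by (auto simp: routes_iff intro: flow_val_cong)

lemma route_eq_edge_path: "P \<in> routes s \<Longrightarrow> P = edge_path (length P) (entry P)"
  by (auto simp: routes_iff intro: edge_path_cong)

lemma route_eqI:
  assumes "P \<in> routes s" "Q \<in> routes s" "length P = length Q"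
    "\<And>i. 1 \<le> i \<Longrightarrow> i \<le> length P \<Longrightarrow> entry P i = entry Q i"
  shows "P = Q"
  using assms route_eq_edge_path edge_path_cong by metis

lemma route_bounds:
  assumes "P \<in> routes s"
  shows "1 \<le> length P" "length P \<le> Suc n" "0 < entry P (length P)"
    "entry P (length P) < part s (length P)"
    "\<And>i. 1 \<le> i \<Longrightarrow> i < length P \<Longrightarrow> entry P i = 0 \<or> entry P i = part s i"
    "\<And>i. 1 \<le> i \<Longrightarrow> i \<le> length P \<Longrightarrow> entry P i \<le> part s i"
  using route_flow_val[OF assms] by (auto simp: flow_val_def) (metis le_neq_implies_less less_imp_le_nat order_refl zero_le)

lemma set_route: "P \<in> routes s \<Longrightarrow> set P = {(i, entry P i) |i. 1 \<le> i \<and> i \<le> length P}"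
  using route_eq_edge_path[of P] set_edge_path[of "length P" "entry P"] by simp

lemma finite_edges: "finite (edges s)"
proof (rule finite_subset)
  show "edges s \<subseteq> {0..Suc n} \<times> {0..Max (part s ` {0..Suc n})}"
    by (auto simp: edges_def intro!: Max_ge_iff[THEN iffD2]) (metis atLeastAtMost_iff diff_le_self le_trans le0)
qed auto

lemma finite_routes: "finite (routes s)"
proof (rule finite_subset)
  show "routes s \<subseteq> {P. set P \<subseteq> edges s \<and> length P \<le> Suc n}"
    using route_bounds(2) by (auto simp: routes_def)
  show "finite {P. set P \<subseteq> edges s \<and> length P \<le> Suc n}"
    by (rule finite_lists_length_le[OF finite_edges])
qed

section \<open>Coherence as comparability of subscripts\<close>

lemma edge_path_decomp:
  assumes "edge_path k c = P1 @ [e] @ M @ [f] @ P2"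
  shows "e = (fst e, c (fst e))" "f = (fst f, c (fst f))" "1 \<le> fst f" "fst e \<le> k"
    "fst e = fst f + length M + 1"
proof -
  have nth: "edge_path k c ! j = (k - j, c (k - j))" if "j < k" for j
    using that by (simp add: edge_path_def rev_nth Suc_diff_Suc del: upt_Suc)
  have len: "k = length P1 + length M + length P2 + 2"
    using arg_cong[OF assms, of length] by simp
  have "edge_path k c ! length P1 = e" by (simp add: assms)
  moreover have "edge_path k c ! (length P1 + 1 + length M) = f"
    unfolding assms by (simp add: nth_append)
  ultimately have e: "e = (k - length P1, c (k - length P1))"
    and f: "f = (k - (length P1 + 1 + length M), c (k - (length P1 + 1 + length M)))"
    using nth len by auto
  show "e = (fst e, c (fst e))" "f = (fst f, c (fst f))" "1 \<le> fst f" "fst e \<le> k"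
    "fst e = fst f + length M + 1"
    using e f len by auto
qed

text \<open>Two consecutive disagreements enclose a maximal common subpath, and coherence compares
  the edges entering and leaving it. For \<open>j = i - 1\<close> it is a single vertex and
  \<open>mid\<close> is empty.\<close>

lemma opposite_disagreement:
  assumes coh: "coherent s (edge_path k c) (edge_path k' c')"
    and ij: "1 \<le> j" "j < i" "i \<le> k" "i \<le> k'"
    and ne: "c i \<noteq> c' i" "c j \<noteq> c' j" and between: "\<And>l. j < l \<Longrightarrow> l < i \<Longrightarrow> c l = c' l"
  shows "c i < c' i \<longleftrightarrow> c j < c' j"
proof -
  define mid where "mid d = map (\<lambda>l. (l, d l)) (rev [Suc j..<i])" for d :: "nat \<Rightarrow> nat"
  have *: "edge_path m d = map (\<lambda>l. (l, d l)) (rev [Suc i..<Suc m]) @ [(i, d i)] @ mid d @ [(j, d j)] @ edge_path (j - 1) d"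
    if "i \<le> m" for m d
  proof -
    have "edge_path m d = map (\<lambda>l. (l, d l)) (rev [Suc i..<Suc m]) @ [(i, d i)] @ edge_path (i - 1) d"
      using edge_path_split[of i m d] that ij by simp
    also have "edge_path (i - 1) d = map (\<lambda>l. (l, d l)) (rev [Suc j..<Suc (i - 1)]) @ [(j, d j)] @ edge_path (j - 1) d"
      using ij by (intro edge_path_split) auto
    finally show ?thesis using ij by (simp add: mid_def)
  qed
  have mm: "mid c = mid c'" using between by (simp add: mid_def)
  have "edge_prec (i, c i) (i, c' i) \<longleftrightarrow> edge_prec (j, c j) (j, c' j)"
    using coh[unfolded coherent_def, rule_format] *[OF ij(3), of c] *[OF ij(4), of c', folded mm] ne
    by (auto simp: edge_target_def)
  then show ?thesis by (simp add: edge_prec_def)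
qed

text \<open>Coherence carries the sign of a disagreement to the next one, hence to all of them.
  Conversely, both ends of a maximal common subpath are disagreements at common levels, where
  \<open>route_le\<close> fixes the same sign.\<close>

lemma coherent_iff:
  assumes P: "P \<in> routes s" and Q: "Q \<in> routes s"
  shows "coherent s P Q \<longleftrightarrow> route_le P Q \<or> route_le Q P"
proof
  assume coh: "coherent s P Q"
  define c c' where "c = entry P" and "c' = entry Q"
  have PQ: "P = edge_path (length P) c" "Q = edge_path (length Q) c'"
    using P Q by (auto simp: c_def c'_def intro: route_eq_edge_path)
  let ?D = "{i. 1 \<le> i \<and> i \<le> length P \<and> i \<le> length Q}"
  \<comment> \<open>Disagreements that are not consecutive are linked through one in between, which
    shortens both gaps.\<close>
  have key: "i \<in> ?D \<Longrightarrow> j \<in> ?D \<Longrightarrow> j < i \<Longrightarrow> c i \<noteq> c' i \<Longrightarrow> c j \<noteq> c' j \<Longrightarrow> c i < c' i \<longleftrightarrow> c j < c' j" for i j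
  proof (induction "i - j" arbitrary: i j rule: less_induct)
    case less
    show ?case
    proof (cases "\<exists>l. j < l \<and> l < i \<and> c l \<noteq> c' l")
      case True
      then obtain l where l: "j < l" "l < i" "c l \<noteq> c' l" by auto
      then have "c i < c' i \<longleftrightarrow> c l < c' l" using less.prems by (intro less.hyps) auto
      moreover have "c l < c' l \<longleftrightarrow> c j < c' j" using l less.prems by (intro less.hyps) auto
      ultimately show ?thesis by simp
    next
      case False
      then show ?thesis
        using opposite_disagreement[of "length P" c "length Q" c' j i] coh PQ less.prems by auto
    qed
  qed
  show "route_le P Q \<or> route_le Q P"
  proof (rule ccontr)
    assume "\<not> (route_le P Q \<or> route_le Q P)"
    then obtain i j where "i \<in> ?D" "j \<in> ?D" "c' i < c i" "c j < c' j"
      by (auto simp: route_le_def c_def c'_def not_le)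
    then show False using key[of i j] key[of j i] by (cases i j rule: linorder_cases) auto
  qed
next
  assume le: "route_le P Q \<or> route_le Q P"
  define c c' where "c = entry P" and "c' = entry Q"
  have PQ: "P = edge_path (length P) c" "Q = edge_path (length Q) c'"
    using P Q by (auto simp: c_def c'_def intro: route_eq_edge_path)
  show "coherent s P Q"
    unfolding coherent_def
  proof (intro allI impI)
    fix P1 e M f P2 Q1 e' f' Q2
    assume *: "P = P1 @ [e] @ M @ [f] @ P2 \<and> Q = Q1 @ [e'] @ M @ [f'] @ Q2 \<and>
        edge_target s e = edge_target s e' \<and> e \<noteq> e' \<and> f \<noteq> f'"
    have ee: "fst e = fst e'" using * by (simp add: edge_target_def)
    have p: "edge_path (length P) c = P1 @ [e] @ M @ [f] @ P2"
      and q: "edge_path (length Q) c' = Q1 @ [e'] @ M @ [f'] @ Q2" using * PQ by auto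
    note p' = edge_path_decomp[OF p] and q' = edge_path_decomp[OF q]
    have ff: "fst f = fst f'" using p'(5) q'(5) ee by simp
    have "snd e = c (fst e)" "snd e' = c' (fst e)" "snd f = c (fst f)" "snd f' = c' (fst f)"
      using p' q' ee ff by (metis snd_conv)+
    moreover have "snd e \<noteq> snd e'" "snd f \<noteq> snd f'" using * ee ff by (auto simp: prod_eq_iff)
    moreover have "(c (fst e) \<le> c' (fst e) \<and> c (fst f) \<le> c' (fst f)) \<or> (c' (fst e) \<le> c (fst e) \<and> c' (fst f) \<le> c (fst f))"
      using le p'(3-5) q'(3-5) ee ff by (auto simp: route_le_def c_def c'_def)
    ultimately show "edge_prec e e' \<longleftrightarrow> edge_prec f f'"
      using ee ff by (auto simp: edge_prec_def)
  qed
qed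

end

section \<open>Stirling permutations and their prefix routes\<close>

abbreviation cnt :: "'a list \<Rightarrow> nat \<Rightarrow> 'a \<Rightarrow> nat" where
  "cnt w p x \<equiv> count_list (take p w) x"

lemma cnt_Suc: "p < length w \<Longrightarrow> cnt w (Suc p) x = cnt w p x + (if w ! p = x then 1 else 0)"
  by (simp add: take_Suc_conv_app_nth)

lemma cnt_mono: "p \<le> q \<Longrightarrow> cnt w p x \<le> cnt w q x"
  by (metis count_list_append le_add1 le_add_diff_inverse take_add)

lemma cnt_le: "cnt w p x \<le> count_list w x"
  by (metis append_take_drop_id count_list_append le_add1)

lemma cnt_less_ex:
  assumes "cnt w p x < cnt w q x"
  obtains r where "p \<le> r" "r < q" "r < length w" "w ! r = x"
proof -
  have "p \<le> q" using assms cnt_mono[of q p w x] by linarith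
  then have "take q w = take p w @ take (q - p) (drop p w)" using take_add[of p "q - p" w] by simp
  then have "count_list (take (q - p) (drop p w)) x \<noteq> 0" using assms by simp
  then have "x \<in> set (take (q - p) (drop p w))" by (metis count_notin)
  then obtain j where "j < length (take (q - p) (drop p w))" "take (q - p) (drop p w) ! j = x"
    by (auto simp: in_set_conv_nth)
  then show ?thesis by (intro that[of "p + j"]) auto
qed

lemma cnt_less: "p \<le> r \<Longrightarrow> r < q \<Longrightarrow> r < length w \<Longrightarrow> cnt w p (w ! r) < cnt w q (w ! r)"
  using cnt_mono[of p r w "w ! r"] cnt_mono[of "Suc r" q w "w ! r"] cnt_Suc[of r w "w ! r"] by simp

lemma before_block_eq_take: "before_block w a = take (length (before_block w a)) w"
  unfolding before_block_def by (metis takeWhile_eq_take)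

lemma inversions_eq_cnt: "inversions w c a = cnt w (length (before_block w a)) c"
  unfolding inversions_def by (subst before_block_eq_take) simp

lemma before_block_notin: "a \<notin> set (before_block w a)"
  by (auto simp: before_block_def dest: set_takeWhileD)

lemma nth_before_block:
  assumes "a \<in> set w"
  shows "length (before_block w a) < length w" "w ! length (before_block w a) = a"
proof -
  show l: "length (before_block w a) < length w"
  proof (rule ccontr)
    assume "\<not> ?thesis"
    then have "before_block w a = w" using before_block_eq_take[of w a] by simp
    then show False using assms before_block_notin[of a w] by simp
  qed
  show "w ! length (before_block w a) = a"
    using nth_length_takeWhile[of "\<lambda>x. x \<noteq> a" w] l by (simp add: before_block_def)
qed

lemma cnt_before_block: "cnt w (length (before_block w a)) a = 0"
  using before_block_notin before_block_eq_take by (metis count_notin)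

lemma before_block_less:
  assumes "q < length w" "w ! q = a"
  shows "length (before_block w a) \<le> q"
proof (rule ccontr)
  assume "\<not> ?thesis"
  then have "cnt w 0 a < cnt w (length (before_block w a)) a" using cnt_less[of 0 q _ w] assms by simp
  then show False by (simp add: cnt_before_block)
qed

text \<open>A prefix containing an \<open>a\<close> contains everything before the
  \<open>a\<close>-block.\<close>

lemma inversions_le_cnt:
  assumes "0 < cnt w p a"
  shows "inversions w c a \<le> cnt w p c"
proof -
  obtain q where "q < p" "q < length w" "w ! q = a" using cnt_less_ex[of 0 w a p] assms by auto
  then show ?thesis using before_block_less[of q w a] by (simp add: inversions_eq_cnt cnt_mono)
qed

context composition
begin

lemma stirling_count:
  assumes "w \<in> stirling_perms s"
  shows "count_list w i = (if 1 \<le> i \<and> i \<le> n then part s i else 0)"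
proof -
  have "count_list w i = count (\<Sum>i\<in>{1..n}. replicate_mset (part s i) i) i"
    using assms by (simp add: stirling_perms_def flip: count_mset)
  also have "\<dots> = (\<Sum>j\<in>{1..n}. if j = i then part s j else 0)"
    by (auto simp: count_sum intro!: sum.cong)
  finally show ?thesis by simp
qed

lemma stirling_set: "w \<in> stirling_perms s \<Longrightarrow> set w = {1..n}"
proof (rule set_eqI)
  fix x assume w: "w \<in> stirling_perms s"
  have "x \<in> set w \<longleftrightarrow> count_list w x \<noteq> 0" by (simp add: count_list_0_iff)
  then show "x \<in> set w \<longleftrightarrow> x \<in> {1..n}"
    using stirling_count[OF w, of x] part_pos[of x] by auto
qed

lemma stirling_le:
  assumes "w \<in> stirling_perms s" "p < q" "q < r" "r < length w" "w ! p = w ! r"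
  shows "w ! q \<le> w ! r"
proof (rule ccontr)
  assume "\<not> ?thesis"
  then have "\<exists>p q r. p < q \<and> q < r \<and> r < length w \<and> w ! p = w ! r \<and> w ! p < w ! q"
    using assms(2-5) by (intro exI[of _ p] exI[of _ q] exI[of _ r]) simp
  then show False using assms(1) unfolding stirling_perms_def by blast
qed

lemma stirling_nth: "w \<in> stirling_perms s \<Longrightarrow> p < length w \<Longrightarrow> 1 \<le> w ! p \<and> w ! p \<le> n"
  using stirling_set nth_mem by fastforce

lemma cnt_inside:
  assumes "w \<in> stirling_perms s" "0 < cnt w p k" "cnt w p k < part s k" "1 \<le> k" "k \<le> n"
  obtains i j where "i < p" "w ! i = k" "p \<le> j" "j < length w" "w ! j = k"
proof -
  obtain i where i: "i < p" "i < length w" "w ! i = k" using cnt_less_ex[of 0 w k p] assms by auto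
  have "cnt w p k < cnt w (length w) k" using assms stirling_count by simp
  then obtain j where "p \<le> j" "j < length w" "w ! j = k" using cnt_less_ex by metis
  then show ?thesis using that i by blast
qed

text \<open>A \<open>c\<close> inside the prefix but after the first \<open>a\<close>, with an
  \<open>a\<close> still to come, would form the forbidden pattern \<open>a c a\<close>. Together
  with \<open>inversions_le_cnt\<close> this ties inversion numbers to prefix counts from both
  sides.\<close>

lemma cnt_le_inversions:
  assumes w: "w \<in> stirling_perms s" and ac: "a < c" "1 \<le> a" "a \<le> n" and less: "cnt w p a < part s a"
  shows "cnt w p c \<le> inversions w c a"
proof (rule ccontr)
  assume "\<not> ?thesis"
  then obtain q where q: "length (before_block w a) \<le> q" "q < p" "q < length w" "w ! q = c"
    unfolding inversions_eq_cnt not_le by (rule cnt_less_ex)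
  have "cnt w p a < cnt w (length w) a" using w ac less stirling_count by simp
  then obtain r where r: "p \<le> r" "r < length w" "w ! r = a" using cnt_less_ex by metis
  have a: "a \<in> set w" using r by auto
  have "length (before_block w a) \<noteq> q" using nth_before_block[OF a] q ac by auto
  then show False
    using stirling_le[OF w, of "length (before_block w a)" q r] q r nth_before_block[OF a] ac by auto
qed

text \<open>The letter \<open>Suc n\<close> is a sentinel: one of its two copies precedes the word and belongs to every prefix.\<close>

definition pcount :: "nat list \<Rightarrow> nat \<Rightarrow> nat \<Rightarrow> nat" where
  "pcount w p i = (if i = Suc n then 1 else cnt w p i)"

text \<open>This is the smallest letter whose block is cut by position \<open>p\<close>; smaller
  letters are still absent or already complete. The block of the sentinel is always cut, so the
  minimum exists.\<close>

definition level :: "nat list \<Rightarrow> nat \<Rightarrow> nat" where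
  "level w p = (LEAST k. 1 \<le> k \<and> k \<le> Suc n \<and> 0 < pcount w p k \<and> pcount w p k < part s k)"

definition prefix_route :: "nat list \<Rightarrow> nat \<Rightarrow> edge list" where
  "prefix_route w p = edge_path (level w p) (pcount w p)"

lemma level:
  shows "1 \<le> level w p" "level w p \<le> Suc n" "0 < pcount w p (level w p)"
    "pcount w p (level w p) < part s (level w p)"
proof -
  have "1 \<le> Suc n \<and> Suc n \<le> Suc n \<and> 0 < pcount w p (Suc n) \<and> pcount w p (Suc n) < part s (Suc n)"
    by (simp add: pcount_def)
  from LeastI[of "\<lambda>k. 1 \<le> k \<and> k \<le> Suc n \<and> 0 < pcount w p k \<and> pcount w p k < part s k", OF this]
  show "1 \<le> level w p" "level w p \<le> Suc n" "0 < pcount w p (level w p)"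
    "pcount w p (level w p) < part s (level w p)"
    unfolding level_def by auto
qed

lemma below_level:
  assumes "1 \<le> i" "i < level w p" "w \<in> stirling_perms s"
  shows "cnt w p i = 0 \<or> cnt w p i = part s i"
proof -
  have "i \<le> n" using assms level(2)[of w p] by linarith
  then have "cnt w p i \<le> part s i" using cnt_le[of p w i] stirling_count[OF assms(3)] assms(1) by simp
  moreover have "\<not> (0 < cnt w p i \<and> cnt w p i < part s i)"
    using not_less_Least[OF assms(2)[unfolded level_def]] assms(1) \<open>i \<le> n\<close> by (simp add: pcount_def)
  ultimately show ?thesis by linarith
qed

lemma level_leI: "1 \<le> k \<Longrightarrow> k \<le> n \<Longrightarrow> 0 < cnt w p k \<Longrightarrow> cnt w p k < part s k \<Longrightarrow> level w p \<le> k"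
  unfolding level_def by (rule Least_le) (simp add: pcount_def)

lemma cnt_level: "level w p \<le> n \<Longrightarrow> 0 < cnt w p (level w p) \<and> cnt w p (level w p) < part s (level w p)"
  using level(3,4)[of w p] by (simp add: pcount_def split: if_splits)

lemma flow_val_level: "w \<in> stirling_perms s \<Longrightarrow> flow_val (level w p) (pcount w p)"
  using level[of w p] below_level[of _ w p] unfolding flow_val_def
  by (auto simp: pcount_def)

lemma prefix_route_in_routes: "w \<in> stirling_perms s \<Longrightarrow> prefix_route w p \<in> routes s"
  unfolding prefix_route_def by (intro edge_path_in_routes flow_val_level)

lemma length_prefix_route [simp]: "length (prefix_route w p) = level w p"
  by (simp add: prefix_route_def)

lemma entry_prefix_route:
  "1 \<le> i \<Longrightarrow> i \<le> level w p \<Longrightarrow> i \<le> n \<Longrightarrow> entry (prefix_route w p) i = cnt w p i"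
  by (simp add: prefix_route_def pcount_def)

text \<open>Agreement of the counts up to \<open>length R\<close> also fixes the level, since the
  top entry of \<open>R\<close> is the only one strictly between 0 and the full
  multiplicity.\<close>

lemma prefix_route_eqI:
  assumes R: "R \<in> routes s" and eq: "\<And>i. 1 \<le> i \<Longrightarrow> i \<le> length R \<Longrightarrow> i \<le> n \<Longrightarrow> cnt w p i = entry R i"
  shows "prefix_route w p = R"
proof -
  note b = route_bounds[OF R]
  have ent: "pcount w p i = entry R i" if "1 \<le> i" "i \<le> length R" for i
  proof (cases "i = Suc n")
    case True
    then have "length R = Suc n" using b(2) that by simp
    then show ?thesis using True b(3,4) by (simp add: pcount_def)
  next
    case False
    then show ?thesis using eq[OF that] b(2) that by (simp add: pcount_def)
  qed
  have "level w p = length R"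
    unfolding level_def
  proof (rule Least_equality)
    show "1 \<le> length R \<and> length R \<le> Suc n \<and> 0 < pcount w p (length R) \<and> pcount w p (length R) < part s (length R)"
      using b ent by simp
  next
    fix k assume k: "1 \<le> k \<and> k \<le> Suc n \<and> 0 < pcount w p k \<and> pcount w p k < part s k"
    show "length R \<le> k"
    proof (rule ccontr)
      assume "\<not> length R \<le> k"
      then show False using b(5)[of k] ent[of k] k by auto
    qed
  qed
  then show ?thesis
    unfolding prefix_route_def by (subst route_eq_edge_path[OF R]) (auto intro: edge_path_cong ent)
qed

lemma prefix_route_le:
  assumes "p \<le> q" shows "route_le (prefix_route w p) (prefix_route w q)"
  unfolding route_le_def
proof (intro allI impI)
  fix i assume i: "1 \<le> i \<and> i \<le> length (prefix_route w p) \<and> i \<le> length (prefix_route w q)"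
  then show "entry (prefix_route w p) i \<le> entry (prefix_route w q) i"
    using cnt_mono[OF assms, of w i] by (simp add: prefix_route_def pcount_def)
qed

text \<open>If prefixes \<open>p < q\<close> gave the same route, the letter at \<open>p\<close>
  would lie above their common level \<open>k\<close>. But the block of \<open>k\<close> is cut at
  both positions, so that letter would stand between two copies of the smaller
  \<open>k\<close>.\<close>

lemma inj_on_prefix_route:
  assumes w: "w \<in> stirling_perms s"
  shows "inj_on (prefix_route w) {..length w}"
proof (rule linorder_inj_onI)
  fix p q assume pq: "p < q" "p \<in> {..length w}" "q \<in> {..length w}"
  show "prefix_route w p \<noteq> prefix_route w q"
  proof
    assume eq: "prefix_route w p = prefix_route w q"
    then have lev: "level w p = level w q" by (metis length_prefix_route)
    have c: "cnt w p i = cnt w q i" if "1 \<le> i" "i \<le> level w p" "i \<le> n" for i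
      using that entry_prefix_route lev eq by metis
    define x where "x = w ! p"
    have x: "1 \<le> x" "x \<le> n" using stirling_nth[OF w, of p] pq by (auto simp: x_def)
    have "cnt w p x < cnt w q x" unfolding x_def using pq by (intro cnt_less) auto
    then have "level w p < x" using c x by (metis not_le order_less_irrefl)
    then have l: "level w p \<le> n" using x by linarith
    obtain i where i: "i < p" "w ! i = level w p"
      using cnt_inside[OF w, of p "level w p"] cnt_level[OF l] l level(1) by blast
    obtain j where j: "q \<le> j" "j < length w" "w ! j = level w p"
      using cnt_inside[OF w, of q "level w q"] cnt_level[of w q] l level(1) lev by metis
    have "w ! p \<le> w ! j" using i j pq by (intro stirling_le[OF w, of i]) auto
    then show False using j \<open>level w p < x\<close> x_def by simp
  qed
qed auto

section \<open>Which routes come from prefixes of a given word\<close>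

definition word_routes :: "nat list \<Rightarrow> edge list set" where
  "word_routes w = prefix_route w ` {..length w}"

definition compatible :: "edge list \<Rightarrow> nat list \<Rightarrow> bool" where
  "compatible R w \<longleftrightarrow> (\<forall>a b. 1 \<le> a \<and> a < b \<and> b \<le> length R \<and> b \<le> n \<longrightarrow>
     (entry R a = 0 \<longrightarrow> entry R b \<le> inversions w b a) \<and>
     (entry R a = part s a \<longrightarrow> inversions w b a \<le> entry R b))"

text \<open>For the converse take the longest prefix whose counts nowhere exceed the entries of
  \<open>R\<close>. Its next letter \<open>x\<close> would overshoot, so \<open>x\<close> is matched
  already, and \<open>compatible\<close> rules out a deficit at any other level.\<close>

lemma word_routes_iff:
  assumes w: "w \<in> stirling_perms s" and R: "R \<in> routes s"
  shows "R \<in> word_routes w \<longleftrightarrow> compatible R w"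
proof
  assume "R \<in> word_routes w"
  then obtain p where p: "R = prefix_route w p" by (auto simp: word_routes_def)
  have "entry R i = cnt w p i" if "1 \<le> i" "i \<le> length R" "i \<le> n" for i
    using that entry_prefix_route p by simp
  then show "compatible R w"
    unfolding compatible_def using cnt_le_inversions[OF w] inversions_le_cnt part_pos by auto
next
  assume resp: "compatible R w"
  note b = route_bounds[OF R]
  define Q where "Q p \<longleftrightarrow> p \<le> length w \<and> (\<forall>i. 1 \<le> i \<and> i \<le> length R \<and> i \<le> n \<longrightarrow> cnt w p i \<le> entry R i)" for p
  define p where "p = (GREATEST p. Q p)"
  have "Q 0" by (simp add: Q_def)
  then have Qp: "Q p" unfolding p_def by (rule GreatestI_nat[of Q _ "length w"]) (auto simp: Q_def)
  have "\<not> Q (Suc p)"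
  proof
    assume "Q (Suc p)"
    then have "Suc p \<le> p" unfolding p_def by (rule Greatest_le_nat[of Q _ "length w"]) (auto simp: Q_def)
    then show False by simp
  qed
  have "cnt w p i = entry R i" if i: "1 \<le> i" "i \<le> length R" "i \<le> n" for i
  proof (cases "p < length w")
    case False
    then have "p = length w" using Qp by (simp add: Q_def)
    then have "cnt w p i = part s i" using stirling_count[OF w] i by simp
    then show ?thesis using Qp b(6)[of i] i by (auto simp: Q_def intro: antisym)
  next
    case True
    define x where "x = w ! p"
    have c: "cnt w (Suc p) j = cnt w p j + (if x = j then 1 else 0)" for j
      using True by (simp add: cnt_Suc x_def)
    obtain j where j: "1 \<le> j" "j \<le> length R" "j \<le> n" "\<not> cnt w (Suc p) j \<le> entry R j"
      using \<open>\<not> Q (Suc p)\<close> True unfolding Q_def by auto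
    have "x = j" using j Qp c[of j] by (auto simp: Q_def split: if_splits)
    then have x: "1 \<le> x" "x \<le> length R" "x \<le> n" "cnt w p x = entry R x" "cnt w (Suc p) x = Suc (entry R x)"
      using j Qp c[of x] by (auto simp: Q_def intro: antisym)
    have xs: "entry R x < part s x"
      using x(5) cnt_le[of "Suc p" w x] stirling_count[OF w, of x] x by simp
    have le: "cnt w p i \<le> entry R i" using Qp i by (simp add: Q_def)
    consider "i = x" | "i < x" "entry R i = 0" | "i < x" "entry R i = part s i" | "x < i"
      using b(5)[of i] i x by fastforce
    then show ?thesis
    proof cases
      case 3
      \<comment> \<open>If \<open>i\<close> were unfinished, the overshooting \<open>x\<close> would
        be counted in \<open>inversions w x i\<close>, above the bound
        \<open>entry R x\<close>.\<close>
      have "inversions w x i \<le> entry R x" using resp 3 i x unfolding compatible_def by blast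
      moreover have "cnt w (Suc p) x \<le> inversions w x i" if "cnt w p i < part s i"
        using that 3 i c[of i] by (intro cnt_le_inversions[OF w]) auto
      ultimately show ?thesis using x le 3 by linarith
    next
      case 4
      \<comment> \<open>Below the top an entry that is not full is 0. So the first \<open>x\<close>
        comes next, and the prefix contains everything counted by
        \<open>inversions w i x\<close>.\<close>
      then have "entry R x = 0" using b(5)[of x] xs x i by auto
      then have "entry R i \<le> inversions w i x" using resp 4 i x unfolding compatible_def by blast
      also have "\<dots> \<le> cnt w (Suc p) i" using x by (intro inversions_le_cnt) simp
      finally show ?thesis using 4 c[of i] le by simp
    qed (use x le in auto)
  qed
  then have "prefix_route w p = R" by (intro prefix_route_eqI[OF R])
  then show "R \<in> word_routes w" using Qp by (auto simp: word_routes_def Q_def)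
qed

text \<open>At the first position where the words differ, let \<open>x < y\<close> be the two
  letters. In the word that continues with \<open>y\<close> this \<open>y\<close> precedes an
  \<open>x\<close>, hence the whole \<open>x\<close>-block; in the other word the
  \<open>x\<close>-block has started before it.\<close>

lemma inversions_inject:
  assumes w: "w \<in> stirling_perms s" and z: "z \<in> stirling_perms s"
    and eq: "\<And>a c. 1 \<le> a \<Longrightarrow> a < c \<Longrightarrow> c \<le> n \<Longrightarrow> inversions w c a = inversions z c a"
  shows "w = z"
proof -
  have len: "length w = length z"
    using w z by (metis (mono_tags, lifting) mem_Collect_eq size_mset stirling_perms_def)
  have no: False if uv: "u \<in> stirling_perms s" "v \<in> stirling_perms s" "p < length u" "p < length v"
    "take p u = take p v" "u ! p < v ! p"
    "inversions u (v ! p) (u ! p) = inversions v (v ! p) (u ! p)" for u v p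
  proof -
    define x y where "x = u ! p" and "y = v ! p"
    have xy: "1 \<le> x" "x < y" "y \<le> n" using that stirling_nth[of u p] stirling_nth[of v p]
      by (auto simp: x_def y_def)
    have u: "cnt u (Suc p) x = Suc (cnt u p x)" "cnt u (Suc p) y = cnt u p y"
      using uv xy by (auto simp: cnt_Suc x_def y_def)
    have v: "cnt v (Suc p) x = cnt u p x" "cnt v (Suc p) y = Suc (cnt u p y)"
      using uv xy by (auto simp: cnt_Suc x_def y_def)
    have "inversions u y x \<le> cnt u p y" using inversions_le_cnt[of "Suc p" u x y] u by simp
    moreover have "cnt u p x < part s x"
      using u(1) cnt_le[of "Suc p" u x] stirling_count[OF uv(1), of x] xy by simp
    then have "Suc (cnt u p y) \<le> inversions v y x"
      using cnt_le_inversions[OF uv(2), of x y "Suc p"] v xy by simp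
    ultimately show False using uv(7) by (simp add: x_def y_def)
  qed
  have "take p w = take p z" if "p \<le> length w" for p
    using that
  proof (induction p)
    case (Suc p)
    have "w ! p = z ! p"
    proof (rule ccontr)
      assume "w ! p \<noteq> z ! p"
      then consider "w ! p < z ! p" | "z ! p < w ! p" by linarith
      then show False
      proof cases
        case 1
        then show False using no[OF w z, of p] eq Suc len stirling_nth[OF w, of p] stirling_nth[OF z, of p] by simp
      next
        case 2
        then show False using no[OF z w, of p] eq Suc len stirling_nth[OF w, of p] stirling_nth[OF z, of p] by simp
      qed
    qed
    then show ?case using Suc len by (simp add: take_Suc_conv_app_nth)
  qed simp
  from this[of "length w"] len show ?thesis by simp
qed

end

section \<open>Faces as cliques\<close>

lemma nth_occurrence:
  assumes "0 < t" "t \<le> cnt w p x"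
  obtains q where "q < p" "q < length w" "w ! q = x" "cnt w (Suc q) x = t"
proof -
  have "\<exists>q. q < p \<and> q < length w \<and> w ! q = x \<and> cnt w (Suc q) x = t"
    using assms(2)
  proof (induction p)
    case (Suc p)
    show ?case
    proof (cases "t \<le> cnt w p x")
      case True then show ?thesis using Suc.IH less_SucI by blast
    next
      case False
      then have "p < length w" using Suc.prems by (rule_tac ccontr) simp
      then show ?thesis using False Suc.prems cnt_Suc[of p w x]
        by (intro exI[of _ p]) (auto split: if_splits)
    qed
  qed (use assms in simp)
  then show ?thesis using that by blast
qed

text \<open>An ascent occurs at only one position of a Stirling permutation
  (\<open>ascent_unique\<close>), so pairs of letters suffice to name the prefix lengths to be
  dropped.\<close>

definition cuts :: "nat list \<Rightarrow> (nat \<times> nat) set \<Rightarrow> nat set" where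
  "cuts w A = {p. p \<le> length w \<and> \<not> (0 < p \<and> p < length w \<and> (w ! (p - 1), w ! p) \<in> A)}"

lemma ascents_nth: "Suc p < length w \<Longrightarrow> (w ! p, w ! Suc p) \<in> ascents w \<longleftrightarrow> w ! p < w ! Suc p"
proof -
  assume "Suc p < length w"
  then have "w = take p w @ [w ! p, w ! Suc p] @ drop (Suc (Suc p)) w"
    by (simp add: Cons_nth_drop_Suc)
  then show ?thesis by (auto simp: ascents_def)
qed

lemma ascentE:
  assumes "(a, c) \<in> ascents w"
  obtains p where "Suc p < length w" "w ! p = a" "w ! Suc p = c" "a < c"
proof -
  obtain u v where "w = u @ [a, c] @ v" "a < c" using assms by (auto simp: ascents_def)
  then show ?thesis by (intro that[of "length u"]) (auto simp: nth_append)
qed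

lemma Suc_in_cuts:
  "Suc p \<in> cuts w A \<longleftrightarrow> Suc p \<le> length w \<and> \<not> (Suc p < length w \<and> (w ! p, w ! Suc p) \<in> A)"
  by (auto simp: cuts_def)

lemma zero_in_cuts [simp]: "0 \<in> cuts w A"
  by (simp add: cuts_def)

lemma length_in_cuts [simp]: "length w \<in> cuts w A"
  by (simp add: cuts_def)

text \<open>A position that is not a cut lies inside an ascent, so the word strictly increases from
  \<open>p\<close> to the next cut: the shortest kept prefix containing position \<open>p\<close>
  has only larger letters after it.\<close>

lemma next_cut:
  assumes "A \<subseteq> ascents w" "p < length w"
  obtains q where "Suc p \<le> q" "q \<in> cuts w A" "\<And>r. p < r \<Longrightarrow> r < q \<Longrightarrow> w ! p < w ! r"
proof -
  have "\<exists>q. Suc p \<le> q \<and> q \<in> cuts w A \<and> (\<forall>r. p < r \<and> r < q \<longrightarrow> w ! p < w ! r)"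
    using assms(2)
  proof (induction "length w - p" arbitrary: p rule: less_induct)
    case less
    show ?case
    proof (cases "Suc p \<in> cuts w A")
      case True then show ?thesis by (intro exI[of _ "Suc p"]) auto
    next
      case False
      then have p: "Suc p < length w" "w ! p < w ! Suc p"
        using less.prems assms(1) ascents_nth[of p w] by (auto simp: Suc_in_cuts)
      then obtain q where q: "Suc (Suc p) \<le> q" "q \<in> cuts w A" "\<forall>r. Suc p < r \<and> r < q \<longrightarrow> w ! Suc p < w ! r"
        using less.hyps[of "Suc p", OF diff_less_mono2[OF lessI less.prems]] by auto
      have "w ! p < w ! r" if "p < r" "r < q" for r
        using that q p by (cases "r = Suc p") (auto intro: order_less_trans[OF p(2)])
      then show ?thesis using q(1,2) by (intro exI[of _ q]) auto
    qed
  qed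
  then show ?thesis using that by blast
qed

context composition
begin

lemma ascent_last:
  assumes "w \<in> stirling_perms s" "Suc p < length w" "w ! p < w ! Suc p" "p < q" "q < length w"
  shows "w ! q \<noteq> w ! p"
  using stirling_le[OF assms(1), of p "Suc p" q] assms by (cases "q = Suc p") auto

lemma ascent_unique:
  assumes "w \<in> stirling_perms s" "Suc p < length w" "w ! p < w ! Suc p" "Suc q < length w" "w ! q < w ! Suc q"
    "w ! p = w ! q"
  shows "p = q"
  using ascent_last[OF assms(1-3), of q] ascent_last[OF assms(1,4,5), of p] assms
  by (cases p q rule: linorder_cases) auto

text \<open>A letter below \<open>w ! p\<close> does not occur strictly between \<open>p\<close> and
  \<open>q\<close>. If its block were cut at \<open>q\<close>, it would occur on both sides of
  \<open>p\<close>, giving the forbidden pattern.\<close>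

lemma le_level:
  assumes w: "w \<in> stirling_perms s" and p: "p < q" "q \<le> length w"
    and gt: "\<And>r. p < r \<Longrightarrow> r < q \<Longrightarrow> w ! p < w ! r"
  shows "w ! p \<le> level w q"
proof (rule ccontr)
  assume less: "\<not> ?thesis"
  then have l: "level w q \<le> n" using stirling_nth[OF w, of p] p by simp
  obtain i j where ij: "i < q" "w ! i = level w q" "q \<le> j" "j < length w" "w ! j = level w q"
    using cnt_inside[OF w, of q "level w q"] cnt_level[OF l] l level(1) by blast
  then have "i < p" using gt[of i] less by (cases i p rule: linorder_cases) auto
  then show False using stirling_le[OF w, of i p j] ij p less by auto
qed

lemma level_0 [simp]: "level w 0 = Suc n"
  using cnt_level[of w 0] level(2)[of w 0] by (cases "level w 0 = Suc n") auto

definition face_routes :: "nat list \<Rightarrow> (nat \<times> nat) set \<Rightarrow> edge list set" where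
  "face_routes w A = prefix_route w ` cuts w A"

definition covering_cliques :: "edge list set set" where
  "covering_cliques = {C. C \<subseteq> routes s \<and> (\<forall>P\<in>C. \<forall>Q\<in>C. coherent s P Q) \<and> edges s \<subseteq> (\<Union>P\<in>C. set P)}"

lemma face_routes_word_routes: "face_routes w A \<subseteq> word_routes w"
  by (auto simp: face_routes_def word_routes_def cuts_def)

lemma face_routes_subset: "w \<in> stirling_perms s \<Longrightarrow> face_routes w A \<subseteq> routes s"
  by (auto simp: face_routes_def prefix_route_in_routes)

text \<open>The prefix before the \<open>a\<close>-block attains \<open>inversions w c a\<close> but
  may have been dropped. The next cut after its last \<open>c\<close> serves instead: only letters
  above \<open>c > a\<close> are passed, so the first \<open>a\<close> is not reached.\<close>

lemma face_routes_lower: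
  assumes w: "w \<in> stirling_perms s" and A: "A \<subseteq> ascents w" and ac: "1 \<le> a" "a < c" "c \<le> n"
  shows "\<exists>R\<in>face_routes w A. c \<le> length R \<and> entry R a = 0 \<and> entry R c = inversions w c a"
proof -
  define f where "f = length (before_block w a)"
  have a: "a \<in> set w" using stirling_set[OF w] ac by auto
  note f = nth_before_block[OF a, folded f_def]
  have f0: "cnt w f a = 0" using cnt_before_block f_def by metis
  have "\<exists>p\<in>cuts w A. c \<le> level w p \<and> p \<le> f \<and> cnt w p c = cnt w f c"
  proof (cases "cnt w f c = 0")
    case True
    then show ?thesis using ac by (intro bexI[of _ 0]) auto
  next
    case False
    then obtain p where p: "p < f" "p < length w" "w ! p = c" "cnt w (Suc p) c = cnt w f c"
      using nth_occurrence[of "cnt w f c" f w c] by auto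
    obtain q where q: "Suc p \<le> q" "q \<in> cuts w A" "\<And>r. p < r \<Longrightarrow> r < q \<Longrightarrow> w ! p < w ! r"
      using next_cut[OF A p(2)] by blast
    have "q \<le> f" using q(3)[of f] p f ac by (rule_tac ccontr) auto
    moreover have "c \<le> level w q" using le_level[OF w, of p q] q p by (auto simp: cuts_def)
    moreover have "cnt w q c = cnt w f c"
      using cnt_mono[OF q(1), of w c] cnt_mono[OF \<open>q \<le> f\<close>, of w c] p by simp
    ultimately show ?thesis using q(2) by blast
  qed
  then obtain p where p: "p \<in> cuts w A" "c \<le> level w p" "p \<le> f" "cnt w p c = cnt w f c" by blast
  have "cnt w p a = 0" using cnt_mono[OF p(3), of w a] f0 by simp
  then show ?thesis
    using p ac by (intro bexI[of _ "prefix_route w p"])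
      (auto simp: face_routes_def entry_prefix_route inversions_eq_cnt f_def)
qed

lemma face_routes_coherent:
  assumes w: "w \<in> stirling_perms s" and "P \<in> face_routes w A" "Q \<in> face_routes w A"
  shows "coherent s P Q"
proof -
  obtain p q where "P = prefix_route w p" "Q = prefix_route w q" using assms by (auto simp: face_routes_def)
  then show ?thesis
    using prefix_route_le[of p q w] prefix_route_le[of q p w]
    by (simp add: coherent_iff prefix_route_in_routes[OF w]) linarith
qed

text \<open>The empty prefix uses all bumps and the whole word all dips. For
  \<open>i \<le> n\<close> the source edge \<open>(i, t)\<close> is used by the prefix ending with
  the \<open>t\<close>-th \<open>i\<close>: another \<open>i\<close> follows later, so no ascent
  starts there and the prefix is kept.\<close>

lemma face_routes_covering:
  assumes w: "w \<in> stirling_perms s" and A: "A \<subseteq> ascents w"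
  shows "face_routes w A \<in> covering_cliques"
proof -
  have ex: "\<exists>P\<in>face_routes w A. i \<le> length P \<and> entry P i = t" if it: "(i, t) \<in> edges s" for i t
  proof -
    have start: "prefix_route w 0 \<in> face_routes w A" by (auto simp: face_routes_def)
    consider "i = Suc n" "t = 1" | "1 \<le> i" "i \<le> n" "0 < t" "t < part s i"
      | "1 \<le> i" "i \<le> n" "t = 0" | "1 \<le> i" "i \<le> n" "t = part s i"
      using it unfolding edges_def by (cases "i = Suc n") auto
    then show ?thesis
    proof cases
      case 1
      then show ?thesis using start by (intro bexI[of _ "prefix_route w 0"]) (auto simp: prefix_route_def pcount_def)
    next
      case 2
      then obtain p where p: "p < length w" "w ! p = i" "cnt w (Suc p) i = t"
        using nth_occurrence[of t "length w" w i] stirling_count[OF w, of i] by auto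
      obtain j where j: "Suc p \<le> j" "j < length w" "w ! j = i"
        using cnt_inside[OF w, of "Suc p" i] p 2 by auto
      have "\<not> w ! p < w ! Suc p" using ascent_last[OF w, of p j] p j by auto
      then have "Suc p \<in> cuts w A" using p A ascents_nth[of p w] by (auto simp: Suc_in_cuts)
      moreover have "level w (Suc p) = i"
        using le_level[OF w, of p "Suc p"] level_leI[of i "Suc p" w] p 2 by auto
      ultimately show ?thesis using p 2
        by (intro bexI[of _ "prefix_route w (Suc p)"]) (auto simp: face_routes_def entry_prefix_route)
    next
      case 3
      then show ?thesis using start by (intro bexI[of _ "prefix_route w 0"]) (auto simp: entry_prefix_route)
    next
      case 4
      have l: "level w (length w) = Suc n"
        using cnt_level[of w "length w"] level(1,2)[of w "length w"] stirling_count[OF w, of "level w (length w)"]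
        by (cases "level w (length w) = Suc n") auto
      show ?thesis
        using 4 l stirling_count[OF w, of i]
        by (intro bexI[of _ "prefix_route w (length w)"]) (auto simp: face_routes_def entry_prefix_route)
    qed
  qed
  have "edges s \<subseteq> (\<Union>P\<in>face_routes w A. set P)"
  proof
    fix e assume e: "e \<in> edges s"
    then obtain i t where it: "e = (i, t)" "1 \<le> i" by (cases e) (auto simp: edges_def)
    obtain P where P: "P \<in> face_routes w A" "i \<le> length P" "entry P i = t" using ex e it by blast
    then show "e \<in> (\<Union>P\<in>face_routes w A. set P)"
      using set_route[of P] face_routes_subset[OF w] it by auto
  qed
  then show ?thesis
    using face_routes_coherent[OF w] face_routes_subset[OF w] by (auto simp: covering_cliques_def)
qed

text \<open>The routes of \<open>face_routes_lower\<close> have entry 0 at \<open>a\<close>, so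
  compatibility with \<open>z\<close> turns their entries at \<open>c\<close> into lower bounds for
  its inversion numbers.\<close>

lemma weak_le_face_routes:
  assumes w: "w \<in> stirling_perms s" and A: "A \<subseteq> ascents w" and z: "z \<in> stirling_perms s"
    and sub: "face_routes w A \<subseteq> word_routes z"
  shows "weak_le s w z"
  unfolding weak_le_def
proof (intro allI impI)
  fix a c assume ac: "1 \<le> a \<and> a < c \<and> c \<le> n"
  then obtain R where R: "R \<in> face_routes w A" "c \<le> length R" "entry R a = 0" "entry R c = inversions w c a"
    using face_routes_lower[OF w A] by blast
  then have "compatible R z"
    using word_routes_iff[OF z] sub face_routes_subset[OF w] by blast
  then have "entry R c \<le> inversions z c a" using R ac unfolding compatible_def by blast
  then show "inversions w c a \<le> inversions z c a" using R by simp
qed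

text \<open>The witness routes mirror those of \<open>face_routes_lower\<close>, with
  \<open>a\<close> complete instead of absent. They make \<open>z\<close> the greatest word whose
  prefixes give all routes of the face; its existence comes from reversal.\<close>

definition face_top :: "nat list \<Rightarrow> (nat \<times> nat) set \<Rightarrow> nat list \<Rightarrow> bool" where
  "face_top w A z \<longleftrightarrow> z \<in> stirling_perms s \<and> face_routes w A \<subseteq> word_routes z \<and>
     (\<forall>a c. 1 \<le> a \<and> a < c \<and> c \<le> n \<longrightarrow>
       (\<exists>R\<in>face_routes w A. c \<le> length R \<and> entry R a = part s a \<and> entry R c = inversions z c a))"

lemma weak_le_face_top:
  assumes w: "w \<in> stirling_perms s" and top: "face_top w A z" and y: "y \<in> stirling_perms s"
    and sub: "face_routes w A \<subseteq> word_routes y"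
  shows "weak_le s y z"
  unfolding weak_le_def
proof (intro allI impI)
  fix a c assume ac: "1 \<le> a \<and> a < c \<and> c \<le> n"
  then obtain R where R: "R \<in> face_routes w A" "c \<le> length R" "entry R a = part s a" "entry R c = inversions z c a"
    using top unfolding face_top_def by blast
  then have "compatible R y"
    using word_routes_iff[OF y] sub face_routes_subset[OF w] by blast
  then have "inversions y c a \<le> entry R c" using R ac unfolding compatible_def by blast
  then show "inversions y c a \<le> inversions z c a" using R by simp
qed

text \<open>Compatibility consists of lower bounds on inversion numbers, inherited upwards from
  \<open>w\<close>, and upper bounds, inherited downwards from \<open>z\<close>.\<close>

lemma weak_interval_face_top:
  assumes w: "w \<in> stirling_perms s" and A: "A \<subseteq> ascents w" and top: "face_top w A z"
  shows "weak_interval s w z = {y \<in> stirling_perms s. face_routes w A \<subseteq> word_routes y}"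
proof (intro equalityI subsetI)
  fix y assume "y \<in> weak_interval s w z"
  then have y: "y \<in> stirling_perms s" "weak_le s w y" "weak_le s y z" by (auto simp: weak_interval_def)
  have "R \<in> word_routes y" if R: "R \<in> face_routes w A" for R
  proof -
    have "R \<in> routes s" using R face_routes_subset[OF w] by auto
    then have "compatible R w" "compatible R z"
      using R top face_routes_word_routes[of w A] w word_routes_iff by (auto simp: face_top_def dest: subsetD)
    then have "compatible R y"
      using y(2,3) unfolding compatible_def weak_le_def by (meson le_trans)
    then show ?thesis using word_routes_iff[OF y(1) \<open>R \<in> routes s\<close>] by simp
  qed
  then show "y \<in> {y \<in> stirling_perms s. face_routes w A \<subseteq> word_routes y}" using y by auto
next
  fix y assume "y \<in> {y \<in> stirling_perms s. face_routes w A \<subseteq> word_routes y}"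
  then show "y \<in> weak_interval s w z"
    using weak_le_face_routes[OF w A] weak_le_face_top[OF w top] by (auto simp: weak_interval_def)
qed

section \<open>Transposing a word along an ascent\<close>

lemma stirling_split:
  assumes "w \<in> stirling_perms s" "w = u @ y # v" "x < y"
  shows "x \<notin> set u \<or> x \<notin> set v"
proof (rule ccontr)
  assume "\<not> ?thesis"
  then obtain p r where "p < length u" "u ! p = x" "r < length v" "v ! r = x" by (auto simp: in_set_conv_nth)
  then show False
    using stirling_le[OF assms(1), of p "length u" "length u + 1 + r"] assms(2,3) by (auto simp: nth_append)
qed

lemma stirling_permsI:
  assumes "w \<in> stirling_perms s" "mset w' = mset w"
    "\<And>u y v x. w' = u @ y # v \<Longrightarrow> x < y \<Longrightarrow> x \<notin> set u \<or> x \<notin> set v"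
  shows "w' \<in> stirling_perms s"
proof -
  have False if pqr: "p < q" "q < r" "r < length w'" "w' ! p = w' ! r" "w' ! p < w' ! q" for p q r
  proof -
    have "w' = take q w' @ w' ! q # drop (Suc q) w'" using pqr by (simp add: id_take_nth_drop)
    then have "w' ! p \<notin> set (take q w') \<or> w' ! p \<notin> set (drop (Suc q) w')" using assms(3) pqr by blast
    moreover have "w' ! p \<in> set (take q w')" using pqr by (auto simp: in_set_conv_nth intro!: exI[of _ p])
    moreover have "w' ! p \<in> set (drop (Suc q) w')"
      using pqr by (auto simp: in_set_conv_nth intro!: exI[of _ "r - Suc q"])
    ultimately show False by blast
  qed
  then show ?thesis using assms(1,2) by (auto simp: stirling_perms_def)
qed

lemma block_decomp:
  assumes w: "w \<in> stirling_perms s" and ac: "(a, c) \<in> ascents w"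
  obtains B B1 B2 v where "w = before_block w a @ B @ c # v" "block w a = B" "after_block w a = c # v"
    "B = a # B1" "B = B2 @ [a]"
proof -
  obtain u v where uv: "w = u @ [a, c] @ v" and less: "a < c" using ac by (auto simp: ascents_def)
  have av: "a \<notin> set v" using stirling_split[OF w, of "u @ [a]" c v a] uv less by auto
  have "takeWhile (\<lambda>x. x \<noteq> a) (rev v @ c # a # rev u) = rev v @ takeWhile (\<lambda>x. x \<noteq> a) (c # a # rev u)"
    using av by (intro takeWhile_append2) auto
  then have aft: "after_block w a = c # v"
    unfolding after_block_def uv using less by simp
  define d where "d = dropWhile (\<lambda>x. x \<noteq> a) w"
  have wd: "w = before_block w a @ d" by (simp add: d_def before_block_def)
  have "a \<in> set d" using uv wd before_block_notin[of a w] by (metis Un_iff append_Cons in_set_conv_decomp set_append)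
  then have "takeWhile (\<lambda>x. x \<noteq> a) (rev w) = takeWhile (\<lambda>x. x \<noteq> a) (rev d)"
    by (subst wd) (simp add: takeWhile_append1)
  then have "rev d = rev (c # v) @ dropWhile (\<lambda>x. x \<noteq> a) (rev d)"
    using aft unfolding after_block_def by (metis rev_rev_ident takeWhile_dropWhile_id)
  then have d: "d = block w a @ c # v"
    unfolding block_def d_def[symmetric] by (metis rev_append rev_rev_ident)
  have "dropWhile (\<lambda>x. x \<noteq> a) (rev d) \<noteq> []" using \<open>a \<in> set d\<close> by (simp add: dropWhile_eq_Nil_conv)
  then obtain ys where "dropWhile (\<lambda>x. x \<noteq> a) (rev d) = a # ys"
    by (metis (mono_tags, lifting) hd_dropWhile list.exhaust_sel)
  then have B2: "block w a = rev ys @ [a]" unfolding block_def d_def[symmetric] by simp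
  have "d \<noteq> []" using \<open>a \<in> set d\<close> by auto
  then have "hd d = a" unfolding d_def using hd_dropWhile by (metis (mono_tags, lifting))
  then have "hd (block w a) = a" using d B2 by (metis append_is_Nil_conv hd_append not_Cons_self2)
  then have B1: "block w a = a # tl (block w a)" using B2 by (metis append_is_Nil_conv hd_Cons_tl not_Cons_self2)
  show ?thesis using that[of "block w a" v "tl (block w a)" "rev ys"] wd d aft B1 B2 by simp
qed

lemma block_le:
  assumes w: "w \<in> stirling_perms s" and "w = u @ B @ v" "B = a # B1" "B = B2 @ [a]" "y \<in> set B"
  shows "y \<le> a"
proof (rule ccontr)
  assume y: "\<not> y \<le> a"
  obtain b1 b2 where b: "B = b1 @ y # b2" using assms(5) by (meson split_list)
  have "b1 \<noteq> []" using b y assms(3) by (cases b1) auto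
  then have "a \<in> set b1" using b assms(3) by (cases b1) auto
  moreover have "b2 \<noteq> []" using b y assms(4) by (cases b2 rule: rev_cases) auto
  then have "a \<in> set b2" using b assms(4) by (cases b2 rule: rev_cases) auto
  ultimately show False using stirling_split[OF w, of "u @ b1" y "b2 @ v" a] b y assms(2) by auto
qed

text \<open>Otherwise the first or the last \<open>a\<close> of the block would stand between two
  copies of the smaller \<open>y\<close>. So a letter \<open>c\<close> put in front of the block
  does not separate copies of a letter inside it.\<close>

lemma block_private:
  assumes w: "w \<in> stirling_perms s" and "w = u @ B @ v" "B = a # B1" "B = B2 @ [a]" "y \<in> set B" "y < a"
  shows "y \<notin> set u" "y \<notin> set v"
proof -
  have "y \<in> set B1" using assms(3,5,6) by auto
  moreover have "y \<in> set B2" using assms(4,5,6) by auto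
  moreover have "w = u @ a # (B1 @ v)" using assms(2,3) by simp
  moreover have "w = (u @ B2) @ a # v" using assms(2,4) by simp
  ultimately show "y \<notin> set u" "y \<notin> set v"
    using stirling_split[OF w _ assms(6)] by fastforce+
qed

lemma prefix_route_cong:
  assumes "w \<in> stirling_perms s"
    "\<And>i. 1 \<le> i \<Longrightarrow> i \<le> level w p \<Longrightarrow> i \<le> n \<Longrightarrow> cnt w' p' i = cnt w p i"
  shows "prefix_route w' p' = prefix_route w p"
  using assms by (intro prefix_route_eqI) (auto simp: prefix_route_in_routes entry_prefix_route)

text \<open>The word \<open>u B c v\<close> becomes \<open>u c B v\<close>. Prefixes ending in
  \<open>u\<close> or after \<open>c\<close> keep their counts. A prefix ending inside
  \<open>B\<close> gains a \<open>c\<close>, but its level is at most \<open>a < c\<close>, so its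
  route does not see this. Only the route cut between \<open>B\<close> and \<open>c\<close> is lost:
  its entry at \<open>a\<close> is full while its entry at \<open>c\<close> falls short of the new
  inversion number.\<close>

lemma transpose_ascent:
  assumes w: "w \<in> stirling_perms s" and ac: "(a, c) \<in> ascents w"
  defines "w' \<equiv> transpose_ascent w (a, c)"
  shows "w' \<in> stirling_perms s"
    and "inversions w' c a = Suc (inversions w c a)"
    and "p \<le> length w \<Longrightarrow> \<not> (0 < p \<and> p < length w \<and> w ! (p - 1) = a \<and> w ! p = c) \<Longrightarrow> prefix_route w p \<in> word_routes w'"
    and "0 < p \<Longrightarrow> p < length w \<Longrightarrow> w ! (p - 1) = a \<Longrightarrow> w ! p = c \<Longrightarrow> prefix_route w p \<notin> word_routes w'"
proof -
  define u where "u = before_block w a"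
  obtain B B1 B2 v where B0: "w = u @ B @ c # v" "block w a = B" "after_block w a = c # v"
    "B = a # B1" "B = B2 @ [a]"
    unfolding u_def by (rule block_decomp[OF w ac])
  have w': "w' = u @ [c] @ B @ v" unfolding w'_def transpose_ascent_def u_def by (simp add: B0(2,3))
  have less: "a < c" using ac by (auto simp: ascents_def)
  have au: "a \<notin> set u" by (simp add: u_def before_block_notin)
  have wB: "w = u @ B @ (c # v)" using B0 by simp
  note Ble = block_le[OF w wB B0(4,5)]
  note Bpr = block_private[OF w wB B0(4,5)]
  have Bu: "y \<in> set B \<Longrightarrow> y \<notin> set u" for y using Ble[of y] Bpr[of y] au by (cases "y = a") auto
  have cB: "c \<notin> set B" using Ble less by fastforce
  have c: "1 \<le> a" "c \<le> n" using ac stirling_set[OF w] B0 by auto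
  show w'S: "w' \<in> stirling_perms s"
  proof (rule stirling_permsI[OF w])
    show "mset w' = mset w" by (simp add: w' B0(1))
  next
    fix u' y v' x assume eq: "w' = u' @ y # v'" and xy: "x < y"
    have eq': "u @ (c # B @ v) = u' @ (y # v')" using eq w' by simp
    \<comment> \<open>The letter \<open>y\<close> lies in \<open>u\<close>, is the moved
      \<open>c\<close>, or lies in \<open>B\<close> or in \<open>v\<close>.\<close>
    consider zs where "u = u' @ y # zs" "v' = zs @ c # B @ v"
      | "u = u'" "y = c" "v' = B @ v"
      | zs zs' where "u' = u @ c # zs" "B = zs @ y # zs'" "v' = zs' @ v"
      | zs zs' where "u' = u @ c # B @ zs" "v = zs @ y # zs'" "v' = zs'"
    proof -
      consider zs where "u = u' @ zs" "zs @ c # B @ v = y # v'" | zs where "u' = u @ zs" "c # B @ v = zs @ y # v'"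
        using eq' by (auto simp: append_eq_append_conv2)
      then show ?thesis
      proof cases
        case 1 then show ?thesis using that(1,2) by (cases zs) auto
      next
        case 2
        show ?thesis
        proof (cases zs)
          case Nil then show ?thesis using 2 that(2) by auto
        next
          case (Cons d ys)
          then have d: "d = c" "B @ v = ys @ y # v'" using 2 by auto
          then consider ts where "B = ys @ ts" "ts @ v = y # v'" | ts where "ys = B @ ts" "v = ts @ y # v'"
            by (auto simp: append_eq_append_conv2)
          then show ?thesis
          proof cases
            case 1
            show ?thesis
            proof (cases ts)
              case Nil then show ?thesis using 1 2 Cons d that(4)[of "[]" v'] by auto
            next
              case (Cons t tt) then show ?thesis using 1 2 \<open>zs = d # ys\<close> d that(3)[of ys tt] by auto
            qed
          next
            case 2 then show ?thesis using \<open>u' = u @ zs\<close> Cons d that(4)[of ts v'] by auto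
          qed
        qed
      qed
    qed
    then show "x \<notin> set u' \<or> x \<notin> set v'"
    proof cases
      case 1
      then show ?thesis using stirling_split[OF w, of u' y "zs @ B @ c # v" x] B0(1) xy by auto
    next
      case 2
      then show ?thesis using stirling_split[OF w, of "u @ B" c v x] B0(1) xy Bu[of x] by auto
    next
      case 3
      then have "y < c" using Ble[of y] less by simp
      then show ?thesis using 3 stirling_split[OF w, of "u @ zs" y "zs' @ c # v" x] B0(1) xy by auto
    next
      case 4
      then show ?thesis using stirling_split[OF w, of "u @ B @ c # zs" y zs' x] B0(1) xy by auto
    qed
  qed
  have "before_block w' a = u @ [c]"
  proof -
    have "takeWhile (\<lambda>x. x \<noteq> a) (u @ c # B @ v) = u @ takeWhile (\<lambda>x. x \<noteq> a) (c # B @ v)"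
      using au by (intro takeWhile_append2) auto
    then show ?thesis unfolding before_block_def w' using less B0(4) by simp
  qed
  then show inv: "inversions w' c a = Suc (inversions w c a)"
    by (simp add: inversions_def u_def)
  have len: "length w' = length w" by (simp add: w' B0(1))
  define g where "g = length u + length B"
  have g: "0 < g" "g < length w" "w ! (g - 1) = a" "w ! g = c"
  proof -
    show "0 < g" using B0(4) by (simp add: g_def)
    show "g < length w" "w ! g = c" by (simp_all add: g_def B0(1) nth_append)
    have "w = (u @ B2) @ a # c # v" using B0(1,5) by simp
    moreover have "g - 1 = length (u @ B2)" by (simp add: g_def B0(5))
    ultimately show "w ! (g - 1) = a" by (metis nth_append_length)
  qed
  have cases3: "prefix_route w p \<in> word_routes w'" if p: "p \<le> length w" "p \<noteq> g"
  proof -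
    consider "p \<le> length u" | "length u < p" "p < g" | "g < p" using p by linarith
    then show ?thesis
    proof cases
      case 1
      then have "prefix_route w' p = prefix_route w p"
        by (intro prefix_route_cong[OF w]) (simp add: w' B0(1))
      then show ?thesis using p len by (metis atMost_iff imageI word_routes_def)
    next
      case 2
      define m where "m = p - Suc (length u)"
      have pm: "p = length u + Suc m" "m < length B2" using 2 by (auto simp: m_def g_def B0(5))
      have "length B1 = length B2" using B0(4,5) by (metis length_Cons length_append_singleton nat.inject)
      then have ca: "cnt w p a = Suc (count_list (take m B1) a)" using pm au B0(1,4) by simp
      have tk: "cnt w p x = count_list u x + count_list (take (Suc m) B2) x" for x
        unfolding B0(1) using pm B0(5) by simp
      have "count_list w a = count_list u a + count_list B2 a + 1 + count_list v a"
        unfolding B0(1) using B0(5) less by simp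
      then have "cnt w p a < count_list w a" using tk[of a] cnt_le[of "Suc m" B2 a] by simp
      then have "level w p \<le> a"
        using ca c less stirling_count[OF w, of a] by (intro level_leI) auto
      \<comment> \<open>The index grows by one because \<open>c\<close> now precedes the
        block.\<close>
      then have "prefix_route w' (Suc p) = prefix_route w p"
        using less pm B0(5) by (intro prefix_route_cong[OF w]) (auto simp: w' B0(1))
      moreover have "Suc p \<le> length w'" using 2 g(2) len by linarith
      ultimately show ?thesis by (metis atMost_iff imageI word_routes_def)
    next
      case 3
      obtain m where "p = length u + (length B + Suc m)" using less_imp_Suc_add[OF 3] g_def by auto
      then have "cnt w' p i = cnt w p i" for i by (simp add: w' B0(1))
      then have "prefix_route w' p = prefix_route w p" by (intro prefix_route_cong[OF w]) simp
      then show ?thesis using p len by (metis atMost_iff imageI word_routes_def)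
    qed
  qed
  show "prefix_route w p \<in> word_routes w'"
    if "p \<le> length w" "\<not> (0 < p \<and> p < length w \<and> w ! (p - 1) = a \<and> w ! p = c)"
    using that cases3 g by blast
  show "prefix_route w p \<notin> word_routes w'" if p: "0 < p" "p < length w" "w ! (p - 1) = a" "w ! p = c"
  proof
    assume "prefix_route w p \<in> word_routes w'"
    then have comp: "compatible (prefix_route w p) w'"
      using word_routes_iff[OF w'S prefix_route_in_routes[OF w]] by simp
    have "p - 1 = g - 1" using ascent_unique[OF w, of "p - 1" "g - 1"] p g less by simp
    then have pg: "p = g" using p g by simp
    \<comment> \<open>The block of a smaller letter cut at \<open>g\<close> would enclose the
      \<open>c\<close> at that position.\<close>
    have "c \<le> level w g"
    proof (rule ccontr)
      assume less': "\<not> c \<le> level w g"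
      then have l: "level w g \<le> n" using c by simp
      obtain i j where "i < g" "w ! i = level w g" "g \<le> j" "j < length w" "w ! j = level w g"
        using cnt_inside[OF w, of g "level w g"] cnt_level[OF l] l level(1) by blast
      then show False using stirling_le[OF w, of i g j] g less' by (cases "j = g") auto
    qed
    moreover have "cnt w g a = part s a"
    proof -
      have "a \<notin> set v" using stirling_split[OF w, of "u @ B" c v a] B0 less by auto
      then have "cnt w g a = count_list w a" using less by (simp add: B0(1) g_def)
      then show ?thesis using stirling_count[OF w] c less by simp
    qed
    ultimately have "inversions w' c a \<le> cnt w g c"
      using comp c less unfolding compatible_def pg by (auto simp: entry_prefix_route)
    moreover have "cnt w g c = inversions w c a"
    proof -
      have "cnt w g c = count_list u c" using cB by (simp add: B0(1) g_def count_notin)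
      then show ?thesis by (simp add: inversions_def u_def)
    qed
    ultimately show False using inv by simp
  qed
qed

end

section \<open>Joins of transpositions\<close>

lemma last_occurrence:
  assumes "q < length w"
  obtains p where "q \<le> p" "p < length w" "w ! p = w ! q" "\<And>r. p < r \<Longrightarrow> r < length w \<Longrightarrow> w ! r \<noteq> w ! q"
proof -
  let ?M = "{p. q \<le> p \<and> p < length w \<and> w ! p = w ! q}"
  have fin: "finite ?M" by (rule finite_subset[of _ "{..<length w}"]) auto
  have "q \<in> ?M" using assms by simp
  then have "Max ?M \<in> ?M" using fin by (intro Max_in) auto
  moreover have "w ! r \<noteq> w ! q" if "Max ?M < r" "r < length w" for r
  proof
    assume "w ! r = w ! q"
    then have "r \<in> ?M" using that \<open>Max ?M \<in> ?M\<close> by auto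
    then show False using Max_ge[OF fin] that by fastforce
  qed
  ultimately show ?thesis using that by blast
qed

text \<open>Some \<open>b\<close> precedes the \<open>a\<close>-block, so whatever precedes the
  first \<open>b\<close> precedes the first \<open>a\<close>.\<close>

lemma inversions_trans:
  assumes "0 < inversions w b a" shows "inversions w c b \<le> inversions w c a"
  using assms inversions_le_cnt unfolding inversions_eq_cnt[of w b a] inversions_eq_cnt[of w c a] by blast

context composition
begin

lemma face_routes_transpose:
  assumes "w \<in> stirling_perms s" "A \<subseteq> ascents w" "e \<in> A"
  shows "face_routes w A \<subseteq> word_routes (transpose_ascent w e)"
proof -
  obtain a c where e: "e = (a, c)" by (cases e)
  show ?thesis
    using transpose_ascent(3)[OF assms(1), of a c] assms e by (auto simp: face_routes_def cuts_def)
qed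

text \<open>
  The induction moves from a letter \<open>m\<close> to a letter finishing later that precedes \<open>m\<close> in \<open>y\<close>:
  the right neighbour, if the ascent there is transposed below \<open>y\<close>, or an enclosing block otherwise.
\<close>

lemma upper_bound_inversions:
  assumes w: "w \<in> stirling_perms s" and A: "A \<subseteq> ascents w"
    and wy: "weak_le s w y" and ty: "\<And>e. e \<in> A \<Longrightarrow> weak_le s (transpose_ascent w e) y"
    and pc: "pc < length w" and i: "c \<le> level w i"
    and l: "\<And>l. l \<in> cuts w A \<Longrightarrow> i < l \<Longrightarrow> l \<le> pc \<Longrightarrow> level w l < c"
    and c: "c = w ! pc"
    and "i \<le> p" "p < pc" "w ! p < c" "\<And>r. p < r \<Longrightarrow> r < length w \<Longrightarrow> w ! r \<noteq> w ! p"
  shows "cnt w (Suc pc) c \<le> inversions y c (w ! p)"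
  using assms(9-)
proof (induction "pc - p" arbitrary: p rule: less_induct)
  case less
  define m where "m = w ! p"
  note p = less.prems[folded m_def]
  have cn: "1 \<le> c" "c \<le> n" using stirling_nth[OF w pc] c by auto
  have m1: "1 \<le> m" using stirling_nth[OF w, of p] p pc by (simp add: m_def)
  have yge: "inversions w k m \<le> inversions y k m" if "m < k" "k \<le> n" for k
    using wy that m1 unfolding weak_le_def by blast
  have mless: "cnt w r m < part s m" if "r \<le> p" for r
  proof -
    have "cnt w r m < cnt w (length w) m" unfolding m_def using that p pc by (intro cnt_less) auto
    then show ?thesis using stirling_count[OF w] by (simp split: if_splits)
  qed
  \<comment> \<open>The induction hypothesis applies at the last \<open>k\<close>, which comes
    before \<open>pc\<close> since copies of \<open>k < c\<close> cannot enclose the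
    \<open>c\<close> there; \<open>inversions_trans\<close> passes the bound from \<open>k\<close>
    to \<open>m\<close>.\<close>
  have step: "cnt w (Suc pc) c \<le> inversions y c m"
    if k: "m < k" "k < c" "0 < inversions y k m" and r: "p < r" "r < pc" "w ! r = k" for k r
  proof -
    have rl: "r < length w" using r pc by simp
    obtain p' where p': "r \<le> p'" "p' < length w" "w ! p' = w ! r"
      "\<And>r'. p' < r' \<Longrightarrow> r' < length w \<Longrightarrow> w ! r' \<noteq> w ! r"
      using last_occurrence[OF rl] by blast
    note p' = p'[unfolded r(3)]
    have "p' < pc"
    proof (rule ccontr)
      assume "\<not> p' < pc"
      moreover have "p' \<noteq> pc" using p' c k by auto
      ultimately show False using stirling_le[OF w, of r pc p'] p' r c k by auto
    qed
    then have "cnt w (Suc pc) c \<le> inversions y c k"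
      using less.hyps[of p'] p' p r k by auto
    also have "\<dots> \<le> inversions y c m" using k by (intro inversions_trans)
    finally show ?thesis .
  qed
  show ?case
    unfolding m_def[symmetric]
  proof (cases "Suc p \<in> cuts w A")
    case False
    then have As: "(m, w ! Suc p) \<in> A" using p pc by (auto simp: Suc_in_cuts m_def)
    then have asc: "(m, w ! Suc p) \<in> ascents w" using A by auto
    have m': "m < w ! Suc p" using asc by (auto simp: ascents_def)
    have "w ! Suc p \<le> n" using stirling_nth[OF w, of "Suc p"] p pc by simp
    then have inv: "Suc (inversions w (w ! Suc p) m) \<le> inversions y (w ! Suc p) m"
      using ty[OF As] transpose_ascent(2)[OF w asc] m' m1 unfolding weak_le_def by (metis le_trans order_refl)
    show "cnt w (Suc pc) c \<le> inversions y c m"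
    proof (cases "Suc p = pc")
      case True
      \<comment> \<open>Here the ascent is \<open>(m, c)\<close> itself, and its transposition
        accounts for the \<open>c\<close> at \<open>pc\<close>.\<close>
      have "cnt w (Suc pc) c = Suc (cnt w p c)"
        using True pc c p by (auto simp: cnt_Suc m_def)
      also have "cnt w p c \<le> inversions w c m" using p cn m1 mless by (intro cnt_le_inversions[OF w]) auto
      finally show ?thesis using inv True c by simp
    next
      case neq: False
      have sp: "Suc p < length w" using p pc by simp
      obtain q where q: "Suc (Suc p) \<le> q" "q \<in> cuts w A" "\<And>r. Suc p < r \<Longrightarrow> r < q \<Longrightarrow> w ! Suc p < w ! r"
        using next_cut[OF A sp] by blast
      \<comment> \<open>Either the next cut comes no later than \<open>pc\<close> and has level
        below \<open>c\<close> by assumption, or the increasing run reaches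
        \<open>pc\<close>.\<close>
      have "w ! Suc p < c"
      proof (cases "q \<le> pc")
        case True
        have "w ! Suc p \<le> level w q" using q by (intro le_level[OF w]) (auto simp: cuts_def)
        also have "\<dots> < c" using l[of q] q True p by simp
        finally show ?thesis .
      next
        case False then show ?thesis using q(3)[of pc] neq p c by simp
      qed
      then show ?thesis using step[of "w ! Suc p" "Suc p"] m' inv neq p by simp
    qed
  next
    case True
    \<comment> \<open>The cut after the last \<open>m\<close> has level \<open>k < c\<close>, and
      the block of \<open>k\<close> is cut there, so it encloses this \<open>m\<close>. Hence
      \<open>k > m\<close>, and some \<open>k\<close> precedes the \<open>m\<close>-block in
      \<open>w\<close> and therefore in \<open>y\<close>.\<close>
    define k where "k = level w (Suc p)"
    have k: "k < c" using l[OF True] p by (simp add: k_def)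
    then have kn: "k \<le> n" using cn by simp
    obtain i0 j where ij: "i0 < Suc p" "w ! i0 = k" "Suc p \<le> j" "j < length w" "w ! j = k"
      using cnt_inside[OF w, of "Suc p" k] cnt_level[of w "Suc p"] kn level(1) unfolding k_def by blast
    have km: "k \<noteq> m" using p(4)[of j] ij by auto
    then have i0: "i0 < p" using ij m_def by (cases "i0 = p") auto
    have "m \<le> k" using stirling_le[OF w, of i0 p j] i0 ij by (simp add: m_def)
    then have mk: "m < k" using km by simp
    have "0 < cnt w (Suc i0) k" using cnt_less[of 0 i0 "Suc i0" w] ij by simp
    also have "\<dots> \<le> inversions w k m" using mk m1 kn mless[of "Suc i0"] i0 by (intro cnt_le_inversions[OF w]) auto
    also have "\<dots> \<le> inversions y k m" using yge mk kn by simp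
    finally have inv: "0 < inversions y k m" .
    have "j < pc"
    proof (rule ccontr)
      assume "\<not> j < pc"
      moreover have "j \<noteq> pc" using ij c k by auto
      ultimately show False using stirling_le[OF w, of i0 pc j] ij i0 p c k by auto
    qed
    then show "cnt w (Suc pc) c \<le> inversions y c m"
      using step[OF mk k inv, of j] ij by simp
  qed
qed

text \<open>Let \<open>q\<close> be the inversion number of \<open>(c, a)\<close> in
  \<open>w\<close>, and \<open>pc\<close> the position of the next \<open>c\<close>. If
  \<open>z\<close> exceeds \<open>q\<close>, a kept prefix that contains all \<open>a\<close> and
  ends no later than \<open>pc\<close> has level below \<open>c\<close>; this is what
  \<open>upper_bound_inversions\<close> needs to give \<open>y\<close> at least
  \<open>q + 1\<close>. The next cut after \<open>pc\<close> bounds \<open>z\<close> by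
  \<open>q + 1\<close>.\<close>

lemma face_top_least:
  assumes w: "w \<in> stirling_perms s" and A: "A \<subseteq> ascents w"
    and wy: "weak_le s w y" and ty: "\<And>e. e \<in> A \<Longrightarrow> weak_le s (transpose_ascent w e) y"
    and top: "face_top w A z"
  shows "weak_le s z y"
  unfolding weak_le_def
proof (intro allI impI)
  fix a c assume ac: "1 \<le> a \<and> a < c \<and> c \<le> n"
  have z: "z \<in> stirling_perms s" using top by (simp add: face_top_def)
  have compat: "compatible (prefix_route w q) z" if "q \<in> cuts w A" for q
    using that top word_routes_iff[OF z prefix_route_in_routes[OF w]]
    by (auto simp: face_top_def face_routes_def)
  show "inversions z c a \<le> inversions y c a"
  proof (cases "inversions z c a \<le> inversions w c a")
    case True
    then show ?thesis using wy ac unfolding weak_le_def by (meson le_trans)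
  next
    case False
    define q where "q = inversions w c a"
    have "inversions z c a \<le> cnt z (length z) c"
      unfolding inversions_eq_cnt using cnt_le[of _ z c] by simp
    also have "\<dots> = cnt w (length w) c" using stirling_count w z by simp
    finally have "Suc q \<le> cnt w (length w) c" using False by (simp add: q_def)
    then obtain pc where pc: "pc < length w" "w ! pc = c" "cnt w (Suc pc) c = Suc q"
      using nth_occurrence[of "Suc q" "length w" w c] by auto
    have pcq: "cnt w pc c = q" using pc by (simp add: cnt_Suc)
    have a: "a \<in> set w" using stirling_set[OF w] ac by auto
    define f where "f = length (before_block w a)"
    note f = nth_before_block[OF a, folded f_def]
    have fq: "cnt w f c = q" by (simp add: q_def f_def inversions_eq_cnt)
    have fpc: "f < pc"
    proof (rule ccontr)
      assume "\<not> f < pc"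
      moreover have "f \<noteq> pc" using f pc ac by auto
      ultimately have "Suc pc \<le> f" by simp
      then show False using cnt_mono[of "Suc pc" f w c] pc fq by simp
    qed
    obtain p where p: "f \<le> p" "p < length w" "w ! p = w ! f" "\<And>r. p < r \<Longrightarrow> r < length w \<Longrightarrow> w ! r \<noteq> w ! f"
      using last_occurrence[OF f(1)] by blast
    note p = p[unfolded f(2)]
    have ppc: "p < pc"
    proof (rule ccontr)
      assume "\<not> p < pc"
      moreover have "p \<noteq> pc" using p pc ac by auto
      ultimately show False using stirling_le[OF w, of f pc p] f fpc p pc ac by auto
    qed
    have full: "cnt w r a = part s a" if "p < r" for r
    proof (rule ccontr)
      assume "cnt w r a \<noteq> part s a"
      then have "cnt w r a < cnt w (length w) a"
        using cnt_le[of r w a] stirling_count[OF w, of a] ac by simp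
      then obtain r' where "r \<le> r'" "r' < length w" "w ! r' = a" by (rule cnt_less_ex)
      then show False using p(4)[of r'] that by simp
    qed
    \<comment> \<open>\<open>Max I\<close> will be the position \<open>i\<close> of
      \<open>upper_bound_inversions\<close>; the empty prefix keeps \<open>I\<close>
      nonempty.\<close>
    define I where "I = {l \<in> cuts w A. l \<le> pc \<and> c \<le> level w l}"
    have fin: "finite I" unfolding I_def by (rule finite_subset[of _ "{..pc}"]) auto
    have "0 \<in> I" using ac by (simp add: I_def)
    then have I: "Max I \<in> I" using fin by (intro Max_in) auto
    have Ip: "Max I \<le> p"
    proof (rule ccontr)
      assume "\<not> Max I \<le> p"
      then have "cnt w (Max I) a = part s a" by (intro full) simp
      then have "inversions z c a \<le> cnt w (Max I) c"
        using compat[of "Max I"] I ac unfolding compatible_def I_def by (auto simp: entry_prefix_route)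
      also have "\<dots> \<le> q" using I pcq cnt_mono[of "Max I" pc w c] by (simp add: I_def)
      finally show False using False q_def by simp
    qed
    have lev: "level w l < c" if "l \<in> cuts w A" "Max I < l" "l \<le> pc" for l
    proof (rule ccontr)
      assume "\<not> ?thesis"
      then have "l \<in> I" using that by (simp add: I_def)
      then show False using Max_ge[OF fin] that by fastforce
    qed
    have Ic: "c \<le> level w (Max I)" using I by (simp add: I_def)
    have pless: "w ! p < c" using p ac by simp
    have plast: "w ! r \<noteq> w ! p" if "p < r" "r < length w" for r using p(4)[OF that] p(3) by simp
    have "cnt w (Suc pc) c \<le> inversions y c (w ! p)"
      by (rule upper_bound_inversions[OF w A wy ty pc(1) Ic lev pc(2)[symmetric] Ip ppc pless plast])
    then have ya: "Suc q \<le> inversions y c a" using pc p by simp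
    obtain q' where q': "Suc pc \<le> q'" "q' \<in> cuts w A" "\<And>r. pc < r \<Longrightarrow> r < q' \<Longrightarrow> w ! pc < w ! r"
      using next_cut[OF A pc(1)] by blast
    have lq: "c \<le> level w q'" using le_level[OF w, of pc q'] q' pc by (auto simp: cuts_def)
    have "cnt w q' a = part s a" using full q' ppc by simp
    with lq have "inversions z c a \<le> cnt w q' c"
      using compat[OF q'(2)] ac unfolding compatible_def by (auto simp: entry_prefix_route)
    moreover have "cnt w q' c \<le> Suc q"
    proof (rule ccontr)
      assume "\<not> ?thesis"
      then have "cnt w (Suc pc) c < cnt w q' c" using pc by simp
      then obtain r where "Suc pc \<le> r" "r < q'" "w ! r = c" by (rule cnt_less_ex)
      then show False using q'(3)[of r] pc by simp
    qed
    ultimately show ?thesis using ya by simp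
  qed
qed

section \<open>The order on faces as reversed inclusion of cliques\<close>

lemma weak_le_antisym:
  assumes "w \<in> stirling_perms s" "z \<in> stirling_perms s" "weak_le s w z" "weak_le s z w"
  shows "w = z"
  using assms by (intro inversions_inject) (auto simp: weak_le_def intro: antisym)

lemma join_ascents_eq:
  assumes w: "w \<in> stirling_perms s" and A: "A \<subseteq> ascents w" and top: "face_top w A z"
  shows "join_ascents s w A = z"
  unfolding join_ascents_def weak_join_def
proof (rule the_equality)
  have z: "z \<in> stirling_perms s" using top by (simp add: face_top_def)
  have ub: "weak_le s u z" if "u \<in> insert w (transpose_ascent w ` A)" for u
  proof (rule weak_le_face_top[OF w top])
    show "u \<in> stirling_perms s" using that transpose_ascent(1)[OF w] A w by auto
    show "face_routes w A \<subseteq> word_routes u"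
      using that face_routes_transpose[OF w A] face_routes_word_routes[of w A] by auto
  qed
  have least: "weak_le s z y" if "\<forall>u\<in>insert w (transpose_ascent w ` A). weak_le s u y" for y
    using that by (intro face_top_least[OF w A _ _ top]) auto
  show "z \<in> stirling_perms s \<and> (\<forall>u\<in>insert w (transpose_ascent w ` A). weak_le s u z) \<and>
      (\<forall>y\<in>stirling_perms s. (\<forall>u\<in>insert w (transpose_ascent w ` A). weak_le s u y) \<longrightarrow> weak_le s z y)"
    using z ub least by blast
  fix z' assume "z' \<in> stirling_perms s \<and> (\<forall>u\<in>insert w (transpose_ascent w ` A). weak_le s u z') \<and>
      (\<forall>y\<in>stirling_perms s. (\<forall>u\<in>insert w (transpose_ascent w ` A). weak_le s u y) \<longrightarrow> weak_le s z' y)"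
  then show "z' = z" using z ub least by (intro weak_le_antisym) blast+
qed

lemma join_ascents_interval:
  assumes "w \<in> stirling_perms s" "A \<subseteq> ascents w" "face_top w A z"
  shows "weak_interval s w (join_ascents s w A) = {y \<in> stirling_perms s. face_routes w A \<subseteq> word_routes y}"
  using join_ascents_eq[OF assms] weak_interval_face_top[OF assms] by simp

text \<open>An interval consists of the words whose prefixes give all routes of the face, so larger
  cliques give smaller intervals. Conversely, suppose \<open>A\<close> drops from \<open>w\<close> a
  route of the second face. The transposition along that ascent loses this route, yet the transposed
  word lies in the first interval.\<close>

lemma perm_face_le_iff:
  assumes top: "\<And>w A. (w, A) \<in> perm_faces s \<Longrightarrow> \<exists>z. face_top w A z"
    and X: "(w, A) \<in> perm_faces s" and Y: "(w', A') \<in> perm_faces s"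
  shows "perm_face_le s (w, A) (w', A') \<longleftrightarrow> face_routes w' A' \<subseteq> face_routes w A"
proof -
  have w: "w \<in> stirling_perms s" and A: "A \<subseteq> ascents w" using X by (auto simp: perm_faces_def)
  have w': "w' \<in> stirling_perms s" and A': "A' \<subseteq> ascents w'" using Y by (auto simp: perm_faces_def)
  have eq: "perm_face_le s (w, A) (w', A') \<longleftrightarrow>
      {y \<in> stirling_perms s. face_routes w A \<subseteq> word_routes y} \<subseteq> {y \<in> stirling_perms s. face_routes w' A' \<subseteq> word_routes y}"
  proof -
    obtain z z' where "face_top w A z" "face_top w' A' z'" using top X Y by blast
    then show ?thesis
      using join_ascents_interval[OF w A] join_ascents_interval[OF w' A'] by (simp add: perm_face_le_def)
  qed
  have "face_routes w' A' \<subseteq> face_routes w A"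
    if sub: "{y \<in> stirling_perms s. face_routes w A \<subseteq> word_routes y} \<subseteq> {y \<in> stirling_perms s. face_routes w' A' \<subseteq> word_routes y}"
  proof
    fix R assume R: "R \<in> face_routes w' A'"
    have "R \<in> word_routes w" using sub R w face_routes_word_routes by blast
    then obtain p where p: "R = prefix_route w p" "p \<le> length w" by (auto simp: word_routes_def)
    have "p \<in> cuts w A"
    proof (rule ccontr)
      assume "p \<notin> cuts w A"
      then have q: "0 < p" "p < length w" "(w ! (p - 1), w ! p) \<in> A" using p by (auto simp: cuts_def)
      let ?t = "transpose_ascent w (w ! (p - 1), w ! p)"
      have "R \<notin> word_routes ?t" using transpose_ascent(4)[OF w _ q(1,2)] q A p by blast
      moreover have "?t \<in> {y \<in> stirling_perms s. face_routes w A \<subseteq> word_routes y}"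
        using transpose_ascent(1)[OF w] face_routes_transpose[OF w A] q A by blast
      ultimately show False using sub R by blast
    qed
    then show "R \<in> face_routes w A" using p by (simp add: face_routes_def)
  qed
  then show ?thesis using eq by blast
qed

text \<open>The clique determines \<open>w\<close> as the least word giving all its routes, then the
  kept positions because prefixes have distinct routes, and these determine
  \<open>A\<close>.\<close>

lemma inj_on_face_routes:
  assumes top: "\<And>w A. (w, A) \<in> perm_faces s \<Longrightarrow> \<exists>z. face_top w A z"
  shows "inj_on (\<lambda>(w, A). face_routes w A) (perm_faces s)"
proof (rule inj_onI, clarify)
  fix w A w' A' assume X: "(w, A) \<in> perm_faces s" and Y: "(w', A') \<in> perm_faces s"
    and eq: "face_routes w A = face_routes w' A'"
  have w: "w \<in> stirling_perms s" and A: "A \<subseteq> ascents w" using X by (auto simp: perm_faces_def)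
  have w': "w' \<in> stirling_perms s" and A': "A' \<subseteq> ascents w'" using Y by (auto simp: perm_faces_def)
  have "weak_le s w w'" using eq face_routes_word_routes by (intro weak_le_face_routes[OF w A w']) metis
  moreover have "weak_le s w' w" using eq face_routes_word_routes by (intro weak_le_face_routes[OF w' A' w]) metis
  ultimately have ww: "w = w'" using w w' by (intro weak_le_antisym)
  have "cuts w A \<subseteq> {..length w}" "cuts w A' \<subseteq> {..length w}" by (auto simp: cuts_def)
  then have cc: "cuts w A = cuts w A'"
    using inj_on_image_eq_iff[OF inj_on_prefix_route[OF w]] eq ww unfolding face_routes_def by blast
  have sub: "A1 \<subseteq> A2" if "A1 \<subseteq> ascents w" "cuts w A1 = cuts w A2" for A1 A2
  proof (rule subrelI)
    fix a c assume ac: "(a, c) \<in> A1"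
    then have "(a, c) \<in> ascents w" using that(1) by blast
    then obtain p where p: "Suc p < length w" "w ! p = a" "w ! Suc p = c" by (rule ascentE)
    then have "Suc p \<notin> cuts w A2" using ac that(2) Suc_in_cuts by metis
    then show "(a, c) \<in> A2" using p by (simp add: Suc_in_cuts)
  qed
  show "w = w' \<and> A = A'" using ww sub[of A A'] sub[of A' A] A A' cc by auto
qed

end

section \<open>Every covering clique is a face\<close>

text \<open>Sorting by the number of predecessors works for any total preorder: elements of equal
  rank have the same predecessors and are related both ways.\<close>

lemma finite_chain_enumeration:
  assumes fin: "finite C" and ne: "C \<noteq> {}"
    and total: "\<forall>x\<in>C. \<forall>y\<in>C. r x y \<or> r y x" and trans: "transp_on C r"
  shows "\<exists>P m. P ` {..m::nat} = C \<and> (\<forall>i j. i \<le> j \<longrightarrow> j \<le> m \<longrightarrow> r (P i) (P j))"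
proof -
  define rank where "rank x = card {y \<in> C. r y x}" for x
  have rank: "r x y" if "x \<in> C" "y \<in> C" "rank x \<le> rank y" for x y
  proof (rule ccontr)
    assume n: "\<not> r x y"
    then have "r y x" using total that by blast
    then have "{u \<in> C. r u y} \<subseteq> {u \<in> C. r u x}" using trans that by (blast dest: transp_onD)
    then have "{u \<in> C. r u y} = {u \<in> C. r u x}"
      using that(3) fin unfolding rank_def by (intro card_seteq) auto
    then show False using n total that by blast
  qed
  obtain ys where ys: "set ys = C" using fin finite_list by blast
  define xs where "xs = sort_key rank ys"
  have xs: "set xs = C" "sorted (map rank xs)" by (auto simp: xs_def ys)
  then have ne': "xs \<noteq> []" using ne by auto
  show ?thesis
  proof (intro exI[of _ "(!) xs"] exI[of _ "length xs - 1"] conjI allI impI)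
    have "{..length xs - 1} = {..<length xs}" using ne' by (cases xs) auto
    then show "(!) xs ` {..length xs - 1} = C" using xs(1) by (auto simp: set_conv_nth)
    fix i j :: nat assume ij: "i \<le> j" "j \<le> length xs - 1"
    then have l: "j < length xs" "i < length xs" using ne' by (cases xs; auto)+
    have "rank (xs ! i) \<le> rank (xs ! j)" using sorted_nth_mono[OF xs(2) ij(1)] l by simp
    then show "r (xs ! i) (xs ! j)" using rank l xs(1) by (metis nth_mem)
  qed
qed

section \<open>Reading a chain of routes as a word\<close>

primrec fill :: "(nat \<Rightarrow> edge list) \<Rightarrow> nat \<Rightarrow> nat \<Rightarrow> nat" where
  "fill P 0 i = entry (P 0) i"
| "fill P (Suc j) i = (if i \<le> length (P (Suc j)) then entry (P (Suc j)) i else fill P j i)"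

text \<open>Each step of the chain contributes the letters whose count grows. Prefixes ending
  strictly within a step are missing from the chain, and sorting turns these positions into
  ascents.\<close>

primrec chain_word :: "(nat \<Rightarrow> edge list) \<Rightarrow> nat \<Rightarrow> nat \<Rightarrow> nat list" where
  "chain_word P N 0 = []"
| "chain_word P N (Suc j) = chain_word P N j @ sorted_list_of_set {i \<in> {1..N}. fill P j i < fill P (Suc j) i}"

lemma chain_word_prefix: "j \<le> m \<Longrightarrow> \<exists>zs. chain_word P N m = chain_word P N j @ zs"
  by (induction m) (auto simp: le_Suc_eq)

lemma take_chain_word: "j \<le> m \<Longrightarrow> take (length (chain_word P N j)) (chain_word P N m) = chain_word P N j"
  using chain_word_prefix[of j m P N] by auto

lemma length_chain_word_mono: "j \<le> m \<Longrightarrow> length (chain_word P N j) \<le> length (chain_word P N m)"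
  using chain_word_prefix[of j m P N] by auto

lemma chain_word_block:
  assumes "p < length (chain_word P N m)"
  obtains j where "j < m" "length (chain_word P N j) \<le> p" "p < length (chain_word P N (Suc j))"
proof -
  have "\<exists>j<m. length (chain_word P N j) \<le> p \<and> p < length (chain_word P N (Suc j))"
    using assms
  proof (induction m)
    case (Suc m)
    show ?case
    proof (cases "p < length (chain_word P N m)")
      case True
      then show ?thesis using Suc.IH less_SucI by blast
    next
      case False
      then show ?thesis using Suc.prems by (intro exI[of _ m]) auto
    qed
  qed simp
  then show ?thesis using that by blast
qed

lemma chain_word_nth:
  assumes "j < m" "length (chain_word P N j) \<le> p" "p < length (chain_word P N (Suc j))"
  shows "chain_word P N m ! p = sorted_list_of_set {i \<in> {1..N}. fill P j i < fill P (Suc j) i} ! (p - length (chain_word P N j))"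
proof -
  obtain zs where "chain_word P N m = chain_word P N (Suc j) @ zs" using chain_word_prefix[of "Suc j" m P N] assms by auto
  then have "chain_word P N m ! p = chain_word P N (Suc j) ! p"
    using assms(3) by (simp add: nth_append del: fill.simps chain_word.simps(2))
  then show ?thesis using assms(2) by (simp add: nth_append del: fill.simps)
qed

lemma chain_word_block_letter:
  assumes "j < m" "length (chain_word P N j) \<le> p" "p < length (chain_word P N (Suc j))"
  shows "chain_word P N m ! p \<in> {i \<in> {1..N}. fill P j i < fill P (Suc j) i}"
proof -
  have "chain_word P N m ! p \<in> set (sorted_list_of_set {i \<in> {1..N}. fill P j i < fill P (Suc j) i})"
    unfolding chain_word_nth[OF assms] using assms by (intro nth_mem) auto
  then show ?thesis by simp
qed

lemma chain_word_block_less: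
  assumes "j < m" "length (chain_word P N j) \<le> p" "p < q" "q < length (chain_word P N (Suc j))"
  shows "chain_word P N m ! p < chain_word P N m ! q"
proof -
  have "sorted_wrt (<) (sorted_list_of_set {i \<in> {1..N}. fill P j i < fill P (Suc j) i})" by simp
  then show ?thesis
    unfolding chain_word_nth[OF assms(1,2) order.strict_trans[OF assms(3,4)]]
      chain_word_nth[OF assms(1) order.trans[OF assms(2) less_imp_le[OF assms(3)]] assms(4)]
    by (rule sorted_wrt_nth_less) (use assms in auto)
qed

lemma count_sorted_list_of_set: "finite S \<Longrightarrow> count_list (sorted_list_of_set S) x = (if x \<in> S then 1 else 0)"
  using distinct_count_atmost_1[of "sorted_list_of_set S"] by (simp add: count_mset)

context composition
begin

text \<open>The three routes agree at all levels shared by all three. The top entry of the shortest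
  is strictly between 0 and the full value, which a longer route cannot have at that level, so the
  lengths are equal.\<close>

lemma route_le_cycle:
  assumes "P \<in> routes s" "Q \<in> routes s" "R \<in> routes s" "route_le P Q" "route_le Q R" "route_le R P"
  shows "P = R"
proof -
  define k where "k = min (length P) (min (length Q) (length R))"
  have eq: "entry P i = entry R i \<and> entry Q i = entry R i" if "1 \<le> i" "i \<le> k" for i
    using assms(4-6) that unfolding route_le_def k_def by (meson le_trans min.boundedE antisym)
  have k1: "1 \<le> k" using assms route_bounds(1) by (simp add: k_def)
  have len: "length X = k" if X: "X \<in> {P, Q, R}" for X
  proof (rule ccontr)
    assume n: "length X \<noteq> k"
    have X': "X \<in> routes s" using X assms by auto
    have "k < length X" using n X by (auto simp: k_def)
    then have "entry X k = 0 \<or> entry X k = part s k" using route_bounds(5)[OF X'] k1 by simp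
    moreover have "entry X k = entry R k" using X eq[of k] k1 by auto
    moreover have "\<exists>Y\<in>{P, Q, R}. length Y = k" by (auto simp: k_def min_def)
    then obtain Y where "Y \<in> {P, Q, R}" "length Y = k" by blast
    then have "0 < entry Y k" "entry Y k < part s k" "entry Y k = entry R k"
      using route_bounds(3,4)[of Y] assms eq[of k] k1 by auto
    ultimately show False by simp
  qed
  show ?thesis using eq len by (intro route_eqI assms) auto
qed

lemma cover_entry:
  assumes "C \<in> covering_cliques" "1 \<le> i" "i \<le> n" "t \<le> part s i"
  obtains Q where "Q \<in> C" "i \<le> length Q" "entry Q i = t"
proof -
  have "(i, t) \<in> edges s" using assms(2-4) by (auto simp: edges_def)
  then obtain Q where "Q \<in> C" "(i, t) \<in> set Q" using assms(1) by (auto simp: covering_cliques_def)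
  then show ?thesis using that[of Q] set_route[of Q] assms(1) by (auto simp: covering_cliques_def)
qed

text \<open>
  A clique is a chain for \<open>route_le\<close>. Carrying the last known entry forward (\<open>fill\<close>) turns its members
  into the letter counts of prefixes of the word \<open>chain_word\<close>; covering makes every step at most one.
\<close>

lemma covering_clique_face:
  assumes C: "C \<in> covering_cliques"
  shows "\<exists>w A. (w, A) \<in> perm_faces s \<and> face_routes w A = C"
proof -
  have CR: "P \<in> routes s" if "P \<in> C" for P using that C by (auto simp: covering_cliques_def)
  have "(Suc n, 1) \<in> edges s" by (simp add: edges_def)
  then have ne: "C \<noteq> {}" using C by (auto simp: covering_cliques_def)
  have fin: "finite C" using finite_routes C by (auto simp: covering_cliques_def intro: finite_subset)
  have total: "\<forall>x\<in>C. \<forall>y\<in>C. route_le x y \<or> route_le y x"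
    using C CR by (auto simp: covering_cliques_def coherent_iff)
  have trans: "transp_on C route_le"
  proof (rule transp_onI)
    fix x y z assume "x \<in> C" "y \<in> C" "z \<in> C" "route_le x y" "route_le y z"
    \<comment> \<open>By totality the alternative is \<open>route_le z x\<close>, which closes a
      cycle and forces \<open>x = z\<close>.\<close>
    then show "route_le x z" using total route_le_cycle[of x y z] CR by blast
  qed
  obtain P m where "P ` {..m::nat} = C \<and> (\<forall>i j. i \<le> j \<longrightarrow> j \<le> m \<longrightarrow> route_le (P i) (P j))"
    using finite_chain_enumeration[OF fin ne total trans] by (elim exE)
  then have Pm: "P ` {..m} = C" "\<And>i j. i \<le> j \<Longrightarrow> j \<le> m \<Longrightarrow> route_le (P i) (P j)" by blast+
  have PC: "P j \<in> C" "P j \<in> routes s" if "j \<le> m" for j using Pm(1) that CR by auto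
  have mono: "entry (P l) i \<le> entry (P j) i" if "l \<le> j" "j \<le> m" "1 \<le> i" "i \<le> length (P l)" "i \<le> length (P j)" for i l j
    using Pm(2)[OF that(1,2)] that by (simp add: route_le_def)
  have cover: "\<exists>l\<le>m. i \<le> length (P l) \<and> entry (P l) i = t" if "1 \<le> i" "i \<le> n" "t \<le> part s i" for i t
    using cover_entry[OF C that] Pm(1) by (metis (no_types, lifting) atMost_iff imageE)
  have P00: "entry (P 0) i = 0" if "1 \<le> i" "i \<le> n" "i \<le> length (P 0)" for i
    using cover[OF that(1,2), of 0] mono[of 0 _ i] that by fastforce
  \<comment> \<open>A shorter first member would have its positive top entry at a level at most
    \<open>n\<close>, where covering the bump forces the least member to have entry 0.\<close>
  have len0: "length (P 0) = Suc n"
    using route_bounds(1-3)[OF PC(2), of 0] P00[of "length (P 0)"] by (cases "length (P 0) = Suc n") auto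
  define v where "v = fill P"
  have fill_Suc: "v (Suc j) i = (if i \<le> length (P (Suc j)) then entry (P (Suc j)) i else v j i)" for i j
    by (simp add: v_def)
  have v0: "v 0 i = 0" if "1 \<le> i" "i \<le> n" for i using P00 len0 that by (simp add: v_def)
  have veq: "v j i = entry (P j) i" if "i \<le> length (P j)" for i j using that by (cases j) (auto simp: v_def)
  have ex: "\<exists>l\<le>j. i \<le> length (P l) \<and> v j i = entry (P l) i" if "i \<le> n" for i j
  proof (induction j)
    case 0 then show ?case using that len0 by (simp add: v_def)
  next
    case (Suc j) then show ?case by (auto simp: fill_Suc intro: le_SucI)
  qed
  have vmono: "v j i \<le> v (Suc j) i" if "Suc j \<le> m" "1 \<le> i" "i \<le> n" for i j
    using ex[of i j] mono[of _ "Suc j" i] that by (auto simp: fill_Suc)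
  have ub: "entry (P l) i \<le> v j i" if "l \<le> j" "j \<le> m" "1 \<le> i" "i \<le> n" "i \<le> length (P l)" for i l j
    using that
  proof (induction j)
    case (Suc j)
    show ?case
    proof (cases "l = Suc j")
      case True then show ?thesis using veq[of i "Suc j"] Suc.prems by simp
    next
      case False
      then have "entry (P l) i \<le> v j i" using Suc by auto
      also have "\<dots> \<le> v (Suc j) i" using vmono Suc.prems by simp
      finally show ?thesis .
    qed
  qed (simp add: veq)
  have vle: "v j i \<le> part s i" if "j \<le> m" "1 \<le> i" "i \<le> n" for i j
    using ex[of i j] that route_bounds(6)[OF PC(2)] by (metis le_trans)
  have vm: "v m i = part s i" if "1 \<le> i" "i \<le> n" for i
    using cover[OF that, of "part s i"] ub[of _ m i] vle[of m i] that by (metis le_antisym order_refl)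
  \<comment> \<open>A jump by two would skip a subscript that covering puts on some member
    \<open>l\<close>; by monotonicity \<open>l\<close> can lie neither up to \<open>j\<close> nor
    after it.\<close>
  have step: "v (Suc j) i \<le> Suc (v j i)" if ij: "Suc j \<le> m" "1 \<le> i" "i \<le> n" for i j
  proof (rule ccontr)
    assume less: "\<not> ?thesis"
    then have "v (Suc j) i \<noteq> v j i" by simp
    then have i: "i \<le> length (P (Suc j))" "v (Suc j) i = entry (P (Suc j)) i" by (auto simp: fill_Suc split: if_splits)
    obtain l where l: "l \<le> m" "i \<le> length (P l)" "entry (P l) i = Suc (v j i)"
      using cover[OF ij(2,3), of "Suc (v j i)"] vle[OF ij] less by auto
    show False
    proof (cases "l \<le> j")
      case True then show False using ub[of l j i] l ij by simp
    next
      case False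
      then have "entry (P (Suc j)) i \<le> entry (P l) i" using l i ij by (intro mono) auto
      then show False using l i less by simp
    qed
  qed
  define cw where "cw = chain_word P n"
  define w where "w = cw m"
  have cw_count: "count_list (cw j) i = v j i" if "j \<le> m" "1 \<le> i" "i \<le> n" for i j
    using that(1)
  proof (induction j)
    case 0 then show ?case using v0 that by (simp add: cw_def)
  next
    case (Suc j)
    have "count_list (cw (Suc j)) i = v j i + (if v j i < v (Suc j) i then 1 else 0)"
      using Suc that by (simp add: cw_def count_sorted_list_of_set v_def del: fill.simps)
    then show ?case using vmono[OF Suc.prems that(2,3)] step[OF Suc.prems that(2,3)] by auto
  qed
  have letters: "set (cw j) \<subseteq> {1..n}" for j
    by (induction j) (auto simp: cw_def simp del: fill.simps)
  have len_mono: "length (cw l) \<le> length (cw j)" if "l \<le> j" for l j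
    using length_chain_word_mono[OF that] by (simp add: cw_def)
  have take_w: "take (length (cw j)) w = cw j" if "j \<le> m" for j
    using take_chain_word[OF that] by (simp add: cw_def w_def)
  have in_block: "\<exists>j<m. length (cw j) \<le> p \<and> p < length (cw (Suc j))" if "p < length w" for p
    using chain_word_block[of p P n m] that unfolding cw_def w_def by metis
  have block_less: "w ! p < w ! q" if "j < m" "length (cw j) \<le> p" "p < q" "q < length (cw (Suc j))" for p q j
    using chain_word_block_less[of j m P n p q] that by (simp add: cw_def w_def)
  have block_letter: "v j (w ! p) < v (Suc j) (w ! p)" "1 \<le> w ! p" "w ! p \<le> n"
    if "j < m" "length (cw j) \<le> p" "p < length (cw (Suc j))" for p j
    using chain_word_block_letter[of j m P n p] that by (auto simp: cw_def w_def v_def simp del: fill.simps)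
  have w: "w \<in> stirling_perms s"
  proof -
    have "count (mset w) i = count (\<Sum>i\<in>{1..n}. replicate_mset (part s i) i) i" for i
    proof -
      have "count (\<Sum>i\<in>{1..n}. replicate_mset (part s i) i) i = (\<Sum>j\<in>{1..n}. if j = i then part s j else 0)"
        by (auto simp: count_sum intro!: sum.cong)
      moreover have "count_list w i = (if 1 \<le> i \<and> i \<le> n then part s i else 0)"
        using cw_count[of m i] vm letters[of m] unfolding w_def by (auto intro: count_notin)
      ultimately show ?thesis by (simp add: count_mset)
    qed
    then have "mset w = (\<Sum>i\<in>{1..n}. replicate_mset (part s i) i)" by (rule multiset_eqI)
    \<comment> \<open>The middle letter is added in step \<open>l\<close>, so
      \<open>P (Suc l)\<close> reaches above level \<open>a\<close>, where its entry must be 0 or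
      full; yet one \<open>a\<close> is already counted and one is still to come.\<close>
    moreover have False if pqr: "p < q" "q < r" "r < length w" "w ! p = w ! r" "w ! p < w ! q" for p q r
    proof -
      define a where "a = w ! r"
      obtain j where j: "j < m" "length (cw j) \<le> r" "r < length (cw (Suc j))" using in_block[OF pqr(3)] by blast
      have qj: "q < length (cw j)" using block_less[of j q r] j pqr by (rule_tac ccontr) auto
      have "q < length w" using pqr by simp
      then obtain l where l: "l < m" "length (cw l) \<le> q" "q < length (cw (Suc l))" using in_block by blast
      have lj: "Suc l \<le> j" using len_mono[of j l] l qj by (rule_tac ccontr) simp
      have lm: "Suc l \<le> m" using l by simp
      have "v l (w ! q) < v (Suc l) (w ! q)" using block_letter l by blast
      then have qP: "w ! q \<le> length (P (Suc l))" by (auto simp: fill_Suc split: if_splits)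
      have a: "1 \<le> a" "a \<le> n" "a < w ! q" using block_letter[OF j] pqr by (auto simp: a_def)
      have ca: "cnt w (length (cw (Suc l))) a = v (Suc l) a" using take_w[OF lm] cw_count[OF lm a(1,2)] by simp
      have "0 < cnt w (length (cw (Suc l))) a"
        using cnt_less[of 0 p "length (cw (Suc l))" w] pqr l by (simp add: a_def)
      moreover have "cnt w (length (cw (Suc l))) a < cnt w (length w) a"
        unfolding a_def using len_mono[OF lj] j pqr by (intro cnt_less) auto
      moreover have "cnt w (length w) a = part s a" using cw_count[of m a] vm a by (simp add: w_def)
      moreover have "v (Suc l) a = entry (P (Suc l)) a" using qP a by (intro veq) simp
      ultimately show False using route_bounds(5)[OF PC(2)[OF lm], of a] a qP ca by auto
    qed
    ultimately show ?thesis unfolding stirling_perms_def by blast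
  qed
  have route: "prefix_route w (length (cw j)) = P j" if "j \<le> m" for j
    using take_w[OF that] cw_count[OF that] veq by (intro prefix_route_eqI PC(2)[OF that]) simp
  define K where "K = (\<lambda>j. length (cw j)) ` {..m}"
  define A where "A = {(w ! p, w ! Suc p) |p. Suc p < length w \<and> Suc p \<notin> K}"
  have asc: "w ! p < w ! Suc p" if p: "Suc p < length w" "Suc p \<notin> K" for p
  proof -
    obtain j where j: "j < m" "length (cw j) \<le> Suc p" "Suc p < length (cw (Suc j))" using in_block[OF p(1)] by blast
    have "length (cw j) \<in> K" using j(1) by (simp add: K_def)
    then have "length (cw j) \<noteq> Suc p" using p(2) by metis
    then show ?thesis using block_less[of j p "Suc p"] j by simp
  qed
  have A: "A \<subseteq> ascents w" using asc ascents_nth by (auto simp: A_def)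
  have mem: "(w ! p, w ! Suc p) \<in> A \<longleftrightarrow> Suc p \<notin> K" if p: "Suc p < length w" for p
  proof
    assume pA: "(w ! p, w ! Suc p) \<in> A"
    then obtain q where q: "Suc q < length w" "Suc q \<notin> K" "w ! q = w ! p" by (auto simp: A_def)
    have lt: "w ! p < w ! Suc p" using pA A ascents_nth[OF p] by auto
    have "p = q" by (rule ascent_unique[OF w p lt q(1) asc[OF q(1,2)] q(3)[symmetric]])
    then show "Suc p \<notin> K" using q(2) by simp
  qed (use p in \<open>auto simp: A_def\<close>)
  have K0: "0 \<in> K" by (auto simp: K_def cw_def intro: image_eqI[of _ _ 0])
  have KN: "length w \<in> K" by (auto simp: K_def w_def)
  have Kle: "p \<le> length w" if "p \<in> K" for p using that len_mono by (auto simp: K_def w_def)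
  have "p \<in> cuts w A \<longleftrightarrow> p \<in> K" for p
  proof (cases p)
    case (Suc q)
    consider "Suc q < length w" | "Suc q = length w" | "length w < Suc q" by linarith
    then show ?thesis
    proof cases
      case 1 then show ?thesis using mem[OF 1] unfolding Suc Suc_in_cuts by simp
    next
      case 2 then show ?thesis using KN unfolding Suc by simp
    next
      case 3 then show ?thesis using Kle[of "Suc q"] unfolding Suc Suc_in_cuts by auto
    qed
  qed (use K0 in simp)
  then have "face_routes w A = prefix_route w ` K" by (auto simp: face_routes_def)
  also have "\<dots> = P ` {..m}" using route by (force simp: K_def)
  finally have "face_routes w A = C" using Pm(1) by simp
  then show ?thesis using w A by (auto simp: perm_faces_def)
qed

section \<open>Reversal: bumps against dips, words read backwards, and the existence of
  joins\<close>

definition rev_route :: "edge list \<Rightarrow> edge list" where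
  "rev_route R = edge_path (length R) (\<lambda>i. part s i - entry R i)"

lemma length_rev_route [simp]: "length (rev_route R) = length R"
  by (simp add: rev_route_def)

lemma entry_rev_route: "1 \<le> i \<Longrightarrow> i \<le> length R \<Longrightarrow> entry (rev_route R) i = part s i - entry R i"
  by (simp add: rev_route_def)

lemma rev_route_in_routes:
  assumes "R \<in> routes s" shows "rev_route R \<in> routes s"
  unfolding rev_route_def
  using route_flow_val[OF assms] by (intro edge_path_in_routes) (auto simp: flow_val_def)

lemma rev_route_rev_route:
  assumes R: "R \<in> routes s" shows "rev_route (rev_route R) = R"
  using route_bounds(6)[OF R] by (intro route_eqI rev_route_in_routes R) (auto simp: entry_rev_route)

lemma route_le_rev_route:
  assumes "route_le P Q" shows "route_le (rev_route Q) (rev_route P)"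
  using assms by (auto simp: route_le_def entry_rev_route intro: diff_le_mono2)

lemma covering_cliques_rev_route:
  assumes C: "C \<in> covering_cliques" shows "rev_route ` C \<in> covering_cliques"
proof -
  have CR: "P \<in> routes s" if "P \<in> C" for P using that C by (auto simp: covering_cliques_def)
  have "coherent s (rev_route P) (rev_route Q)" if "P \<in> C" "Q \<in> C" for P Q
  proof -
    have "coherent s P Q" using C that by (auto simp: covering_cliques_def)
    then show ?thesis using CR that route_le_rev_route by (auto simp: coherent_iff rev_route_in_routes)
  qed
  moreover have "e \<in> (\<Union>P\<in>rev_route ` C. set P)" if e: "e \<in> edges s" for e
  proof -
    obtain i t where it: "e = (i, t)" by (cases e)
    have i: "1 \<le> i" "t \<le> part s i" "(i, part s i - t) \<in> edges s"
      using e it by (auto simp: edges_def)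
    then obtain Q where Q: "Q \<in> C" "(i, part s i - t) \<in> set Q" using C by (auto simp: covering_cliques_def)
    then have "i \<le> length Q" "entry Q i = part s i - t" using set_route[OF CR[OF Q(1)]] by auto
    then have "e \<in> set (rev_route Q)"
      using set_route[OF rev_route_in_routes[OF CR[OF Q(1)]]] i it by (auto simp: entry_rev_route)
    then show ?thesis using Q by auto
  qed
  ultimately show ?thesis using CR rev_route_in_routes by (auto simp: covering_cliques_def)
qed

lemma rev_stirling:
  assumes w: "w \<in> stirling_perms s" shows "rev w \<in> stirling_perms s"
proof (rule stirling_permsI[OF w])
  fix u y v x assume eq: "rev w = u @ y # v" and "x < y"
  have "w = rev (u @ y # v)" using eq by (metis rev_rev_ident)
  then have "w = rev v @ y # rev u" by simp
  then show "x \<notin> set u \<or> x \<notin> set v" using stirling_split[OF w _ \<open>x < y\<close>] by fastforce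
qed simp

lemma cnt_rev:
  assumes w: "w \<in> stirling_perms s" and "p \<le> length w" "1 \<le> i" "i \<le> n"
  shows "cnt (rev w) (length w - p) i = part s i - cnt w p i"
proof -
  have "count_list w i = cnt w p i + count_list (drop p w) i"
    by (metis append_take_drop_id count_list_append)
  then show ?thesis using assms stirling_count[OF w, of i] by (simp add: take_rev)
qed

lemma prefix_route_rev:
  assumes w: "w \<in> stirling_perms s" and p: "p \<le> length w"
  shows "prefix_route (rev w) (length w - p) = rev_route (prefix_route w p)"
  using cnt_rev[OF w p]
  by (intro prefix_route_eqI rev_route_in_routes prefix_route_in_routes[OF w])
    (auto simp: entry_rev_route entry_prefix_route)

text \<open>The prefix of \<open>rev w\<close> that stops just short of the first \<open>a\<close>
  of \<open>w\<close> still lacks one \<open>a\<close>, so all its \<open>c\<close> count as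
  inversions of \<open>rev w\<close>; the other \<open>c\<close> precede the \<open>a\<close>-block
  in \<open>w\<close>.\<close>

lemma inversions_rev:
  assumes w: "w \<in> stirling_perms s" and ac: "1 \<le> a" "a < c" "c \<le> n"
  shows "part s c \<le> inversions w c a + inversions (rev w) c a"
proof -
  have a: "a \<in> set w" using stirling_set[OF w] ac by auto
  define f where "f = length (before_block w a)"
  note f = nth_before_block[OF a, folded f_def]
  have "cnt w (Suc f) a = 1" using f cnt_before_block[of w a] by (simp add: cnt_Suc f_def)
  then have "cnt (rev w) (length w - Suc f) a < part s a"
    using cnt_rev[OF w, of "Suc f" a] f ac part_pos[of a] by simp
  then have "cnt (rev w) (length w - Suc f) c \<le> inversions (rev w) c a"
    using ac by (intro cnt_le_inversions[OF rev_stirling[OF w]]) auto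
  moreover have "cnt w (Suc f) c = inversions w c a" using f ac by (simp add: cnt_Suc inversions_eq_cnt f_def)
  ultimately show ?thesis using cnt_rev[OF w, of "Suc f" c] f ac by simp
qed

text \<open>Reversing the clique gives a covering clique again, hence a face
  \<open>(w', A')\<close>, and \<open>rev w'\<close> is the top. The witnesses of
  \<open>face_routes_lower\<close> for \<open>w'\<close> turn into routes with \<open>a\<close>
  complete; their entries at \<open>c\<close> are bounded above by \<open>inversions_rev\<close> and
  below by compatibility.\<close>

lemma face_top_exists:
  assumes "(w, A) \<in> perm_faces s"
  shows "\<exists>z. face_top w A z"
proof -
  have w: "w \<in> stirling_perms s" and A: "A \<subseteq> ascents w" using assms by (auto simp: perm_faces_def)
  let ?C = "face_routes w A"
  obtain w' A' where X: "(w', A') \<in> perm_faces s" and eq: "face_routes w' A' = rev_route ` ?C"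
    using covering_clique_face[OF covering_cliques_rev_route[OF face_routes_covering[OF w A]]] by blast
  have w': "w' \<in> stirling_perms s" and A': "A' \<subseteq> ascents w'" using X by (auto simp: perm_faces_def)
  note z = rev_stirling[OF w']
  have sub: "?C \<subseteq> word_routes (rev w')"
  proof
    fix R assume R: "R \<in> ?C"
    then have "rev_route R \<in> word_routes w'" using eq face_routes_word_routes by blast
    then obtain p where p: "p \<le> length w'" "rev_route R = prefix_route w' p" by (auto simp: word_routes_def)
    have "prefix_route (rev w') (length w' - p) = rev_route (rev_route R)"
      using prefix_route_rev[OF w' p(1)] p(2) by simp
    also have "\<dots> = R" using R face_routes_subset[OF w] by (intro rev_route_rev_route) auto
    finally show "R \<in> word_routes (rev w')" by (auto simp: word_routes_def intro!: image_eqI[of _ _ "length w' - p"])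
  qed
  have "\<exists>R\<in>?C. c \<le> length R \<and> entry R a = part s a \<and> entry R c = inversions (rev w') c a"
    if ac: "1 \<le> a" "a < c" "c \<le> n" for a c
  proof -
    obtain R' where R': "R' \<in> face_routes w' A'" "c \<le> length R'" "entry R' a = 0" "entry R' c = inversions w' c a"
      using face_routes_lower[OF w' A' ac] by blast
    then obtain R where R: "R \<in> ?C" "R' = rev_route R" using eq by blast
    have Rr: "R \<in> routes s" using R face_routes_subset[OF w] by blast
    then have RR: "R = rev_route R'" using R rev_route_rev_route by simp
    have len: "c \<le> length R" using R R' by simp
    have ea: "entry R a = part s a" using R' ac by (simp add: RR entry_rev_route)
    have "entry R c = part s c - inversions w' c a" using R' ac by (simp add: RR entry_rev_route)
    then have "entry R c \<le> inversions (rev w') c a" using inversions_rev[OF w' ac] by simp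
    moreover have "compatible R (rev w')" using word_routes_iff[OF z Rr] sub R by blast
    then have "inversions (rev w') c a \<le> entry R c" using ea len ac unfolding compatible_def by blast
    ultimately show ?thesis using R len ea by (intro bexI[of _ R]) auto
  qed
  then have "face_top w A (rev w')" using z sub by (simp add: face_top_def)
  then show ?thesis by blast
qed

lemma bij_betw_face_routes: "bij_betw (\<lambda>(w, A). face_routes w A) (perm_faces s) covering_cliques"
  unfolding bij_betw_def
proof
  show "inj_on (\<lambda>(w, A). face_routes w A) (perm_faces s)" by (intro inj_on_face_routes face_top_exists)
  show "(\<lambda>(w, A). face_routes w A) ` perm_faces s = covering_cliques"
  proof (intro equalityI subsetI)
    fix C assume "C \<in> covering_cliques"
    then show "C \<in> (\<lambda>(w, A). face_routes w A) ` perm_faces s" using covering_clique_face[of C] by force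
  qed (auto simp: perm_faces_def face_routes_covering)
qed

end

section \<open>Cells of the arrangement\<close>

lemma lookup_scaleR: "Poly_Mapping.lookup (r *\<^sub>R x) i = r *\<^sub>R Poly_Mapping.lookup x i"
proof -
  have "finite {i. r *\<^sub>R Poly_Mapping.lookup x i \<noteq> 0}"
    by (rule finite_subset[OF _ finite_lookup[of x]]) auto
  then show ?thesis by (simp add: scaleR_poly_mapping_def)
qed

lemma Rn_iff: "x \<in> Rn N \<longleftrightarrow> (\<forall>i. i \<notin> {1..N} \<longrightarrow> Poly_Mapping.lookup x i = 0)"
  by (auto simp: Rn_def in_keys_iff subset_iff)

lemma norm_poly_mapping_eq: "norm x = (\<Sum>i\<in>Poly_Mapping.keys x. norm (Poly_Mapping.lookup x i))"
  by (simp add: norm_poly_mapping_def dist_poly_mapping_def)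

lemma norm_lookup_le: "norm (Poly_Mapping.lookup x i) \<le> norm x"
proof (cases "i \<in> Poly_Mapping.keys x")
  case True
  then show ?thesis unfolding norm_poly_mapping_eq by (intro member_le_sum) auto
qed (simp add: in_keys_iff)

section \<open>Route vectors and linear functionals\<close>

lemma lookup_route_vec: "Poly_Mapping.lookup (route_vec R) e = (if e \<in> set R then 1 else 0)"
  by (auto simp: route_vec_def lookup_sum lookup_single when_def)

lemma linear_route_vec:
  fixes \<phi> :: "(edge \<Rightarrow>\<^sub>0 real) \<times> real \<Rightarrow> real"
  assumes "linear \<phi>"
  shows "\<phi> (route_vec R, z) = (\<Sum>e\<in>set R. \<phi> (Poly_Mapping.single e 1, 0)) + z * \<phi> (0, 1)"
proof -
  interpret linear \<phi> by fact
  have "(route_vec R, z) = (\<Sum>e\<in>set R. (Poly_Mapping.single e 1, 0)) + z *\<^sub>R (0, 1)"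
    by (simp add: route_vec_def sum_prod)
  then show ?thesis by (simp only: add scale sum) simp
qed

definition edge_weight :: "edge set \<Rightarrow> (edge \<Rightarrow> real) \<Rightarrow> (edge \<Rightarrow>\<^sub>0 real) \<Rightarrow> real" where
  "edge_weight E y v = (\<Sum>e\<in>E. y e * Poly_Mapping.lookup v e)"

lemma linear_edge_weight: "linear (edge_weight E y)"
  by (rule linearI)
    (auto simp: edge_weight_def lookup_add lookup_scaleR algebra_simps sum.distrib sum_distrib_left)

lemma edge_weight_route_vec:
  assumes "finite E" "set R \<subseteq> E"
  shows "edge_weight E y (route_vec R) = (\<Sum>e\<in>set R. y e)"
proof -
  have "edge_weight E y (route_vec R) = (\<Sum>e\<in>E. if e \<in> set R then y e else 0)"
    by (auto simp: edge_weight_def lookup_route_vec intro: sum.cong)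
  also have "\<dots> = (\<Sum>e\<in>E \<inter> set R. y e)" using assms(1) by (simp add: sum.inter_restrict)
  finally show ?thesis using assms(2) by (simp add: Int_absorb1)
qed

text \<open>Compared with \<open>trop_indices\<close> this includes \<open>k = 1\<close>. There the
  minimum has a single term, so it defines no hypersurface, but its routes belong to
  \<open>cell_routes\<close> at every point.\<close>

definition source_edges :: "nat list \<Rightarrow> (nat \<times> nat) set" where
  "source_edges s = {(k, t). 1 \<le> k \<and> k \<le> Suc (length s) \<and> 1 \<le> t \<and> t < part s k}"

definition cell_routes :: "nat list \<Rightarrow> (edge list \<Rightarrow> real) \<Rightarrow> (nat \<Rightarrow>\<^sub>0 real) \<Rightarrow> edge list set" where
  "cell_routes s h x = {route s k t \<delta> |k t \<delta>. (k, t) \<in> source_edges s \<and> \<delta> \<in> min_terms s h k t x}"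

lemma finite_bits: "finite (bits k)"
  by (auto simp: bits_def intro: finite_PiE)

lemma bits_nonempty: "bits k \<noteq> {}"
  by (auto simp: bits_def PiE_eq_empty_iff)

lemma trop_poly_le: "\<delta> \<in> bits k \<Longrightarrow> trop_poly s h k t x \<le> trop_term s h k t x \<delta>"
  by (simp add: trop_poly_def finite_bits)

lemma min_terms_nonempty: "min_terms s h k t x \<noteq> {}"
proof -
  have "trop_poly s h k t x \<in> trop_term s h k t x ` bits k"
    unfolding trop_poly_def using finite_bits bits_nonempty by (intro Min_in) auto
  then show ?thesis by (auto simp: min_terms_def)
qed

lemma min_terms_iff:
  "\<delta> \<in> min_terms s h k t x \<longleftrightarrow> \<delta> \<in> bits k \<and> (\<forall>\<delta>'\<in>bits k. trop_term s h k t x \<delta> \<le> trop_term s h k t x \<delta>')"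
proof
  assume r: "\<delta> \<in> bits k \<and> (\<forall>\<delta>'\<in>bits k. trop_term s h k t x \<delta> \<le> trop_term s h k t x \<delta>')"
  obtain \<delta>0 where "\<delta>0 \<in> min_terms s h k t x" using min_terms_nonempty by blast
  then have "trop_term s h k t x \<delta> \<le> trop_poly s h k t x" using r by (auto simp: min_terms_def)
  then show "\<delta> \<in> min_terms s h k t x" using r trop_poly_le[of \<delta> k s h t x] by (auto simp: min_terms_def)
next
  assume "\<delta> \<in> min_terms s h k t x"
  then show "\<delta> \<in> bits k \<and> (\<forall>\<delta>'\<in>bits k. trop_term s h k t x \<delta> \<le> trop_term s h k t x \<delta>')"
    using trop_poly_le[of _ k s h t x] by (auto simp: min_terms_def)
qed

lemma bits_1: "bits (Suc 0) = {\<lambda>_. undefined}"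
  by (simp add: bits_def)

lemma min_terms_1: "min_terms s h (Suc 0) t x = bits (Suc 0)"
  using min_terms_iff[of _ s h "Suc 0" t x] by (auto simp: bits_1)

lemma trop_term_midpoint:
  "trop_term s h k t ((1/2) *\<^sub>R (x + y)) \<delta> = (trop_term s h k t x \<delta> + trop_term s h k t y \<delta>) / 2"
  by (simp add: trop_term_def lookup_scaleR lookup_add algebra_simps sum.distrib add_divide_distrib flip: sum_divide_distrib)

text \<open>Terms are affine, so their values average. A term minimal at the midpoint has no larger
  sum of values than a common minimal term, hence ties with it at both points.\<close>

lemma min_terms_midpoint:
  assumes "min_terms s h k t x \<inter> min_terms s h k t y \<noteq> {}"
  shows "min_terms s h k t ((1/2) *\<^sub>R (x + y)) = min_terms s h k t x \<inter> min_terms s h k t y"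
proof (intro equalityI subsetI)
  obtain \<epsilon> where \<epsilon>: "\<epsilon> \<in> min_terms s h k t x" "\<epsilon> \<in> min_terms s h k t y" using assms by auto
  then have \<epsilon>b: "\<epsilon> \<in> bits k" by (simp add: min_terms_def)
  fix \<delta> assume \<delta>: "\<delta> \<in> min_terms s h k t ((1/2) *\<^sub>R (x + y))"
  then have \<delta>b: "\<delta> \<in> bits k" by (simp add: min_terms_def)
  have "trop_term s h k t ((1/2) *\<^sub>R (x + y)) \<delta> \<le> trop_term s h k t ((1/2) *\<^sub>R (x + y)) \<epsilon>"
    using \<delta> \<epsilon>b by (simp add: min_terms_iff)
  then have "trop_term s h k t x \<delta> + trop_term s h k t y \<delta> \<le> trop_term s h k t x \<epsilon> + trop_term s h k t y \<epsilon>"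
    unfolding trop_term_midpoint by simp
  moreover have "trop_term s h k t x \<epsilon> \<le> trop_term s h k t x \<delta>" "trop_term s h k t y \<epsilon> \<le> trop_term s h k t y \<delta>"
    using \<epsilon> \<delta>b by (auto simp: min_terms_iff)
  ultimately have "trop_term s h k t x \<delta> = trop_term s h k t x \<epsilon>" "trop_term s h k t y \<delta> = trop_term s h k t y \<epsilon>"
    by linarith+
  then show "\<delta> \<in> min_terms s h k t x \<inter> min_terms s h k t y" using \<epsilon> \<delta>b by (simp add: min_terms_def)
next
  fix \<delta> assume "\<delta> \<in> min_terms s h k t x \<inter> min_terms s h k t y"
  then show "\<delta> \<in> min_terms s h k t ((1/2) *\<^sub>R (x + y))"
    by (auto simp: min_terms_iff trop_term_midpoint intro!: divide_right_mono add_mono)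
qed

lemma trop_term_shift:
  "trop_term s h k t (x + Poly_Mapping.single i r) \<delta> =
     trop_term s h k t x \<delta> + (if 1 \<le> i \<and> i < k then real (\<delta> i) * r else 0)"
proof -
  have "(\<Sum>j\<in>{1..<k}. real (\<delta> j) * Poly_Mapping.lookup (Poly_Mapping.single i r) j) =
      (\<Sum>j\<in>{1..<k}. if j = i then real (\<delta> j) * r else 0)"
    by (intro sum.cong) (auto simp: lookup_single when_def)
  then show ?thesis by (simp add: trop_term_def lookup_add algebra_simps sum.distrib)
qed

context composition
begin

lemma route_edge_path:
  "1 \<le> k \<Longrightarrow> route s k t \<delta> = edge_path k (\<lambda>i. if i = k then t else \<delta> i * part s i)"
  by (auto simp: route_def edge_path_def)

lemma source_edges_pos: "(k, t) \<in> source_edges s \<Longrightarrow> 1 \<le> k"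
  by (simp add: source_edges_def)

lemma bits_cases: "\<delta> \<in> bits k \<Longrightarrow> 1 \<le> i \<Longrightarrow> i < k \<Longrightarrow> \<delta> i = 0 \<or> \<delta> i = 1"
  by (auto simp: bits_def PiE_iff)

lemma route_in_routes:
  assumes kt: "(k, t) \<in> source_edges s" and \<delta>: "\<delta> \<in> bits k"
  shows "route s k t \<delta> \<in> routes s"
proof -
  have "\<delta> i * part s i = 0 \<or> \<delta> i * part s i = part s i" if "1 \<le> i" "i < k" for i
    using bits_cases[OF \<delta> that] by auto
  then show ?thesis
    unfolding route_edge_path[OF source_edges_pos[OF kt]]
    using kt by (intro edge_path_in_routes) (auto simp: flow_val_def source_edges_def)
qed

lemma length_route: "(k, t) \<in> source_edges s \<Longrightarrow> length (route s k t \<delta>) = k"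
  using route_edge_path[OF source_edges_pos, of k t t \<delta>] by simp

lemma entry_route:
  "(k, t) \<in> source_edges s \<Longrightarrow> 1 \<le> i \<Longrightarrow> i \<le> k \<Longrightarrow> entry (route s k t \<delta>) i = (if i = k then t else \<delta> i * part s i)"
  using route_edge_path[OF source_edges_pos, of k t t \<delta>] by simp

lemma routes_cases:
  assumes R: "R \<in> routes s"
  obtains k t \<delta> where "(k, t) \<in> source_edges s" "\<delta> \<in> bits k" "R = route s k t \<delta>"
proof -
  note b = route_bounds[OF R]
  define k t where "k = length R" and "t = entry R k"
  define \<delta> where "\<delta> = restrict (\<lambda>i. if entry R i = 0 then 0 else 1 :: nat) {1..<k}"
  have kt: "(k, t) \<in> source_edges s" using b by (simp add: source_edges_def k_def t_def)
  have \<delta>: "\<delta> \<in> bits k" by (auto simp: \<delta>_def bits_def)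
  have "entry R i = entry (route s k t \<delta>) i" if "1 \<le> i" "i \<le> length R" for i
    using b(5)[of i] that entry_route[OF kt, of i \<delta>] by (auto simp: \<delta>_def k_def t_def)
  then have "R = route s k t \<delta>"
    using length_route[OF kt] by (intro route_eqI[OF R route_in_routes[OF kt \<delta>]]) (auto simp: k_def)
  then show ?thesis using that kt \<delta> by blast
qed

lemma route_inject:
  assumes kt: "(k, t) \<in> source_edges s" "(k', t') \<in> source_edges s" and \<delta>: "\<delta> \<in> bits k" "\<delta>' \<in> bits k'"
    and eq: "route s k t \<delta> = route s k' t' \<delta>'"
  shows "k = k' \<and> t = t' \<and> \<delta> = \<delta>'"
proof -
  have k: "k = k'" using arg_cong[OF eq, of length] kt by (simp add: length_route)
  have e: "(if i = k then t else \<delta> i * part s i) = (if i = k then t' else \<delta>' i * part s i)" if "1 \<le> i" "i \<le> k" for i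
    using that arg_cong[OF eq, of "\<lambda>R. entry R i"] kt k by (simp add: entry_route)
  have "t = t'" using e[of k] source_edges_pos[OF kt(1)] by simp
  moreover have "\<delta> = \<delta>'"
  proof
    fix i show "\<delta> i = \<delta>' i"
    proof (cases "1 \<le> i \<and> i < k")
      case True
      then have "0 < part s i" using kt(1) by (intro part_pos) (auto simp: source_edges_def)
      then show ?thesis using e[of i] True by simp
    next
      case False
      then show ?thesis using \<delta> k by (auto simp: bits_def PiE_iff extensional_def)
    qed
  qed
  ultimately show ?thesis using k by simp
qed

lemma route_in_cell_routes:
  assumes "(k, t) \<in> source_edges s" "\<delta> \<in> bits k"
  shows "route s k t \<delta> \<in> cell_routes s h x \<longleftrightarrow> \<delta> \<in> min_terms s h k t x"
proof
  assume "route s k t \<delta> \<in> cell_routes s h x"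
  then obtain k' t' \<delta>' where *: "(k', t') \<in> source_edges s" "\<delta>' \<in> min_terms s h k' t' x"
    "route s k t \<delta> = route s k' t' \<delta>'" by (auto simp: cell_routes_def)
  have "\<delta>' \<in> bits k'" using *(2) by (simp add: min_terms_def)
  then have "k = k' \<and> t = t' \<and> \<delta> = \<delta>'" by (intro route_inject assms *)
  then show "\<delta> \<in> min_terms s h k t x" using *(2) by simp
qed (use assms in \<open>auto simp: cell_routes_def\<close>)

lemma cell_routes_subset_routes: "cell_routes s h x \<subseteq> routes s"
  using route_in_routes by (auto simp: cell_routes_def min_terms_def)

lemma cell_routes_subset_iff:
  "cell_routes s h x \<subseteq> cell_routes s h y \<longleftrightarrow> (\<forall>(k, t)\<in>trop_indices s. min_terms s h k t x \<subseteq> min_terms s h k t y)"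
proof -
  have "cell_routes s h x \<subseteq> cell_routes s h y \<longleftrightarrow> (\<forall>(k, t)\<in>source_edges s. min_terms s h k t x \<subseteq> min_terms s h k t y)"
  proof
    assume sub: "cell_routes s h x \<subseteq> cell_routes s h y"
    have "\<delta> \<in> min_terms s h k t y" if "(k, t) \<in> source_edges s" "\<delta> \<in> min_terms s h k t x" for k t \<delta>
    proof -
      have "\<delta> \<in> bits k" using that by (simp add: min_terms_def)
      then show ?thesis using route_in_cell_routes[OF that(1)] sub that by blast
    qed
    then show "\<forall>(k, t)\<in>source_edges s. min_terms s h k t x \<subseteq> min_terms s h k t y" by auto
  qed (fastforce simp: cell_routes_def)
  also have "\<dots> \<longleftrightarrow> (\<forall>(k, t)\<in>trop_indices s. min_terms s h k t x \<subseteq> min_terms s h k t y)"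
  proof -
    have "min_terms s h k t x \<subseteq> min_terms s h k t y"
      if "(k, t) \<in> source_edges s" "\<forall>(k, t)\<in>trop_indices s. min_terms s h k t x \<subseteq> min_terms s h k t y" for k t
    proof (cases "(k, t) \<in> trop_indices s")
      case False
      then have "k = Suc 0" using that(1) by (auto simp: trop_indices_def source_edges_def)
      then show ?thesis by (simp add: min_terms_1)
    qed (use that(2) in blast)
    then have "(\<forall>(k, t)\<in>trop_indices s. min_terms s h k t x \<subseteq> min_terms s h k t y) \<longrightarrow>
        (\<forall>(k, t)\<in>source_edges s. min_terms s h k t x \<subseteq> min_terms s h k t y)" by blast
    moreover have "trop_indices s \<subseteq> source_edges s" by (auto simp: trop_indices_def source_edges_def)
    ultimately show ?thesis by (meson subset_iff)
  qed
  finally show ?thesis .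
qed

section \<open>Vertices of the flow polytope and of its lifting\<close>

lemma set_route_edges: "R \<in> routes s \<Longrightarrow> set R \<subseteq> edges s"
  by (simp add: routes_def)

lemma set_route_inject:
  assumes P: "P \<in> routes s" and Q: "Q \<in> routes s" and eq: "set P = set Q"
  shows "P = Q"
proof -
  have sub: "i \<le> length Q \<and> entry P i = entry Q i"
    if P: "P \<in> routes s" and Q: "Q \<in> routes s" and eq: "set P = set Q" and i: "1 \<le> i" "i \<le> length P" for P Q i
  proof -
    have "(i, entry P i) \<in> set Q" using set_route[OF P] i eq by auto
    then show ?thesis using set_route[OF Q] by auto
  qed
  have "length P \<le> length Q" using sub[OF P Q eq, of "length P"] route_bounds(1)[OF P] by simp
  moreover have "length Q \<le> length P" using sub[OF Q P eq[symmetric], of "length Q"] route_bounds(1)[OF Q] by simp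
  ultimately show ?thesis using sub[OF P Q eq] by (intro route_eqI[OF P Q]) auto
qed

text \<open>The functional that counts edges on \<open>R\<close> minus edges off \<open>R\<close> is maximal exactly at \<open>R\<close>.\<close>

definition vertex_weight :: "edge list \<Rightarrow> (edge \<Rightarrow>\<^sub>0 real) \<Rightarrow> real" where
  "vertex_weight R = edge_weight (edges s) (\<lambda>e. if e \<in> set R then 1 else -1)"

lemma vertex_weight_less:
  assumes R: "R \<in> routes s" and R': "R' \<in> routes s" and ne: "R' \<noteq> R"
  shows "vertex_weight R (route_vec R') + 1 \<le> vertex_weight R (route_vec R)"
proof -
  have w: "vertex_weight R (route_vec Q) = real (card (set Q \<inter> set R)) - real (card (set Q - set R))"
    if "Q \<in> routes s" for Q
  proof -
    have "vertex_weight R (route_vec Q) = (\<Sum>e\<in>set Q. if e \<in> set R then 1 else -1)"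
      unfolding vertex_weight_def using finite_edges set_route_edges[OF that] by (rule edge_weight_route_vec)
    also have "\<dots> = real (card (set Q \<inter> set R)) - real (card (set Q - set R))"
      by (simp add: sum.If_cases Diff_eq)
    finally show ?thesis .
  qed
  have "card (set R' \<inter> set R) < card (set R) \<or> 0 < card (set R' - set R)"
  proof (cases "set R' \<subseteq> set R")
    case True
    then have "set R' \<subset> set R" using set_route_inject[OF R' R] ne by auto
    then show ?thesis using True by (simp add: psubset_card_mono Int_absorb2)
  qed (auto simp: card_gt_0_iff)
  moreover have "card (set R' \<inter> set R) \<le> card (set R)" by (intro card_mono) auto
  ultimately have "card (set R' \<inter> set R) + 1 \<le> card (set R) + card (set R' - set R)" by linarith
  then show ?thesis using w[OF R] w[OF R'] by simp
qed

text \<open>The other route vectors lie in an open half-space that misses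
  \<open>route_vec R\<close>.\<close>

lemma route_vec_in_hull:
  assumes R: "R \<in> routes s" and D: "D \<subseteq> routes s" and hull: "route_vec R \<in> convex hull (route_vec ` D)"
  shows "R \<in> D"
proof (rule ccontr)
  assume n: "R \<notin> D"
  let ?H = "vertex_weight R -` {..<vertex_weight R (route_vec R)}"
  have "convex ?H" unfolding vertex_weight_def by (intro convex_linear_vimage linear_edge_weight) auto
  moreover have "route_vec ` D \<subseteq> ?H" using vertex_weight_less[OF R] D n by fastforce
  ultimately have "convex hull (route_vec ` D) \<subseteq> ?H" by (intro hull_minimal)
  then show False using hull by auto
qed

lemma height_le_hull:
  fixes h :: "edge list \<Rightarrow> real"
  assumes R: "R \<in> routes s" and hull: "(route_vec R, z) \<in> convex hull ((\<lambda>R. (route_vec R, h R)) ` routes s)"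
  shows "h R \<le> z"
proof -
  \<comment> \<open>\<open>M\<close> bounds every height difference to \<open>R\<close>, and
    \<open>vertex_weight R\<close> drops by at least 1 at any other route, so among the lifted
    routes \<psi> is minimal at the lift of \<open>R\<close>.\<close>
  define M where "M = (\<Sum>R'\<in>routes s. \<bar>h R' - h R\<bar>)"
  define \<psi> where "\<psi> p = snd p - M * vertex_weight R (fst p)" for p
  have M: "\<bar>h R' - h R\<bar> \<le> M" if "R' \<in> routes s" for R'
    unfolding M_def using finite_routes that by (intro member_le_sum) auto
  have "linear (vertex_weight R)" unfolding vertex_weight_def by (rule linear_edge_weight)
  then have lin: "linear \<psi>"
    by (intro linearI) (simp_all add: \<psi>_def linear_add linear_scale algebra_simps)
  let ?H = "\<psi> -` {\<psi> (route_vec R, h R)..}"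
  have "convex ?H" using lin by (intro convex_linear_vimage) auto
  moreover have "(\<lambda>R. (route_vec R, h R)) ` routes s \<subseteq> ?H"
  proof clarsimp
    fix R' assume R': "R' \<in> routes s"
    show "\<psi> (route_vec R, h R) \<le> \<psi> (route_vec R', h R')"
    proof (cases "R' = R")
      case False
      have "M * 1 \<le> M * (vertex_weight R (route_vec R) - vertex_weight R (route_vec R'))"
        using vertex_weight_less[OF R R' False] M[OF R'] by (intro mult_left_mono) auto
      then show ?thesis using M[OF R'] by (simp add: \<psi>_def algebra_simps)
    qed simp
  qed
  ultimately have "convex hull ((\<lambda>R. (route_vec R, h R)) ` routes s) \<subseteq> ?H" by (intro hull_minimal)
  then have "\<psi> (route_vec R, h R) \<le> \<psi> (route_vec R, z)" using hull by auto
  then show ?thesis by (simp add: \<psi>_def)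
qed

text \<open>At each level below \<open>k\<close> the bump potential is paid in any case and a dip
  adds the coordinate of \<open>x\<close>; what remains beyond the tropical term does not depend on
  \<delta>.\<close>

lemma route_weight:
  assumes kt: "(k, t) \<in> source_edges s" and \<delta>: "\<delta> \<in> bits k"
    and x: "\<And>i. 1 \<le> i \<Longrightarrow> i \<le> n \<Longrightarrow> Poly_Mapping.lookup x i = y (i, part s i) - y (i, 0)"
  shows "h (route s k t \<delta>) + (\<Sum>e\<in>set (route s k t \<delta>). y e) =
    trop_term s h k t x \<delta> + (y (k, t) + (\<Sum>i\<in>{1..<k}. y (i, 0)))"
proof -
  have kn: "k \<le> Suc n" using kt by (simp add: source_edges_def)
  have "set (route s k t \<delta>) = insert (k, t) ((\<lambda>i. (i, \<delta> i * part s i)) ` {1..<k})"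
    by (auto simp: route_def)
  moreover have "(k, t) \<notin> (\<lambda>i. (i, \<delta> i * part s i)) ` {1..<k}" by auto
  moreover have "(\<Sum>e\<in>(\<lambda>i. (i, \<delta> i * part s i)) ` {1..<k}. y e) = (\<Sum>i\<in>{1..<k}. y (i, \<delta> i * part s i))"
    by (subst sum.reindex) (auto simp: inj_on_def)
  moreover have "(\<Sum>i\<in>{1..<k}. y (i, \<delta> i * part s i)) =
      (\<Sum>i\<in>{1..<k}. real (\<delta> i) * Poly_Mapping.lookup x i + y (i, 0))"
  proof (intro sum.cong refl)
    fix i assume "i \<in> {1..<k}"
    then show "y (i, \<delta> i * part s i) = real (\<delta> i) * Poly_Mapping.lookup x i + y (i, 0)"
      using bits_cases[OF \<delta>, of i] x[of i] kn by auto
  qed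
  ultimately show ?thesis by (simp add: trop_term_def sum.distrib)
qed

text \<open>The point \<open>x\<close> defines a functional whose lower face contains the lifts of
  all routes minimal at \<open>x\<close>. By admissibility this face projects to the hull of a
  clique, and since route vectors are vertices the clique contains those routes.\<close>

lemma cell_routes_coherent:
  assumes adm: "admissible s h" and PQ: "P \<in> cell_routes s h x" "Q \<in> cell_routes s h x"
  shows "coherent s P Q"
proof -
  \<comment> \<open>Dips carry the coordinates, bumps nothing, and each source edge the negative of
    its minimum, so that the functional is nonnegative on lifted routes and vanishes exactly at the
    minimal terms.\<close>
  define y where "y e = (if snd e = 0 then 0 else if snd e = part s (fst e) then Poly_Mapping.lookup x (fst e)
    else - trop_poly s h (fst e) (snd e) x)" for e :: edge
  define \<phi> where "\<phi> p = snd p + edge_weight (edges s) y (fst p)" for p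
  let ?L = "\<lambda>R. (route_vec R, h R)"
  have lin: "linear \<phi>"
    by (intro linearI) (simp_all add: \<phi>_def linear_add[OF linear_edge_weight] linear_scale[OF linear_edge_weight] algebra_simps)
  have \<phi>01: "\<phi> (0, 1) = 1" using linear_0[OF linear_edge_weight] by (simp add: \<phi>_def)
  have part0: "part s i \<noteq> 0" if "1 \<le> i" "i \<le> n" for i using part_pos[of i] that by simp
  have val: "\<phi> (?L (route s k t \<delta>)) = trop_term s h k t x \<delta> - trop_poly s h k t x"
    if kt: "(k, t) \<in> source_edges s" and \<delta>: "\<delta> \<in> bits k" for k t \<delta>
  proof -
    have "\<phi> (?L (route s k t \<delta>)) = h (route s k t \<delta>) + (\<Sum>e\<in>set (route s k t \<delta>). y e)"
      using edge_weight_route_vec[OF finite_edges set_route_edges[OF route_in_routes[OF kt \<delta>]]] by (simp add: \<phi>_def)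
    also have "\<dots> = trop_term s h k t x \<delta> + (y (k, t) + (\<Sum>i\<in>{1..<k}. y (i, 0)))"
      by (intro route_weight[OF kt \<delta>]) (simp add: y_def part0)
    finally show ?thesis using kt by (simp add: y_def source_edges_def)
  qed
  have nonneg: "0 \<le> \<phi> (?L R)" if R: "R \<in> routes s" for R
  proof -
    obtain k t \<delta> where k: "(k, t) \<in> source_edges s" "\<delta> \<in> bits k" "R = route s k t \<delta>" using routes_cases[OF R] by blast
    then show ?thesis using val[OF k(1,2)] trop_poly_le[OF k(2)] by simp
  qed
  have "convex (\<phi> -` {0..})" using lin by (intro convex_linear_vimage) auto
  then have "convex hull (?L ` routes s) \<subseteq> \<phi> -` {0..}" using nonneg by (intro hull_minimal) auto
  then have nonneg': "0 \<le> \<phi> p" if "p \<in> convex hull (?L ` routes s)" for p using that by auto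
  define F where "F = {p \<in> convex hull (?L ` routes s). \<forall>q\<in>convex hull (?L ` routes s). \<phi> p \<le> \<phi> q}"
  have inF: "?L R \<in> F" if R: "R \<in> cell_routes s h x" for R
  proof -
    obtain k t \<delta> where k: "(k, t) \<in> source_edges s" "\<delta> \<in> min_terms s h k t x" "R = route s k t \<delta>"
      using R by (auto simp: cell_routes_def)
    then have "\<phi> (?L R) = 0" using val[of k t \<delta>] by (simp add: min_terms_def)
    moreover have "R \<in> routes s" using R cell_routes_subset_routes by blast
    then have "?L R \<in> convex hull (?L ` routes s)" by (intro hull_inc) auto
    ultimately show ?thesis using nonneg' by (simp add: F_def)
  qed
  then have "lower_face F (convex hull (?L ` routes s))"
    unfolding lower_face_def using PQ(1) lin \<phi>01 F_def by (intro conjI exI[of _ \<phi>]) auto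
  then have "fst ` F \<in> dkk_triangulation s" using adm by (auto simp: admissible_def regular_subdivision_def)
  then obtain C where C: "fst ` F = convex hull (route_vec ` C)" "C \<subseteq> routes s" "\<forall>P\<in>C. \<forall>Q\<in>C. coherent s P Q"
    by (auto simp: dkk_triangulation_def)
  have "R \<in> C" if R: "R \<in> cell_routes s h x" for R
  proof (rule route_vec_in_hull[OF _ C(2)])
    show "R \<in> routes s" using R cell_routes_subset_routes by blast
    show "route_vec R \<in> convex hull (route_vec ` C)" using inF[OF R] C(1) by force
  qed
  then show ?thesis using C(3) PQ by blast
qed

text \<open>The functional of the lower face over \<open>C\<close>, divided by its height
  coefficient, gives a potential, and dip minus bump gives \<open>x\<close>. A term minimal for
  \<open>(k, t)\<close> belongs to a route of \<open>C\<close> because \<open>C\<close> has a route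
  through this source edge, which attains the global minimum.\<close>

lemma clique_cell_routes:
  assumes adm: "admissible s h" and C: "C \<subseteq> routes s" "\<And>P Q. P \<in> C \<Longrightarrow> Q \<in> C \<Longrightarrow> coherent s P Q" "C \<noteq> {}"
    and source: "\<And>k t. (k, t) \<in> source_edges s \<Longrightarrow> \<exists>R\<in>C. (k, t) \<in> set R"
  shows "\<exists>x\<in>Rn n. cell_routes s h x = C"
proof -
  let ?L = "\<lambda>R. (route_vec R, h R)"
  let ?K = "convex hull (?L ` routes s)"
  have "convex hull (route_vec ` C) \<in> regular_subdivision s h"
    using C adm unfolding admissible_def dkk_triangulation_def by blast
  then obtain F where F: "lower_face F ?K" "fst ` F = convex hull (route_vec ` C)"
    by (auto simp: regular_subdivision_def)
  then obtain \<phi> :: "(edge \<Rightarrow>\<^sub>0 real) \<times> real \<Rightarrow> real"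
    where lin: "linear \<phi>" and pos1: "0 < \<phi> (0, 1)" and Feq: "F = {p \<in> ?K. \<forall>q\<in>?K. \<phi> p \<le> \<phi> q}"
    unfolding lower_face_def by blast
  define u where "u = \<phi> (0, 1)"
  define y where "y e = \<phi> (Poly_Mapping.single e 1, 0) / u" for e
  define x where "x = (\<Sum>i\<in>{1..n}. Poly_Mapping.single i (y (i, part s i) - y (i, 0)))"
  have lx: "Poly_Mapping.lookup x i = (if 1 \<le> i \<and> i \<le> n then y (i, part s i) - y (i, 0) else 0)" for i
    by (simp add: x_def lookup_sum lookup_single when_def)
  have xR: "x \<in> Rn n" by (simp add: Rn_iff lx)
  have \<phi>L: "\<phi> (route_vec R, z) = u * (z + (\<Sum>e\<in>set R. y e))" for R z
    using pos1 by (simp add: linear_route_vec[OF lin] y_def u_def algebra_simps sum_distrib_left)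
  have inK: "?L R \<in> ?K" if "R \<in> routes s" for R using that by (intro hull_inc) auto
  \<comment> \<open>Projection gives a point of \<open>F\<close> above \<open>route_vec R\<close> at
    some height \<open>z\<close>; by \<open>height_le_hull\<close> the lift of \<open>R\<close> is
    no higher, hence minimal too.\<close>
  have min: "\<phi> (?L R) \<le> \<phi> q" if R: "R \<in> C" and q: "q \<in> ?K" for R q
  proof -
    have "route_vec R \<in> fst ` F" using R F(2) by (auto intro: hull_inc)
    then obtain z where z: "(route_vec R, z) \<in> F" by auto
    then have "h R \<le> z" using height_le_hull[of R z h] R C(1) Feq by auto
    then have "\<phi> (?L R) \<le> \<phi> (route_vec R, z)" using pos1 by (simp add: \<phi>L u_def)
    also have "\<dots> \<le> \<phi> q" using z q Feq by auto
    finally show ?thesis .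
  qed
  have conv: "R \<in> C" if R: "R \<in> routes s" and m: "\<And>q. q \<in> ?K \<Longrightarrow> \<phi> (?L R) \<le> \<phi> q" for R
  proof (rule route_vec_in_hull[OF R C(1)])
    have "?L R \<in> F" using inK[OF R] m Feq by auto
    then show "route_vec R \<in> convex hull (route_vec ` C)" using F(2) by force
  qed
  have cmp: "\<phi> (?L (route s k t \<delta>)) \<le> \<phi> (?L (route s k t \<delta>')) \<longleftrightarrow> trop_term s h k t x \<delta> \<le> trop_term s h k t x \<delta>'"
    if "(k, t) \<in> source_edges s" "\<delta> \<in> bits k" "\<delta>' \<in> bits k" for k t \<delta> \<delta>'
    using route_weight[OF that(1,2), of x y h] route_weight[OF that(1,3), of x y h] pos1
    by (simp add: \<phi>L lx u_def)
  have "route s k t \<delta> \<in> C \<longleftrightarrow> \<delta> \<in> min_terms s h k t x" if kt: "(k, t) \<in> source_edges s" and \<delta>: "\<delta> \<in> bits k" for k t \<delta>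
  proof
    assume "route s k t \<delta> \<in> C"
    then have "\<phi> (?L (route s k t \<delta>)) \<le> \<phi> (?L (route s k t \<delta>'))" if "\<delta>' \<in> bits k" for \<delta>'
      using min inK[OF route_in_routes[OF kt that]] by blast
    then show "\<delta> \<in> min_terms s h k t x" using cmp[OF kt \<delta>] \<delta> by (simp add: min_terms_iff)
  next
    assume \<delta>m: "\<delta> \<in> min_terms s h k t x"
    obtain R where R: "R \<in> C" "(k, t) \<in> set R" using source[OF kt] by blast
    then obtain k' t' \<delta>' where R': "(k', t') \<in> source_edges s" "\<delta>' \<in> bits k'" "R = route s k' t' \<delta>'"
      using routes_cases C(1) by blast
    have Rr: "R \<in> routes s" using R(1) C(1) by blast
    have e: "k \<le> length R" "entry R k = t" using R(2) set_route[OF Rr] by auto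
    have len: "length R = k'" using length_route[OF R'(1)] R'(3) by simp
    have "\<not> k < length R" using e(2) route_bounds(5)[OF Rr, of k] kt by (auto simp: source_edges_def)
    then have "k = k'" using e(1) len by simp
    moreover have "t = t'" using e R' calculation source_edges_pos[OF kt] by (simp add: entry_route)
    ultimately have "\<phi> (?L (route s k t \<delta>)) \<le> \<phi> (?L R)"
      using \<delta>m R' cmp[OF kt \<delta>, of \<delta>'] by (simp add: min_terms_iff)
    then show "route s k t \<delta> \<in> C" using min[OF R(1)] by (intro conv route_in_routes[OF kt \<delta>]) (meson order_trans)
  qed
  note iff = this
  have "R \<in> cell_routes s h x \<longleftrightarrow> R \<in> C" if R: "R \<in> routes s" for R
  proof -
    obtain k t \<delta> where k: "(k, t) \<in> source_edges s" "\<delta> \<in> bits k" "R = route s k t \<delta>" using routes_cases[OF R] by blast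
    show ?thesis unfolding k(3) using iff[OF k(1,2)] route_in_cell_routes[OF k(1,2)] by simp
  qed
  then have "cell_routes s h x = C" using C(1) cell_routes_subset_routes by blast
  then show ?thesis using xR by blast
qed

section \<open>Cells, their boundedness and the complex\<close>

definition route_cell :: "(edge list \<Rightarrow> real) \<Rightarrow> edge list set \<Rightarrow> (nat \<Rightarrow>\<^sub>0 real) set" where
  "route_cell h C = {y \<in> Rn n. C \<subseteq> cell_routes s h y}"

text \<open>A cell is given with a separate base point for each hypersurface. A point of the cell
  with fewest minimal routes serves for all of them: its midpoint with any \<open>y\<close> of the
  cell keeps only the common minimal routes, so by the choice none is lost and \<open>y\<close> has
  them all.\<close>

lemma arrangement_complex_eq:
  "arrangement_complex s h = (\<lambda>x. route_cell h (cell_routes s h x)) ` Rn n"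
proof (intro equalityI subsetI)
  fix D assume "D \<in> arrangement_complex s h"
  then obtain c where ne: "D \<noteq> {}" and c: "\<forall>(k, t)\<in>trop_indices s. c (k, t) \<in> trop_subdivision s h k t"
    and D: "D = Rn n \<inter> (\<Inter>p\<in>trop_indices s. c p)"
    unfolding arrangement_complex_def by blast
  have "\<exists>z. \<forall>(k, t)\<in>trop_indices s. c (k, t) = {y \<in> Rn n. min_terms s h k t (z (k, t)) \<subseteq> min_terms s h k t y}"
  proof -
    have "\<forall>p\<in>trop_indices s. \<exists>z. c p = {y \<in> Rn n. min_terms s h (fst p) (snd p) z \<subseteq> min_terms s h (fst p) (snd p) y}"
      using c by (fastforce simp: trop_subdivision_def)
    then obtain z where "\<forall>p\<in>trop_indices s. c p = {y \<in> Rn n. min_terms s h (fst p) (snd p) (z p) \<subseteq> min_terms s h (fst p) (snd p) y}"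
      by (rule bchoice[THEN exE])
    then show ?thesis by (intro exI[of _ z]) auto
  qed
  then obtain z where z: "\<And>k t. (k, t) \<in> trop_indices s \<Longrightarrow> c (k, t) = {y \<in> Rn n. min_terms s h k t (z (k, t)) \<subseteq> min_terms s h k t y}"
    by blast
  have D': "y \<in> D \<longleftrightarrow> y \<in> Rn n \<and> (\<forall>(k, t)\<in>trop_indices s. min_terms s h k t (z (k, t)) \<subseteq> min_terms s h k t y)" for y
    unfolding D using z by auto
  have fin: "finite (cell_routes s h y)" for y
    using cell_routes_subset_routes finite_routes by (rule finite_subset)
  obtain x where x: "x \<in> D" and min: "\<And>y. y \<in> D \<Longrightarrow> card (cell_routes s h x) \<le> card (cell_routes s h y)"
    using ne ex_has_least_nat[of "\<lambda>y. y \<in> D" _ "\<lambda>y. card (cell_routes s h y)"] by blast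
  have "D = route_cell h (cell_routes s h x)"
  proof (intro equalityI subsetI)
    fix y assume y: "y \<in> D"
    define m where "m = (1/2) *\<^sub>R (x + y)"
    have mR: "m \<in> Rn n" using x y D' by (auto simp: m_def Rn_iff lookup_scaleR lookup_add)
    have eq: "min_terms s h k t m = min_terms s h k t x \<inter> min_terms s h k t y" if kt: "(k, t) \<in> trop_indices s" for k t
    proof -
      have "min_terms s h k t (z (k, t)) \<subseteq> min_terms s h k t x \<inter> min_terms s h k t y"
        using x y kt unfolding D' by blast
      then have "min_terms s h k t x \<inter> min_terms s h k t y \<noteq> {}" using min_terms_nonempty by blast
      then show ?thesis unfolding m_def by (rule min_terms_midpoint)
    qed
    have mD: "m \<in> D"
      unfolding D' using mR x y eq unfolding D' by blast
    have mx: "cell_routes s h m \<subseteq> cell_routes s h x" unfolding cell_routes_subset_iff using eq by auto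
    have my: "cell_routes s h m \<subseteq> cell_routes s h y" unfolding cell_routes_subset_iff using eq by auto
    have "cell_routes s h m = cell_routes s h x" using fin mx min[OF mD] by (intro card_seteq)
    then show "y \<in> route_cell h (cell_routes s h x)" using my y D' by (simp add: route_cell_def)
  next
    fix y assume y: "y \<in> route_cell h (cell_routes s h x)"
    then have "\<forall>(k, t)\<in>trop_indices s. min_terms s h k t x \<subseteq> min_terms s h k t y"
      by (simp add: route_cell_def cell_routes_subset_iff)
    moreover have "y \<in> Rn n" using y by (simp add: route_cell_def)
    ultimately show "y \<in> D" using x unfolding D' by blast
  qed
  then show "D \<in> (\<lambda>x. route_cell h (cell_routes s h x)) ` Rn n" using x D' by blast
next
  fix D assume "D \<in> (\<lambda>x. route_cell h (cell_routes s h x)) ` Rn n"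
  then obtain x where x: "x \<in> Rn n" "D = route_cell h (cell_routes s h x)" by blast
  define c where "c = (\<lambda>(k, t). {y \<in> Rn n. min_terms s h k t x \<subseteq> min_terms s h k t y})"
  have "x \<in> D" using x by (simp add: route_cell_def)
  moreover have "\<forall>(k, t)\<in>trop_indices s. c (k, t) \<in> trop_subdivision s h k t"
    using x(1) by (auto simp: c_def trop_subdivision_def)
  moreover have "D = Rn n \<inter> (\<Inter>p\<in>trop_indices s. c p)"
    unfolding x(2) route_cell_def cell_routes_subset_iff c_def by auto
  ultimately show "D \<in> arrangement_complex s h" unfolding arrangement_complex_def by blast
qed

lemma bounded_route_cell_iff:
  assumes x: "x \<in> Rn n"
  shows "bounded (route_cell h (cell_routes s h x)) \<longleftrightarrow>
    (\<forall>i. 1 \<le> i \<and> i \<le> n \<longrightarrow> (\<exists>R\<in>cell_routes s h x. (i, 0) \<in> set R) \<and> (\<exists>R\<in>cell_routes s h x. (i, part s i) \<in> set R))"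
    (is "?B \<longleftrightarrow> ?C")
proof
  assume B: ?B
  then obtain b where b: "\<And>y. y \<in> route_cell h (cell_routes s h x) \<Longrightarrow> norm y \<le> b"
    by (auto simp: bounded_iff)
  have ray: False if i: "1 \<le> i" "i \<le> n" and \<sigma>: "\<bar>\<sigma>\<bar> = 1"
    and shift: "\<And>r k t \<delta> \<delta>'. 0 \<le> r \<Longrightarrow> (k, t) \<in> source_edges s \<Longrightarrow> \<delta> \<in> min_terms s h k t x \<Longrightarrow> \<delta>' \<in> bits k \<Longrightarrow> 1 \<le> i \<Longrightarrow> i < k \<Longrightarrow>
      real (\<delta> i) * (\<sigma> * r) \<le> real (\<delta>' i) * (\<sigma> * r)" for i and \<sigma> :: real
  proof -
    \<comment> \<open>Large enough that coordinate \<open>i\<close> of \<open>y\<close> exceeds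
      \<open>b\<close> in absolute value.\<close>
    define r where "r = \<bar>b\<bar> + \<bar>Poly_Mapping.lookup x i\<bar> + 1"
    define y where "y = x + Poly_Mapping.single i (\<sigma> * r)"
    have "y \<in> Rn n" using x i by (auto simp: y_def Rn_iff lookup_add lookup_single when_def)
    moreover have "R \<in> cell_routes s h y" if R: "R \<in> cell_routes s h x" for R
    proof -
      obtain k t \<delta> where k: "(k, t) \<in> source_edges s" "\<delta> \<in> min_terms s h k t x" "R = route s k t \<delta>"
        using R by (auto simp: cell_routes_def)
      have "trop_term s h k t y \<delta> \<le> trop_term s h k t y \<delta>'" if "\<delta>' \<in> bits k" for \<delta>'
        using k(2) that shift[OF _ k(1,2) that, of r] unfolding y_def trop_term_shift min_terms_iff
        by (auto simp: r_def intro: add_mono)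
      then have "\<delta> \<in> min_terms s h k t y" using k(2) by (simp add: min_terms_iff)
      then show ?thesis using k by (auto simp: cell_routes_def)
    qed
    ultimately have "norm y \<le> b" by (intro b) (auto simp: route_cell_def)
    then have "\<bar>Poly_Mapping.lookup y i\<bar> \<le> b" using norm_lookup_le[of y i] by simp
    moreover have "\<bar>\<sigma> * r\<bar> = r" using \<sigma> by (simp add: abs_mult r_def)
    ultimately show False by (simp add: y_def lookup_add r_def)
  qed
  show ?C
  proof (intro allI impI)
    fix i assume i: "1 \<le> i \<and> i \<le> n"
    have used: "(i, \<delta> i * part s i) \<in> set (route s k t \<delta>)" "route s k t \<delta> \<in> cell_routes s h x"
      if "(k, t) \<in> source_edges s" "\<delta> \<in> min_terms s h k t x" "i < k" for k t \<delta>
      using that i by (auto simp: route_def cell_routes_def)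
    have bit: "\<delta> i = 0 \<or> \<delta> i = 1" if "\<delta> \<in> bits k" "i < k" for \<delta> k using bits_cases[OF that(1)] that i by simp
    have "\<exists>R\<in>cell_routes s h x. (i, 0) \<in> set R"
    proof (rule ccontr)
      assume n: "\<not> ?thesis"
      have one: "\<delta> i = 1" if "(k, t) \<in> source_edges s" "\<delta> \<in> min_terms s h k t x" "i < k" for k t \<delta>
        using bit[of \<delta> k] used[OF that] n that by (auto simp: min_terms_def)
      show False
      proof (rule ray[of i "-1"])
        fix r :: real and k t \<delta> \<delta>' assume "0 \<le> r" "(k, t) \<in> source_edges s" "\<delta> \<in> min_terms s h k t x" "\<delta>' \<in> bits k" "i < k"
        then show "real (\<delta> i) * (- 1 * r) \<le> real (\<delta>' i) * (- 1 * r)" using one[of k t \<delta>] bit[of \<delta>' k] by auto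
      qed (use i in auto)
    qed
    moreover have "\<exists>R\<in>cell_routes s h x. (i, part s i) \<in> set R"
    proof (rule ccontr)
      assume n: "\<not> ?thesis"
      have zero: "\<delta> i = 0" if "(k, t) \<in> source_edges s" "\<delta> \<in> min_terms s h k t x" "i < k" for k t \<delta>
        using bit[of \<delta> k] used[OF that] n that by (auto simp: min_terms_def)
      show False
      proof (rule ray[of i 1])
        fix r :: real and k t \<delta> \<delta>' assume "0 \<le> r" "(k, t) \<in> source_edges s" "\<delta> \<in> min_terms s h k t x" "\<delta>' \<in> bits k" "i < k"
        then show "real (\<delta> i) * (1 * r) \<le> real (\<delta>' i) * (1 * r)" using zero[of k t \<delta>] by simp
      qed (use i in auto)
    qed
    ultimately show "(\<exists>R\<in>cell_routes s h x. (i, 0) \<in> set R) \<and> (\<exists>R\<in>cell_routes s h x. (i, part s i) \<in> set R)" by simp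
  qed
next
  assume C: ?C
  \<comment> \<open>Two heights differ by at most \<open>2 * M\<close>, the slack in comparing a
    term with the one obtained by flipping a bit.\<close>
  define M where "M = (\<Sum>R\<in>routes s. \<bar>h R\<bar>)"
  have M: "\<bar>h R\<bar> \<le> M" if "R \<in> routes s" for R
    unfolding M_def using finite_routes that by (intro member_le_sum) auto
  have flip: "real (\<delta> i) * Poly_Mapping.lookup y i \<le> real b * Poly_Mapping.lookup y i + 2 * M"
    if kt: "(k, t) \<in> source_edges s" and \<delta>: "\<delta> \<in> min_terms s h k t y" and i: "1 \<le> i" "i < k" and b: "b \<in> {0, 1}" for k t \<delta> i b y
  proof -
    define \<delta>' where "\<delta>' = \<delta>(i := b)"
    have \<delta>b: "\<delta> \<in> bits k" using \<delta> by (simp add: min_terms_def)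
    have \<delta>'b: "\<delta>' \<in> bits k" using \<delta>b i b by (auto simp: \<delta>'_def bits_def PiE_iff extensional_def)
    have "(\<Sum>j\<in>{1..<k} - {i}. real (\<delta>' j) * Poly_Mapping.lookup y j) = (\<Sum>j\<in>{1..<k} - {i}. real (\<delta> j) * Poly_Mapping.lookup y j)"
      by (intro sum.cong) (auto simp: \<delta>'_def)
    then have "trop_term s h k t y \<delta>' - trop_term s h k t y \<delta> =
        h (route s k t \<delta>') - h (route s k t \<delta>) + (real b * Poly_Mapping.lookup y i - real (\<delta> i) * Poly_Mapping.lookup y i)"
      using i sum.remove[of "{1..<k}" i "\<lambda>j. real (\<delta>' j) * Poly_Mapping.lookup y j"]
        sum.remove[of "{1..<k}" i "\<lambda>j. real (\<delta> j) * Poly_Mapping.lookup y j"]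
      by (simp add: trop_term_def \<delta>'_def)
    moreover have "trop_term s h k t y \<delta> \<le> trop_term s h k t y \<delta>'" using \<delta> \<delta>'b by (simp add: min_terms_iff)
    ultimately show ?thesis
      using M[OF route_in_routes[OF kt \<delta>b]] M[OF route_in_routes[OF kt \<delta>'b]] by linarith
  qed
  have bound: "\<bar>Poly_Mapping.lookup y i\<bar> \<le> 2 * M" if y: "y \<in> route_cell h (cell_routes s h x)" and i: "1 \<le> i" "i \<le> n" for y i
  proof -
    have part0: "0 < part s i" using part_pos[of i] i by simp
    have ex: "\<exists>k t \<delta>. (k, t) \<in> source_edges s \<and> \<delta> \<in> min_terms s h k t y \<and> i < k \<and> \<delta> i * part s i = p"
      if R: "R \<in> cell_routes s h x" "(i, p) \<in> set R" and p: "p = 0 \<or> p = part s i" for R p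
    proof -
      have "R \<in> cell_routes s h y" using R y by (auto simp: route_cell_def)
      then obtain k t \<delta> where k: "(k, t) \<in> source_edges s" "\<delta> \<in> min_terms s h k t y" "R = route s k t \<delta>"
        by (auto simp: cell_routes_def)
      have "(i, p) \<noteq> (k, t)" using k(1) p by (auto simp: source_edges_def)
      then have "i < k \<and> \<delta> i * part s i = p" using R(2) k(3) by (auto simp: route_def)
      then show ?thesis using k by blast
    qed
    obtain R where "R \<in> cell_routes s h x" "(i, 0) \<in> set R" using C i by blast
    then obtain k t \<delta> where k: "(k, t) \<in> source_edges s" "\<delta> \<in> min_terms s h k t y" "i < k" "\<delta> i * part s i = 0"
      using ex by blast
    have "\<delta> i = 0" using k(4) part0 by simp
    then have "0 \<le> Poly_Mapping.lookup y i + 2 * M" using flip[OF k(1,2) i(1) k(3), of 1] by simp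
    moreover obtain R' where "R' \<in> cell_routes s h x" "(i, part s i) \<in> set R'" using C i by blast
    then obtain k' t' \<delta>' where k': "(k', t') \<in> source_edges s" "\<delta>' \<in> min_terms s h k' t' y" "i < k'" "\<delta>' i * part s i = part s i"
      using ex by blast
    have "\<delta>' i = 1" using k'(4) part0 by simp
    then have "Poly_Mapping.lookup y i \<le> 2 * M" using flip[OF k'(1,2) i(1) k'(3), of 0] by simp
    ultimately show ?thesis by linarith
  qed
  show ?B
  proof (rule boundedI)
    fix y assume y: "y \<in> route_cell h (cell_routes s h x)"
    have keys: "Poly_Mapping.keys y \<subseteq> {1..n}" using y by (simp add: route_cell_def Rn_def)
    have "norm y \<le> (\<Sum>i\<in>Poly_Mapping.keys y. 2 * M)"
      unfolding norm_poly_mapping_eq using bound[OF y] keys by (intro sum_mono) force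
    also have "\<dots> \<le> (\<Sum>i\<in>{1..n}. 2 * M)"
      using keys by (intro sum_mono2) (auto simp: M_def sum_nonneg)
    finally show "norm y \<le> (\<Sum>i\<in>{1..n}. 2 * M)" .
  qed
qed

lemma edges_eq: "edges s = source_edges s \<union> {(i, j). 1 \<le> i \<and> i \<le> n \<and> (j = 0 \<or> j = part s i)}"
  by (auto simp: edges_def source_edges_def)

lemma covering_clique_cell:
  assumes adm: "admissible s h" and C: "C \<in> covering_cliques"
  shows "\<exists>x\<in>Rn n. cell_routes s h x = C"
proof (rule clique_cell_routes[OF adm])
  have c: "edges s \<subseteq> (\<Union>P\<in>C. set P)" using C by (simp add: covering_cliques_def)
  show "\<exists>R\<in>C. (k, t) \<in> set R" if "(k, t) \<in> source_edges s" for k t using c that unfolding edges_eq by blast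
  have "(Suc n, 1) \<in> edges s" by (simp add: edges_def)
  then show "C \<noteq> {}" using c by blast
qed (use C in \<open>auto simp: covering_cliques_def\<close>)

text \<open>Each minimum is attained, so the minimal routes of any point use all source edges;
  boundedness supplies exactly the bumps and dips.\<close>

lemma Perm_eq:
  assumes adm: "admissible s h"
  shows "Perm s h = route_cell h ` covering_cliques"
proof -
  have source: "\<exists>R\<in>cell_routes s h x. (k, t) \<in> set R" if kt: "(k, t) \<in> source_edges s" for k t x
  proof -
    obtain \<delta> where "\<delta> \<in> min_terms s h k t x" using min_terms_nonempty by blast
    then show ?thesis using kt by (intro bexI[of _ "route s k t \<delta>"]) (auto simp: route_def cell_routes_def)
  qed
  have cov: "cell_routes s h x \<in> covering_cliques \<longleftrightarrow> bounded (route_cell h (cell_routes s h x))" if x: "x \<in> Rn n" for x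
  proof
    assume "cell_routes s h x \<in> covering_cliques"
    then have c: "edges s \<subseteq> (\<Union>P\<in>cell_routes s h x. set P)" by (simp add: covering_cliques_def)
    have "\<exists>P\<in>cell_routes s h x. e \<in> set P" if "e \<in> edges s" for e using c that by blast
    then show "bounded (route_cell h (cell_routes s h x))"
      unfolding bounded_route_cell_iff[OF x] edges_eq by blast
  next
    assume b: "bounded (route_cell h (cell_routes s h x))"
    have "edges s \<subseteq> (\<Union>P\<in>cell_routes s h x. set P)"
      unfolding edges_eq using source b[unfolded bounded_route_cell_iff[OF x]] by fastforce
    then show "cell_routes s h x \<in> covering_cliques"
      using cell_routes_subset_routes cell_routes_coherent[OF adm] by (auto simp: covering_cliques_def)
  qed
  show ?thesis
  proof (intro equalityI subsetI)
    fix D assume "D \<in> Perm s h"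
    then show "D \<in> route_cell h ` covering_cliques"
      using cov by (auto simp: Perm_def arrangement_complex_eq)
  next
    fix D assume "D \<in> route_cell h ` covering_cliques"
    then obtain C where C: "C \<in> covering_cliques" "D = route_cell h C" by blast
    then obtain x where "x \<in> Rn n" "cell_routes s h x = C" using covering_clique_cell[OF adm] by blast
    then show "D \<in> Perm s h" using cov[of x] C by (auto simp: Perm_def arrangement_complex_eq)
  qed
qed

text \<open>A point whose minimal routes are exactly \<open>C\<close> witnesses the nontrivial
  direction.\<close>

lemma route_cell_subset_iff:
  assumes adm: "admissible s h" and C: "C \<in> covering_cliques"
  shows "route_cell h C \<subseteq> route_cell h C' \<longleftrightarrow> C' \<subseteq> C"
proof
  assume sub: "route_cell h C \<subseteq> route_cell h C'"
  obtain x where x: "x \<in> Rn n" "cell_routes s h x = C" using covering_clique_cell[OF adm C] by blast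
  then have "x \<in> route_cell h C'" using sub by (auto simp: route_cell_def)
  then show "C' \<subseteq> C" using x by (simp add: route_cell_def)
qed (auto simp: route_cell_def)

end

theorem theorem6p32:
  fixes s :: "nat list" and h :: "edge list \<Rightarrow> real"
  assumes "\<forall>i\<in>set s. 0 < i"
    and "admissible s h"
  shows "\<exists>f. bij_betw f (Perm s h) (perm_faces s) \<and>
             (\<forall>C\<in>Perm s h. \<forall>D\<in>Perm s h. C \<subseteq> D \<longleftrightarrow> perm_face_le s (f C) (f D))"
proof -
  interpret composition s using assms(1) by unfold_locales blast
  define G where "G = (\<lambda>(w, A). face_routes w A)"
  \<comment> \<open>Passing to cliques reverses both the order of faces and the inclusion of cells,
    so the composite preserves order.\<close>
  define \<Psi> where "\<Psi> X = route_cell h (G X)" for X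
  have G: "bij_betw G (perm_faces s) covering_cliques" unfolding G_def by (rule bij_betw_face_routes)
  then have GC: "G X \<in> covering_cliques" if "X \<in> perm_faces s" for X using that by (rule bij_betw_apply)
  have le: "\<Psi> X \<subseteq> \<Psi> Y \<longleftrightarrow> perm_face_le s X Y" if X: "X \<in> perm_faces s" and Y: "Y \<in> perm_faces s" for X Y
    using route_cell_subset_iff[OF assms(2) GC[OF X], of "G Y"] perm_face_le_iff[OF face_top_exists] X Y
    by (cases X; cases Y) (simp add: \<Psi>_def G_def)
  have inj: "inj_on \<Psi> (perm_faces s)"
  proof (rule inj_onI)
    fix X Y assume XY: "X \<in> perm_faces s" "Y \<in> perm_faces s" "\<Psi> X = \<Psi> Y"
    then have "G X = G Y"
      using route_cell_subset_iff[OF assms(2) GC, of X "G Y"] route_cell_subset_iff[OF assms(2) GC, of Y "G X"]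
      by (auto simp: \<Psi>_def)
    then show "X = Y" using G XY by (auto simp: bij_betw_def dest: inj_onD)
  qed
  have "\<Psi> ` perm_faces s = route_cell h ` (G ` perm_faces s)" by (simp add: \<Psi>_def image_image)
  also have "\<dots> = Perm s h" using G Perm_eq[OF assms(2)] by (simp add: bij_betw_def)
  finally have bij: "bij_betw \<Psi> (perm_faces s) (Perm s h)" using inj by (simp add: bij_betw_def)
  define f where "f = the_inv_into (perm_faces s) \<Psi>"
  have f: "bij_betw f (Perm s h) (perm_faces s)" unfolding f_def by (rule bij_betw_the_inv_into[OF bij])
  have "\<Psi> (f C) = C" if "C \<in> Perm s h" for C
    unfolding f_def by (rule f_the_inv_into_f_bij_betw[OF bij that])
  then have "C \<subseteq> D \<longleftrightarrow> perm_face_le s (f C) (f D)" if "C \<in> Perm s h" "D \<in> Perm s h" for C D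
    using le[of "f C" "f D"] bij_betw_apply[OF f] that by metis
  then show ?thesis using f by blast
qed

end
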